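(* Every unital separable simple TAI $C^*$-algebra is MF.
   Context: $\mathcal I$ denotes the class of all unital $C^*$-algebras of the form $\bigoplus_{i=1}^n B_i$ (finite direct sum), where each $B_i\cong M_k$ or $B_i\cong M_k(C([0,1]))$ for some integer $k$. For projections, $p\preceq q$ means $p$ is Murray–von Neumann equivalent to a projection in $qAq$; $[p]$ is the equivalence class of $p$; for $a\in A_+$, $p\preceq a$ means $p\preceq q$ for some projection $q\in\overline{aAa}$. An element is full if the closed ideal it generates is $A$. $x\in_\varepsilon S$ means there is $y\in S$ with $\|x-y\|<\varepsilon$. A unital $C^*$-algebra $A$ is tracially AI (TAI) if for any finite subset $\mathcal F\subset A$ containing a nonzero element $b$, any $\varepsilon>0$, any integer $n>0$ and any full element $a\in A_+$, there exist a nonzero projection $p\in A$ and a $C^*$-subalgebra $I\subset A$ with $I\in\mathcal I$ and $1_I=p$ such that (1) $\|xp-px\|<\varepsilon$ for all $x\in\mathcal F$; (2) $pxp\in_\varepsilon I$ for all $x\in\mathcal F$ and $\|pbp\|\ge\|b\|-\varepsilon$; (3) $n[1-p]\le[p]$ and $1-p\preceq a$. A separable $C^*$-algebra is MF (in the sense of Blackadar and Kirchberg) if it is isomorphic to a $C^*$-subalgebra of $\prod_{n=1}^\infty M_{m(n)}/\bigoplus_{n=1}^\infty M_{m(n)}$ for some sequence of positive integers $m(n)$. *)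

theory Defs
  imports "HOL-Analysis.Analysis" "HOL-Algebra.QuotRing" "HOL-Algebra.Module"
begin

section \<open>Unital C*-algebras\<close>

text \<open>
  The axiom \<open>norm 1 = 1\<close> inherited from \<^class>\<open>real_normed_algebra_1\<close> holds in every nonzero
  unital C*-algebra; the class thus consists of the nonzero unital C*-algebras.
\<close>

class cstar_algebra_1 = real_normed_algebra_1 + banach +
  fixes scaleC :: "complex \<Rightarrow> 'a \<Rightarrow> 'a"
    and adj :: "'a \<Rightarrow> 'a"
  assumes scaleC_add_right: "scaleC c (x + y) = scaleC c x + scaleC c y"
    and scaleC_add_left: "scaleC (c + d) x = scaleC c x + scaleC d x"
    and scaleC_scaleC: "scaleC c (scaleC d x) = scaleC (c * d) x"
    and scaleC_of_real: "scaleC (complex_of_real r) x = r *\<^sub>R x"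
    and mult_scaleC_left: "scaleC c x * y = scaleC c (x * y)"
    and mult_scaleC_right: "x * scaleC c y = scaleC c (x * y)"
    and norm_scaleC: "norm (scaleC c x) = cmod c * norm x"
    and adj_adj: "adj (adj x) = x"
    and adj_add: "adj (x + y) = adj x + adj y"
    and adj_mult: "adj (x * y) = adj y * adj x"
    and adj_scaleC: "adj (scaleC c x) = scaleC (cnj c) (adj x)"
    and cstar_identity: "norm (adj x * x) = (norm x)\<^sup>2"

instantiation complex :: cstar_algebra_1
begin

definition scaleC_complex :: "complex \<Rightarrow> complex \<Rightarrow> complex"
  where "scaleC_complex c x = c * x"

definition adj_complex :: "complex \<Rightarrow> complex"
  where "adj_complex x = cnj x"

instance
  by standard
    (auto simp: scaleC_complex_def adj_complex_def algebra_simps norm_mult scaleR_conv_of_real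
      power2_eq_square)

end


section \<open>Complex *-algebras as objects\<close>

text \<open>
  Operations of a unital complex *-algebra, and of one with a norm, on an explicit carrier.
  They are used for subalgebras, matrix algebras, direct sums and quotients; no axioms are
  attached to the records themselves.
\<close>

record 'a star_alg = "(complex, 'a) module" +
  star :: "'a \<Rightarrow> 'a"

record 'a normed_star_alg = "'a star_alg" +
  nrm :: "'a \<Rightarrow> real"

definition univ_alg :: "'a::cstar_algebra_1 normed_star_alg" where
  "univ_alg = \<lparr>carrier = UNIV, monoid.mult = (*), one = 1, ring.zero = 0, add = (+),
     smult = scaleC, star = adj, nrm = norm\<rparr>"

text \<open>A *-isomorphism of C*-algebras is automatically isometric and unital.\<close>

definition star_iso :: "('a, 'x) star_alg_scheme \<Rightarrow> ('b, 'y) star_alg_scheme \<Rightarrow> ('a \<Rightarrow> 'b) \<Rightarrow> bool" where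
  "star_iso R S \<phi> \<longleftrightarrow> bij_betw \<phi> (carrier R) (carrier S) \<and>
     (\<forall>x\<in>carrier R. \<forall>y\<in>carrier R. \<phi> (x \<oplus>\<^bsub>R\<^esub> y) = \<phi> x \<oplus>\<^bsub>S\<^esub> \<phi> y) \<and>
     (\<forall>x\<in>carrier R. \<forall>y\<in>carrier R. \<phi> (x \<otimes>\<^bsub>R\<^esub> y) = \<phi> x \<otimes>\<^bsub>S\<^esub> \<phi> y) \<and>
     (\<forall>c. \<forall>x\<in>carrier R. \<phi> (c \<odot>\<^bsub>R\<^esub> x) = c \<odot>\<^bsub>S\<^esub> \<phi> x) \<and>
     (\<forall>x\<in>carrier R. \<phi> (star R x) = star S (\<phi> x))"

definition star_isomorphic :: "('a, 'x) star_alg_scheme \<Rightarrow> ('b, 'y) star_alg_scheme \<Rightarrow> bool" where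
  "star_isomorphic R S \<longleftrightarrow> (\<exists>\<phi>. star_iso R S \<phi>)"

text \<open>C*-subalgebras: norm-closed *-subalgebras, not required to contain the unit of \<open>R\<close>.\<close>

definition cstar_subalgebra :: "('a, 'x) normed_star_alg_scheme \<Rightarrow> 'a set \<Rightarrow> bool" where
  "cstar_subalgebra R S \<longleftrightarrow> S \<subseteq> carrier R \<and> \<zero>\<^bsub>R\<^esub> \<in> S \<and>
     (\<forall>x\<in>S. \<forall>y\<in>S. x \<oplus>\<^bsub>R\<^esub> y \<in> S) \<and>
     (\<forall>x\<in>S. \<forall>y\<in>S. x \<otimes>\<^bsub>R\<^esub> y \<in> S) \<and>
     (\<forall>c. \<forall>x\<in>S. c \<odot>\<^bsub>R\<^esub> x \<in> S) \<and>
     (\<forall>x\<in>S. star R x \<in> S) \<and>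
     (\<forall>x\<in>carrier R. (\<forall>e>0. \<exists>y\<in>S. nrm R (x \<ominus>\<^bsub>R\<^esub> y) < e) \<longrightarrow> x \<in> S)"

definition is_unit_of :: "('a, 'x) star_alg_scheme \<Rightarrow> 'a set \<Rightarrow> 'a \<Rightarrow> bool" where
  "is_unit_of R S u \<longleftrightarrow> u \<in> S \<and> (\<forall>x\<in>S. u \<otimes>\<^bsub>R\<^esub> x = x \<and> x \<otimes>\<^bsub>R\<^esub> u = x)"

text \<open>Matrices are indexed from \<open>0\<close> and padded with zeros outside the \<open>k \<times> k\<close> block.\<close>

definition mat_alg :: "nat \<Rightarrow> ('a, 'x) star_alg_scheme \<Rightarrow> (nat \<Rightarrow> nat \<Rightarrow> 'a) star_alg" where
  "mat_alg k R =
    \<lparr>carrier = {a. \<forall>i j. if i < k \<and> j < k then a i j \<in> carrier R else a i j = \<zero>\<^bsub>R\<^esub>},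
     monoid.mult = (\<lambda>a b i j. \<Oplus>\<^bsub>R\<^esub>l\<in>{..<k}. a i l \<otimes>\<^bsub>R\<^esub> b l j),
     one = (\<lambda>i j. if i = j \<and> i < k then \<one>\<^bsub>R\<^esub> else \<zero>\<^bsub>R\<^esub>),
     ring.zero = (\<lambda>i j. \<zero>\<^bsub>R\<^esub>),
     add = (\<lambda>a b i j. a i j \<oplus>\<^bsub>R\<^esub> b i j),
     smult = (\<lambda>c a i j. c \<odot>\<^bsub>R\<^esub> a i j),
     star = (\<lambda>a i j. star R (a j i))\<rparr>"

definition direct_sum_alg :: "nat \<Rightarrow> (nat \<Rightarrow> ('a, 'x) star_alg_scheme) \<Rightarrow> (nat \<Rightarrow> 'a) star_alg" where
  "direct_sum_alg n B =
    \<lparr>carrier = (\<Pi>\<^sub>E i\<in>{..<n}. carrier (B i)),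
     monoid.mult = (\<lambda>x y. \<lambda>i\<in>{..<n}. x i \<otimes>\<^bsub>B i\<^esub> y i),
     one = (\<lambda>i\<in>{..<n}. \<one>\<^bsub>B i\<^esub>),
     ring.zero = (\<lambda>i\<in>{..<n}. \<zero>\<^bsub>B i\<^esub>),
     add = (\<lambda>x y. \<lambda>i\<in>{..<n}. x i \<oplus>\<^bsub>B i\<^esub> y i),
     smult = (\<lambda>c x. \<lambda>i\<in>{..<n}. c \<odot>\<^bsub>B i\<^esub> x i),
     star = (\<lambda>x. \<lambda>i\<in>{..<n}. star (B i) (x i))\<rparr>"

definition C01 :: "(real \<Rightarrow> complex) star_alg" where
  "C01 =
    \<lparr>carrier = {f \<in> extensional {0..1}. continuous_on {0..1} f},
     monoid.mult = (\<lambda>f g. \<lambda>t\<in>{0..1}. f t * g t),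
     one = (\<lambda>t\<in>{0..1}. 1),
     ring.zero = (\<lambda>t\<in>{0..1}. 0),
     add = (\<lambda>f g. \<lambda>t\<in>{0..1}. f t + g t),
     smult = (\<lambda>c f. \<lambda>t\<in>{0..1}. c * f t),
     star = (\<lambda>f. \<lambda>t\<in>{0..1}. cnj (f t))\<rparr>"

abbreviation cmat_alg :: "nat \<Rightarrow> (nat \<Rightarrow> nat \<Rightarrow> complex) star_alg" where
  "cmat_alg k \<equiv> mat_alg k (univ_alg :: complex normed_star_alg)"

text \<open>
  The class \<open>\<I>\<close>. The summands \<open>B i\<close> may be taken over the element type of \<open>R\<close> without loss of
  generality, since each of them embeds into \<open>R\<close>.
\<close>

definition in_class_I :: "('a, 'x) star_alg_scheme \<Rightarrow> bool" where
  "in_class_I R \<longleftrightarrow> (\<exists>n>0. \<exists>B :: nat \<Rightarrow> 'a star_alg.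
     (\<forall>i<n. \<exists>k\<ge>1. star_isomorphic (B i) (cmat_alg k) \<or> star_isomorphic (B i) (mat_alg k C01)) \<and>
     star_isomorphic R (direct_sum_alg n B))"


section \<open>Comparison of projections\<close>

definition projections :: "('a, 'x) star_alg_scheme \<Rightarrow> 'a set" where
  "projections R = {p \<in> carrier R. p \<otimes>\<^bsub>R\<^esub> p = p \<and> star R p = p}"

definition mvn_equiv :: "('a, 'x) star_alg_scheme \<Rightarrow> 'a \<Rightarrow> 'a \<Rightarrow> bool" where
  "mvn_equiv R p q \<longleftrightarrow>
     (\<exists>v\<in>carrier R. star R v \<otimes>\<^bsub>R\<^esub> v = p \<and> v \<otimes>\<^bsub>R\<^esub> star R v = q)"

definition mvn_le :: "('a, 'x) star_alg_scheme \<Rightarrow> 'a \<Rightarrow> 'a \<Rightarrow> bool" where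
  "mvn_le R p q \<longleftrightarrow>
     (\<exists>r\<in>projections R. r \<in> (\<lambda>x. q \<otimes>\<^bsub>R\<^esub> x \<otimes>\<^bsub>R\<^esub> q) ` carrier R \<and> mvn_equiv R p r)"

text \<open>
  \<open>n[q] \<le> [p]\<close> in the Murray-von Neumann semigroup: \<open>diag(q,\<dots>,q) \<preceq> diag(p,0,\<dots>,0)\<close> in the
  \<open>n \<times> n\<close> matrices over the algebra.
\<close>

definition mvn_multiple_le :: "('a, 'x) star_alg_scheme \<Rightarrow> nat \<Rightarrow> 'a \<Rightarrow> 'a \<Rightarrow> bool" where
  "mvn_multiple_le R n q p \<longleftrightarrow>
     mvn_le (mat_alg n R)
       (\<lambda>i j. if i = j \<and> i < n then q else \<zero>\<^bsub>R\<^esub>)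
       (\<lambda>i j. if i = 0 \<and> j = 0 then p else \<zero>\<^bsub>R\<^esub>)"

definition mvn_le_pos :: "'a::cstar_algebra_1 \<Rightarrow> 'a \<Rightarrow> bool" where
  "mvn_le_pos p a \<longleftrightarrow>
     (\<exists>q\<in>projections univ_alg. q \<in> closure (range (\<lambda>x. a * x * a)) \<and> mvn_le univ_alg p q)"


section \<open>Positive and full elements, simplicity\<close>

definition spectrum :: "'a::cstar_algebra_1 \<Rightarrow> complex set" where
  "spectrum a = {z. \<not> (\<exists>b. (scaleC z 1 - a) * b = 1 \<and> b * (scaleC z 1 - a) = 1)}"

definition positive :: "'a::cstar_algebra_1 \<Rightarrow> bool" where
  "positive a \<longleftrightarrow> adj a = a \<and> (\<forall>z\<in>spectrum a. z \<in> \<real> \<and> Re z \<ge> 0)"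

text \<open>Ring ideals of a unital algebra are automatically complex subspaces.\<close>

definition closed_ideal :: "'a::cstar_algebra_1 set \<Rightarrow> bool" where
  "closed_ideal J \<longleftrightarrow> ideal J univ_alg \<and> closed J"

definition full :: "'a::cstar_algebra_1 \<Rightarrow> bool" where
  "full a \<longleftrightarrow> \<Inter>{J. closed_ideal J \<and> a \<in> J} = UNIV"

definition simple_cstar :: "'a::cstar_algebra_1 itself \<Rightarrow> bool" where
  "simple_cstar _ \<longleftrightarrow> (\<forall>J::'a set. closed_ideal J \<longrightarrow> J = {0} \<or> J = UNIV)"

definition separable_cstar :: "'a::cstar_algebra_1 itself \<Rightarrow> bool" where
  "separable_cstar _ \<longleftrightarrow> separable_space (euclidean :: 'a topology)"


section \<open>Tracially AI algebras\<close>

definition TAI :: "'a::cstar_algebra_1 itself \<Rightarrow> bool" where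
  "TAI _ \<longleftrightarrow>
     (\<forall>(F :: 'a set) b (\<epsilon> :: real) (n :: nat) a.
        finite F \<longrightarrow> b \<in> F \<longrightarrow> b \<noteq> 0 \<longrightarrow> \<epsilon> > 0 \<longrightarrow> n > 0 \<longrightarrow> positive a \<longrightarrow> full a \<longrightarrow>
        (\<exists>p I. p \<in> projections univ_alg \<and> p \<noteq> 0 \<and>
           cstar_subalgebra univ_alg I \<and> is_unit_of univ_alg I p \<and>
           in_class_I (univ_alg\<lparr>carrier := I, one := p\<rparr>) \<and>
           (\<forall>x\<in>F. norm (x * p - p * x) < \<epsilon>) \<and>
           (\<forall>x\<in>F. \<exists>y\<in>I. norm (p * x * p - y) < \<epsilon>) \<and>
           norm (p * b * p) \<ge> norm b - \<epsilon> \<and>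
           mvn_multiple_le univ_alg n (1 - p) p \<and>
           mvn_le_pos (1 - p) a))"


section \<open>MF algebras\<close>

text \<open>The operator norm of a \<open>k \<times> k\<close> matrix acting on the Hilbert space \<open>\<complex>\<^sup>k\<close>.\<close>

definition opnorm :: "nat \<Rightarrow> (nat \<Rightarrow> nat \<Rightarrow> complex) \<Rightarrow> real" where
  "opnorm k a =
     (SUP v\<in>{v :: nat \<Rightarrow> complex. L2_set (\<lambda>i. cmod (v i)) {..<k} \<le> 1}.
        L2_set (\<lambda>i. cmod (\<Sum>j<k. a i j * v j)) {..<k})"

definition mat_prod_alg :: "(nat \<Rightarrow> nat) \<Rightarrow> (nat \<Rightarrow> nat \<Rightarrow> nat \<Rightarrow> complex) normed_star_alg" where
  "mat_prod_alg m =
    \<lparr>carrier = {x. (\<forall>n. x n \<in> carrier (cmat_alg (m n))) \<and> bounded (range (\<lambda>n. opnorm (m n) (x n)))},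
     monoid.mult = (\<lambda>x y n. x n \<otimes>\<^bsub>cmat_alg (m n)\<^esub> y n),
     one = (\<lambda>n. \<one>\<^bsub>cmat_alg (m n)\<^esub>),
     ring.zero = (\<lambda>n. \<zero>\<^bsub>cmat_alg (m n)\<^esub>),
     add = (\<lambda>x y n. x n \<oplus>\<^bsub>cmat_alg (m n)\<^esub> y n),
     smult = (\<lambda>c x n. c \<odot>\<^bsub>cmat_alg (m n)\<^esub> x n),
     star = (\<lambda>x n. star (cmat_alg (m n)) (x n)),
     nrm = (\<lambda>x. SUP n. opnorm (m n) (x n))\<rparr>"

text \<open>The C*-algebraic direct sum: sequences vanishing in norm at infinity.\<close>

definition mat_c0_ideal :: "(nat \<Rightarrow> nat) \<Rightarrow> (nat \<Rightarrow> nat \<Rightarrow> nat \<Rightarrow> complex) set" where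
  "mat_c0_ideal m = {x \<in> carrier (mat_prod_alg m). (\<lambda>n. opnorm (m n) (x n)) \<longlonglongrightarrow> 0}"

text \<open>The quotient ring \<open>R Quot J\<close> with the induced scalar multiplication, involution and quotient norm.\<close>

definition quot_alg :: "('a, 'x) normed_star_alg_scheme \<Rightarrow> 'a set \<Rightarrow> 'a set normed_star_alg" where
  "quot_alg R J =
    \<lparr>carrier = carrier (R Quot J),
     monoid.mult = monoid.mult (R Quot J),
     one = \<one>\<^bsub>R Quot J\<^esub>,
     ring.zero = \<zero>\<^bsub>R Quot J\<^esub>,
     add = add (R Quot J),
     smult = (\<lambda>c X. \<Union>x\<in>X. J +>\<^bsub>R\<^esub> (c \<odot>\<^bsub>R\<^esub> x)),
     star = (\<lambda>X. star R ` X),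
     nrm = (\<lambda>X. INF x\<in>X. nrm R x)\<rparr>"

definition MF :: "('a, 'x) normed_star_alg_scheme \<Rightarrow> bool" where
  "MF A \<longleftrightarrow> (\<exists>m :: nat \<Rightarrow> nat. (\<forall>n. m n > 0) \<and>
     (\<exists>S. cstar_subalgebra (quot_alg (mat_prod_alg m) (mat_c0_ideal m)) S \<and>
        star_isomorphic A ((quot_alg (mat_prod_alg m) (mat_c0_ideal m))\<lparr>carrier := S\<rparr>)))"

end

theory Submission
  imports Defs
begin

text \<open>
  A separable algebra is MF as soon as it admits maps \<open>\<phi> n\<close> into matrix algebras that are
  asymptotically *-homomorphic and satisfy \<open>limsup \<parallel>\<phi> n x\<parallel> = \<parallel>x\<parallel>\<close>: the norm of a sequence modulo the
  sequences tending to zero is the limes superior of the norms, so the sequences \<open>(\<phi> n x)\<close>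
  represent an isometric *-homomorphism into the quotient, and an isometric image of a complete
  space is closed (\<open>asymptotic_embedding_imp_MF\<close>).

  A tracially AI algebra provides such maps. For a finite set \<open>F\<close> and a tolerance, take the
  projection \<open>p\<close> and the subalgebra \<open>I\<close> of class \<open>\<I>\<close> from the definition. Compression
  \<open>x \<mapsto> p x p\<close> is nearly multiplicative on \<open>F\<close>, because \<open>p\<close> nearly commutes with \<open>F\<close>, and its values
  are near \<open>I\<close>; replacing \<open>p x p\<close> by a nearby point \<open>y x\<close> of \<open>I\<close> gives a map into \<open>I\<close> with only
  small defects. Composing with a point evaluation \<open>I \<rightarrow> M\<^sub>k\<close> at which the norm of
  \<open>y b\<close> is almost attained gives a map that almost preserves the norm of one prescribed \<open>b\<close>. One
  element per step is enough: if \<open>b\<close> runs through a dense sequence visiting every term infinitely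
  often, the limes superior is right for all terms, hence for all elements
  (\<open>TAI_asymptotic_embedding\<close>).

  This uses that the point evaluations of \<open>I\<close> are contractive and norming for the norm which \<open>I\<close>
  inherits from the ambient algebra, although \<open>I\<close> is only known to be algebraically *-isomorphic
  to a direct sum of matrix algebras over \<open>\<complex>\<close> and \<open>C[0,1]\<close>. Contractivity
  (\<open>matrix_hom_contractive\<close>) comes from the Neumann series in \<open>I\<close>. For the other inequality, an
  element all of whose evaluations are bounded by \<open>r\<close> is a sum of boundedly many multiples, with
  coefficients of modulus \<open>r/2\<close>, of partial isometries \<open>u e\<^sub>a\<^sub>b\<close> with \<open>u\<close> unimodular; these have
  norm at most 1, so the element has norm at most \<open>C r\<close>
  (\<open>norm_le_const_mult_coordinates\<close>). Applied to the powers \<open>(y* y)^(2^j)\<close>, the C*-identity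
  removes the constant (\<open>evaluations_norming\<close>).
\<close>

section \<open>Matrices and the operator norm\<close>

definition vnorm :: "nat \<Rightarrow> (nat \<Rightarrow> complex) \<Rightarrow> real" where
  "vnorm k v = L2_set (\<lambda>i. cmod (v i)) {..<k}"

definition mvec :: "nat \<Rightarrow> (nat \<Rightarrow> nat \<Rightarrow> complex) \<Rightarrow> (nat \<Rightarrow> complex) \<Rightarrow> nat \<Rightarrow> complex" where
  "mvec k a v = (\<lambda>i. \<Sum>j<k. a i j * v j)"

definition mmul :: "nat \<Rightarrow> (nat \<Rightarrow> nat \<Rightarrow> complex) \<Rightarrow> (nat \<Rightarrow> nat \<Rightarrow> complex) \<Rightarrow> nat \<Rightarrow> nat \<Rightarrow> complex" where
  "mmul k a b = (\<lambda>i j. \<Sum>l<k. a i l * b l j)"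

definition madj :: "(nat \<Rightarrow> nat \<Rightarrow> complex) \<Rightarrow> nat \<Rightarrow> nat \<Rightarrow> complex" where
  "madj a = (\<lambda>i j. cnj (a j i))"

lemma vnorm_nonneg [simp]: "0 \<le> vnorm k v"
  by (simp add: vnorm_def)

lemma vnorm_power2: "(vnorm k v)\<^sup>2 = (\<Sum>i<k. (cmod (v i))\<^sup>2)"
  by (simp add: vnorm_def L2_set_def sum_nonneg)

lemma vnorm_zero [simp]: "vnorm k (\<lambda>i. 0) = 0"
  by (simp add: vnorm_def L2_set_def)

lemma vnorm_component: "i < k \<Longrightarrow> cmod (v i) \<le> vnorm k v"
  unfolding vnorm_def by (rule member_le_L2_set) auto

lemma vnorm_add: "vnorm k (\<lambda>i. u i + v i) \<le> vnorm k u + vnorm k v"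
proof -
  have "vnorm k (\<lambda>i. u i + v i) \<le> L2_set (\<lambda>i. cmod (u i) + cmod (v i)) {..<k}"
    unfolding vnorm_def by (rule L2_set_mono) (auto intro: norm_triangle_ineq)
  also have "\<dots> \<le> vnorm k u + vnorm k v"
    unfolding vnorm_def by (rule L2_set_triangle_ineq)
  finally show ?thesis .
qed

lemma vnorm_scale: "vnorm k (\<lambda>i. c * v i) = cmod c * vnorm k v"
  unfolding vnorm_def by (simp add: norm_mult L2_set_right_distrib)

lemma vnorm_cong: "(\<And>i. i < k \<Longrightarrow> u i = v i) \<Longrightarrow> vnorm k u = vnorm k v"
  unfolding vnorm_def by (rule L2_set_cong) auto

lemma mvec_mmul: "mvec k (mmul k a b) v = mvec k a (mvec k b v)"
proof
  fix i
  have "mvec k (mmul k a b) v i = (\<Sum>j<k. \<Sum>l<k. a i l * b l j * v j)"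
    by (simp add: mvec_def mmul_def sum_distrib_right)
  also have "\<dots> = (\<Sum>l<k. \<Sum>j<k. a i l * b l j * v j)"
    by (rule sum.swap)
  also have "\<dots> = mvec k a (mvec k b v) i"
    by (simp add: mvec_def sum_distrib_left mult.assoc)
  finally show "mvec k (mmul k a b) v i = mvec k a (mvec k b v) i" .
qed

lemma opnorm_eq: "opnorm k a = (SUP v\<in>{v. vnorm k v \<le> 1}. vnorm k (mvec k a v))"
  by (simp add: opnorm_def vnorm_def mvec_def)

text \<open>
  The supremum defining \<open>opnorm\<close> is finite, since a vector in the unit ball has entries of modulus at most 1.
\<close>

lemma bdd_above_mvec: "bdd_above ((\<lambda>v. vnorm k (mvec k a v)) ` {v. vnorm k v \<le> 1})"
proof (rule bdd_aboveI2)
  fix v assume "v \<in> {v. vnorm k v \<le> 1}"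
  then have v: "cmod (v j) \<le> 1" if "j < k" for j
    using vnorm_component[OF that, of v] by auto
  have "vnorm k (mvec k a v) \<le> (\<Sum>i<k. cmod (mvec k a v i))"
    unfolding vnorm_def by (rule L2_set_le_sum) auto
  also have "\<dots> \<le> (\<Sum>i<k. \<Sum>j<k. cmod (a i j))"
  proof (rule sum_mono)
    fix i
    have "cmod (mvec k a v i) \<le> (\<Sum>j<k. cmod (a i j * v j))"
      unfolding mvec_def by (rule norm_sum)
    also have "\<dots> \<le> (\<Sum>j<k. cmod (a i j))"
      by (rule sum_mono) (use v in \<open>auto simp: norm_mult intro: mult_left_le\<close>)
    finally show "cmod (mvec k a v i) \<le> (\<Sum>j<k. cmod (a i j))" .
  qed
  finally show "vnorm k (mvec k a v) \<le> (\<Sum>i<k. \<Sum>j<k. cmod (a i j))" .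
qed

lemma opnorm_least: "(\<And>v. vnorm k v \<le> 1 \<Longrightarrow> vnorm k (mvec k a v) \<le> C) \<Longrightarrow> opnorm k a \<le> C"
  unfolding opnorm_eq by (rule cSUP_least) (auto intro!: exI[of _ "\<lambda>i. 0"])

lemma opnorm_upper: "vnorm k v \<le> 1 \<Longrightarrow> vnorm k (mvec k a v) \<le> opnorm k a"
  unfolding opnorm_eq by (rule cSUP_upper[OF _ bdd_above_mvec]) auto

lemma opnorm_nonneg [simp]: "0 \<le> opnorm k a"
  using order_trans[OF vnorm_nonneg opnorm_upper[of k "\<lambda>i. 0" a]] by simp

lemma mvec_scale: "mvec k a (\<lambda>i. c * v i) = (\<lambda>i. c * mvec k a v i)"
  by (simp add: mvec_def sum_distrib_left mult_ac)

lemma vnorm_mvec_le: "vnorm k (mvec k a v) \<le> opnorm k a * vnorm k v"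
proof (cases "vnorm k v = 0")
  case True
  then have "v j = 0" if "j < k" for j
    using vnorm_component[OF that, of v] by simp
  then have "mvec k a v = (\<lambda>i. 0)" by (simp add: mvec_def)
  then show ?thesis using True by simp
next
  case False
  then have pos: "vnorm k v > 0" using vnorm_nonneg[of k v] by linarith
  define c where "c = complex_of_real (1 / vnorm k v)"
  have c: "cmod c = 1 / vnorm k v" using pos by (simp add: c_def norm_divide)
  have "vnorm k (mvec k a (\<lambda>i. c * v i)) \<le> opnorm k a"
    by (rule opnorm_upper) (use pos in \<open>simp add: vnorm_scale c\<close>)
  then show ?thesis using pos by (simp add: mvec_scale vnorm_scale c field_simps)
qed

lemma opnorm_add: "opnorm k (\<lambda>i j. a i j + b i j) \<le> opnorm k a + opnorm k b"
proof (rule opnorm_least)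
  fix v assume v: "vnorm k v \<le> 1"
  have "mvec k (\<lambda>i j. a i j + b i j) v = (\<lambda>i. mvec k a v i + mvec k b v i)"
    by (simp add: mvec_def distrib_right sum.distrib)
  then show "vnorm k (mvec k (\<lambda>i j. a i j + b i j) v) \<le> opnorm k a + opnorm k b"
    using vnorm_add[of k "mvec k a v" "mvec k b v"] opnorm_upper[OF v, of a] opnorm_upper[OF v, of b]
    by simp
qed

lemma opnorm_mult: "opnorm k (mmul k a b) \<le> opnorm k a * opnorm k b"
proof (rule opnorm_least)
  fix v assume v: "vnorm k v \<le> 1"
  have "vnorm k (mvec k a (mvec k b v)) \<le> opnorm k a * vnorm k (mvec k b v)"
    by (rule vnorm_mvec_le)
  also have "\<dots> \<le> opnorm k a * opnorm k b"
    by (intro mult_left_mono opnorm_upper v opnorm_nonneg)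
  finally show "vnorm k (mvec k (mmul k a b) v) \<le> opnorm k a * opnorm k b"
    by (simp add: mvec_mmul)
qed

lemma opnorm_scale_le: "opnorm k (\<lambda>i j. c * a i j) \<le> cmod c * opnorm k a"
proof (rule opnorm_least)
  fix v assume v: "vnorm k v \<le> 1"
  have "mvec k (\<lambda>i j. c * a i j) v = (\<lambda>i. c * mvec k a v i)"
    by (simp add: mvec_def sum_distrib_left mult_ac)
  then show "vnorm k (mvec k (\<lambda>i j. c * a i j) v) \<le> cmod c * opnorm k a"
    by (simp add: vnorm_scale mult_left_mono opnorm_upper[OF v])
qed

lemma opnorm_zero [simp]: "opnorm k (\<lambda>i j. 0) = 0"
  using opnorm_scale_le[of k 0] opnorm_nonneg[of k "\<lambda>i j. 0"] by force

lemma opnorm_uminus [simp]: "opnorm k (\<lambda>i j. - a i j) = opnorm k a"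
  using opnorm_scale_le[of k "-1" a] opnorm_scale_le[of k "-1" "\<lambda>i j. - a i j"] by simp

lemma opnorm_minus_commute: "opnorm k (\<lambda>i j. a i j - b i j) = opnorm k (\<lambda>i j. b i j - a i j)"
  using opnorm_uminus[of k "\<lambda>i j. a i j - b i j"] by simp

lemma opnorm_diff_triangle:
  "opnorm k (\<lambda>i j. a i j - c i j) \<le> opnorm k (\<lambda>i j. a i j - b i j) + opnorm k (\<lambda>i j. b i j - c i j)"
  using opnorm_add[of k "\<lambda>i j. a i j - b i j" "\<lambda>i j. b i j - c i j"] by simp

lemma opnorm_entry: assumes "i < k" "j < k" shows "cmod (a i j) \<le> opnorm k a"
proof -
  define v where "v = (\<lambda>l. if l = j then 1 else 0 :: complex)"
  have "(vnorm k v)\<^sup>2 = 1"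
    unfolding vnorm_power2 v_def using assms by (simp add: if_distrib[of "\<lambda>x. (cmod x)\<^sup>2"] cong: if_cong)
  then have v: "vnorm k v \<le> 1"
    using vnorm_nonneg[of k v] by (simp add: power2_eq_1_iff)
  have "mvec k a v i = a i j"
    unfolding mvec_def v_def using assms by (simp add: if_distrib cong: if_cong)
  then show ?thesis
    using vnorm_component[OF assms(1), of "mvec k a v"] opnorm_upper[OF v, of a] by simp
qed

text \<open>
  The matrix \<open>madj a\<close> is the adjoint of \<open>a\<close> for the inner product \<open>\<Sum>i<k. cnj (v i) * w i\<close>.
\<close>

lemma mvec_adjoint: "(\<Sum>i<k. cnj (v i) * mvec k (madj a) w i) = (\<Sum>i<k. cnj (mvec k a v i) * w i)"
proof -
  have "(\<Sum>i<k. cnj (v i) * mvec k (madj a) w i) = (\<Sum>i<k. \<Sum>j<k. cnj (v i) * (cnj (a j i) * w j))"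
    by (simp add: mvec_def madj_def sum_distrib_left)
  also have "\<dots> = (\<Sum>j<k. \<Sum>i<k. cnj (v i) * (cnj (a j i) * w j))"
    by (rule sum.swap)
  also have "\<dots> = (\<Sum>j<k. cnj (mvec k a v j) * w j)"
    by (simp add: mvec_def sum_distrib_left sum_distrib_right mult_ac)
  finally show ?thesis .
qed

lemma sum_cnj_self: "(\<Sum>i<k. cnj (u i) * u i) = complex_of_real ((vnorm k u)\<^sup>2)"
  unfolding vnorm_power2 of_real_sum
  by (intro sum.cong refl) (metis complex_norm_square mult.commute)

lemma cauchy_schwarz_vnorm: "cmod (\<Sum>i<k. cnj (u i) * v i) \<le> vnorm k u * vnorm k v"
proof -
  have "cmod (\<Sum>i<k. cnj (u i) * v i) \<le> (\<Sum>i<k. \<bar>cmod (u i)\<bar> * \<bar>cmod (v i)\<bar>)"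
    using norm_sum[of "\<lambda>i. cnj (u i) * v i" "{..<k}"] by (simp add: norm_mult)
  also have "\<dots> \<le> vnorm k u * vnorm k v"
    unfolding vnorm_def by (rule L2_set_mult_ineq)
  finally show ?thesis .
qed

text \<open>
  With \<open>w = a* v\<close>, the adjoint relation and the Cauchy-Schwarz inequality give \<open>\<parallel>w\<parallel>\<^sup>2 = \<langle>a w, v\<rangle> \<le> \<parallel>a\<parallel> \<parallel>w\<parallel> \<parallel>v\<parallel>\<close>.
\<close>

lemma opnorm_madj_le: "opnorm k (madj a) \<le> opnorm k a"
proof (rule opnorm_least)
  fix v assume v: "vnorm k v \<le> 1"
  define w where "w = mvec k (madj a) v"
  have "complex_of_real ((vnorm k w)\<^sup>2) = (\<Sum>i<k. cnj (mvec k a w i) * v i)"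
    unfolding sum_cnj_self[symmetric] using mvec_adjoint[where k = k and v = w and a = a and w = v] by (simp add: w_def)
  then have "cmod (complex_of_real ((vnorm k w)\<^sup>2)) \<le> vnorm k (mvec k a w) * vnorm k v"
    using cauchy_schwarz_vnorm[where u = "mvec k a w" and v = v and k = k] by simp
  then have "(vnorm k w)\<^sup>2 \<le> vnorm k (mvec k a w) * vnorm k v"
    by (simp add: norm_power)
  also have "\<dots> \<le> opnorm k a * vnorm k w * 1"
    by (intro mult_mono vnorm_mvec_le v) auto
  finally have "vnorm k w * vnorm k w \<le> opnorm k a * vnorm k w"
    by (simp add: power2_eq_square)
  then show "vnorm k (mvec k (madj a) v) \<le> opnorm k a"
    unfolding w_def[symmetric] using vnorm_nonneg[of k w] opnorm_nonneg[of k a]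
    by (cases "vnorm k w = 0") (auto simp: mult_le_cancel_right)
qed

lemma opnorm_madj [simp]: "opnorm k (madj a) = opnorm k a"
  using opnorm_madj_le[of k a] opnorm_madj_le[of k "madj a"] by (simp add: madj_def)

lemma vnorm_diff_power2:
  "(vnorm k (\<lambda>i. u i - v i))\<^sup>2 = (vnorm k u)\<^sup>2 - 2 * Re (\<Sum>i<k. cnj (v i) * u i) + (vnorm k v)\<^sup>2"
proof -
  have "(cmod (u i - v i))\<^sup>2 = (cmod (u i))\<^sup>2 - 2 * Re (cnj (v i) * u i) + (cmod (v i))\<^sup>2" for i
    by (simp only: cmod_power2) (simp add: power2_eq_square algebra_simps)
  then show ?thesis
    by (simp add: vnorm_power2 sum.distrib sum_subtractf sum_distrib_left)
qed

lemma mmul_assoc: "mmul k (mmul k a b) c = mmul k a (mmul k b c)"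
proof (intro ext)
  fix i j
  have "mmul k (mmul k a b) c i j = (\<Sum>l<k. \<Sum>h<k. a i h * b h l * c l j)"
    by (simp add: mmul_def sum_distrib_right)
  also have "\<dots> = (\<Sum>h<k. \<Sum>l<k. a i h * b h l * c l j)"
    by (rule sum.swap)
  also have "\<dots> = mmul k a (mmul k b c) i j"
    by (simp add: mmul_def sum_distrib_left mult.assoc)
  finally show "mmul k (mmul k a b) c i j = mmul k a (mmul k b c) i j" .
qed

lemma mmul_add_left: "mmul k (\<lambda>i j. a i j + b i j) c = (\<lambda>i j. mmul k a c i j + mmul k b c i j)"
  by (simp add: mmul_def distrib_right sum.distrib)

lemma mmul_add_right: "mmul k a (\<lambda>i j. b i j + c i j) = (\<lambda>i j. mmul k a b i j + mmul k a c i j)"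
  by (simp add: mmul_def distrib_left sum.distrib)

lemma mmul_one:
  assumes "\<And>i j. \<not> (i < k \<and> j < k) \<Longrightarrow> a i j = 0"
  shows "mmul k (\<lambda>i j. if i = j \<and> i < k then 1 else 0) a = a"
    and "mmul k a (\<lambda>i j. if i = j \<and> i < k then 1 else 0) = a"
proof -
  have "(\<Sum>l<k. (if i = l \<and> i < k then 1 else 0) * a l j) = (\<Sum>l<k. if l = i then a l j else 0)" for i j
    by (rule sum.cong) auto
  then show "mmul k (\<lambda>i j. if i = j \<and> i < k then 1 else 0) a = a"
    using assms by (auto simp: mmul_def fun_eq_iff)
  have "(\<Sum>l<k. a i l * (if l = j \<and> l < k then 1 else 0)) = (\<Sum>l<k. if l = j then a i l else 0)" for i j
    by (rule sum.cong) auto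
  then show "mmul k a (\<lambda>i j. if i = j \<and> i < k then 1 else 0) = a"
    using assms by (auto simp: mmul_def fun_eq_iff)
qed

definition mat_dist :: "nat \<Rightarrow> (nat \<Rightarrow> nat \<Rightarrow> complex) \<Rightarrow> (nat \<Rightarrow> nat \<Rightarrow> complex) \<Rightarrow> real" where
  "mat_dist k a b = opnorm k (\<lambda>i j. a i j - b i j)"

lemma mat_dist_nonneg [simp]: "0 \<le> mat_dist k a b"
  by (simp add: mat_dist_def)

lemma mat_dist_self [simp]: "mat_dist k a a = 0"
  by (simp add: mat_dist_def)

lemma mat_dist_commute: "mat_dist k a b = mat_dist k b a"
  unfolding mat_dist_def by (rule opnorm_minus_commute)

lemma mat_dist_triangle: "mat_dist k a c \<le> mat_dist k a b + mat_dist k b c"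
  unfolding mat_dist_def by (rule opnorm_diff_triangle)

lemma opnorm_le_add_mat_dist: "opnorm k a \<le> opnorm k b + mat_dist k a b"
  using opnorm_add[of k b "\<lambda>i j. a i j - b i j"] by (simp add: mat_dist_def)

lemma mat_dist_madj: "mat_dist k (madj a) (madj b) = mat_dist k a b"
  using opnorm_madj[of k "\<lambda>i j. a i j - b i j"] by (simp add: mat_dist_def madj_def)

lemma madj_madj [simp]: "madj (madj a) = a"
  by (simp add: madj_def)

section \<open>Contractivity of matrix representations\<close>

lemma norm_adj [simp]: "norm (adj x) = norm (x :: 'a::cstar_algebra_1)"
proof -
  have *: "norm x \<le> norm (adj x)" for x :: 'a
  proof (cases "x = 0")
    case False
    have "norm x * norm x \<le> norm (adj x) * norm x"
      using cstar_identity[of x] norm_mult_ineq[of "adj x" x] by (simp add: power2_eq_square)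
    then show ?thesis using False by simp
  qed simp
  show ?thesis using *[of x] *[of "adj x"] by (simp add: adj_adj)
qed

lemma scaleC_zero_left [simp]: "scaleC 0 x = (0 :: 'a::cstar_algebra_1)"
  using scaleC_of_real[of 0 x] by simp

lemma scaleC_minus_one: "scaleC (-1) x = - (x :: 'a::cstar_algebra_1)"
  using scaleC_of_real[of "-1" x] by simp

lemma adj_minus: "adj (- x) = - adj (x :: 'a::cstar_algebra_1)"
  using adj_scaleC[of "-1" x] by (simp add: scaleC_minus_one)

lemma adj_diff: "adj (x - y) = adj x - adj (y :: 'a::cstar_algebra_1)"
  using adj_add[of x "- y"] by (simp add: adj_minus)

text \<open>
  By the C*-identity, \<open>\<parallel>p\<parallel>\<^sup>2 = \<parallel>p* p\<parallel> = \<parallel>p\<parallel>\<close>.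
\<close>

lemma norm_projection_le_1:
  fixes p :: "'a::cstar_algebra_1"
  assumes "p * p = p" "adj p = p" shows "norm p \<le> 1"
  using cstar_identity[of p] assms by (cases "norm p = 0") (auto simp: power2_eq_square)

lemma univ_alg_simps [simp]:
  "carrier univ_alg = UNIV" "x \<otimes>\<^bsub>univ_alg\<^esub> y = x * y" "\<one>\<^bsub>univ_alg\<^esub> = 1" "\<zero>\<^bsub>univ_alg\<^esub> = 0"
  "x \<oplus>\<^bsub>univ_alg\<^esub> y = x + y" "c \<odot>\<^bsub>univ_alg\<^esub> x = scaleC c x" "star univ_alg x = adj x"
  "nrm univ_alg x = norm x"
  by (simp_all add: univ_alg_def)

lemma univ_alg_ring: "ring (univ_alg :: 'a::cstar_algebra_1 normed_star_alg)"
proof (rule ringI)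
  show "abelian_group (univ_alg :: 'a normed_star_alg)"
    by (rule abelian_groupI) (auto simp: ac_simps intro: exI[of _ "- x" for x])
  show "Group.monoid (univ_alg :: 'a normed_star_alg)"
    by (rule monoidI) (auto simp: ac_simps)
qed (auto simp: algebra_simps)

lemma univ_alg_a_minus [simp]: "x \<ominus>\<^bsub>univ_alg\<^esub> y = x - (y :: 'a::cstar_algebra_1)"
proof -
  interpret ring "univ_alg :: 'a normed_star_alg" by (rule univ_alg_ring)
  have "\<ominus>\<^bsub>univ_alg\<^esub> y = - y"
    by (rule minus_equality) auto
  then show ?thesis by (simp add: a_minus_def)
qed

lemma univ_alg_finsum: "finite A \<Longrightarrow> (\<Oplus>\<^bsub>univ_alg\<^esub>i\<in>A. f i) = (\<Sum>i\<in>A. f i :: 'a::cstar_algebra_1)"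
proof (induction A rule: finite_induct)
  interpret ring "univ_alg :: 'a normed_star_alg" by (rule univ_alg_ring)
  { case empty show ?case by simp }
  { case (insert x F) then show ?case by simp }
qed

lemma cmat_alg_simps [simp]:
  "carrier (cmat_alg k) = {a. \<forall>i j. \<not> (i < k \<and> j < k) \<longrightarrow> a i j = 0}"
  "a \<otimes>\<^bsub>cmat_alg k\<^esub> b = mmul k a b"
  "\<one>\<^bsub>cmat_alg k\<^esub> = (\<lambda>i j. if i = j \<and> i < k then 1 else 0)"
  "\<zero>\<^bsub>cmat_alg k\<^esub> = (\<lambda>i j. 0)"
  "a \<oplus>\<^bsub>cmat_alg k\<^esub> b = (\<lambda>i j. a i j + b i j)"
  "c \<odot>\<^bsub>cmat_alg k\<^esub> a = (\<lambda>i j. c * a i j)"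
  "star (cmat_alg k) a = madj a"
  by (auto simp: mat_alg_def univ_alg_finsum mmul_def madj_def scaleC_complex_def adj_complex_def
      fun_eq_iff)

text \<open>
  Units are not required to be preserved: a subalgebra \<open>I\<close> need not contain the unit of the ambient algebra.
\<close>

definition star_hom :: "('a, 'x) star_alg_scheme \<Rightarrow> ('b, 'y) star_alg_scheme \<Rightarrow> ('a \<Rightarrow> 'b) \<Rightarrow> bool" where
  "star_hom R S f \<longleftrightarrow> (\<forall>x\<in>carrier R. f x \<in> carrier S) \<and>
     (\<forall>x\<in>carrier R. \<forall>y\<in>carrier R. f (x \<oplus>\<^bsub>R\<^esub> y) = f x \<oplus>\<^bsub>S\<^esub> f y) \<and>
     (\<forall>x\<in>carrier R. \<forall>y\<in>carrier R. f (x \<otimes>\<^bsub>R\<^esub> y) = f x \<otimes>\<^bsub>S\<^esub> f y) \<and>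
     (\<forall>c. \<forall>x\<in>carrier R. f (c \<odot>\<^bsub>R\<^esub> x) = c \<odot>\<^bsub>S\<^esub> f x) \<and>
     (\<forall>x\<in>carrier R. f (star R x) = star S (f x))"

abbreviation subalg :: "'a::cstar_algebra_1 set \<Rightarrow> 'a \<Rightarrow> 'a normed_star_alg" where
  "subalg I p \<equiv> univ_alg\<lparr>carrier := I, one := p\<rparr>"

lemma star_hom_subalg_matrix:
  "star_hom (subalg I p) (cmat_alg k) f \<longleftrightarrow>
    (\<forall>x\<in>I. \<forall>i j. \<not> (i < k \<and> j < k) \<longrightarrow> f x i j = 0) \<and>
    (\<forall>x\<in>I. \<forall>y\<in>I. f (x + y) = (\<lambda>i j. f x i j + f y i j)) \<and>
    (\<forall>x\<in>I. \<forall>y\<in>I. f (x * y) = mmul k (f x) (f y)) \<and>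
    (\<forall>c. \<forall>x\<in>I. f (scaleC c x) = (\<lambda>i j. c * f x i j)) \<and>
    (\<forall>x\<in>I. f (adj x) = madj (f x))"
  by (simp add: star_hom_def univ_alg_def cmat_alg_simps[unfolded univ_alg_def])

lemma cstar_subalgebra_univ_alg:
  "cstar_subalgebra univ_alg I \<longleftrightarrow> 0 \<in> I \<and> (\<forall>x\<in>I. \<forall>y\<in>I. x + y \<in> I) \<and> (\<forall>x\<in>I. \<forall>y\<in>I. x * y \<in> I) \<and>
     (\<forall>c. \<forall>x\<in>I. scaleC c x \<in> I) \<and> (\<forall>x\<in>I. adj x \<in> I) \<and> closed (I :: 'a::cstar_algebra_1 set)"
proof -
  have "(\<forall>x. (\<forall>e>0. \<exists>y\<in>I. norm (x - y) < e) \<longrightarrow> x \<in> I) \<longleftrightarrow> closed I"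
    unfolding closure_subset_eq[symmetric] subset_iff closure_approachable dist_norm
    by (simp add: norm_minus_commute)
  then show ?thesis by (simp add: cstar_subalgebra_def)
qed

text \<open>
  The element \<open>w = h + h\<^sup>2 + h\<^sup>3 + \<dots>\<close> lies in every closed subalgebra containing \<open>h\<close>, even if the
  subalgebra does not contain 1, so that \<open>1 + w\<close> serves as an inverse of \<open>1 - h\<close> without leaving
  the subalgebra.
\<close>

lemma quasi_inverse_in_closed_subalgebra:
  fixes h :: "'a::cstar_algebra_1"
  assumes I: "cstar_subalgebra univ_alg I" and h: "h \<in> I" and lt: "norm h < 1"
  obtains w where "w \<in> I" "w = h + w * h"
proof -
  have summ: "summable (\<lambda>n. h ^ n)"
    using lt by (rule complete_algebra_summable_geometric)
  have summ1: "summable (\<lambda>n. h ^ Suc n)"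
    using summ by (subst summable_Suc_iff)
  define w where "w = (\<Sum>n. h ^ Suc n)"
  have powI: "h ^ Suc n \<in> I" for n
    by (induction n) (use h I in \<open>auto simp: cstar_subalgebra_univ_alg\<close>)
  have partI: "(\<Sum>n<m. h ^ Suc n) \<in> I" for m
    by (induction m) (use powI I in \<open>auto simp: cstar_subalgebra_univ_alg\<close>)
  have "(\<lambda>m. \<Sum>n<m. h ^ Suc n) \<longlonglongrightarrow> w"
    unfolding w_def by (rule summable_LIMSEQ[OF summ1])
  moreover have "closed I" using I by (simp add: cstar_subalgebra_univ_alg)
  ultimately have "w \<in> I"
    using closed_sequentially[of I "\<lambda>m. \<Sum>n<m. h ^ Suc n" w] partI by simp
  moreover have "w = h + w * h"
  proof -
    have "w = h ^ Suc 0 + (\<Sum>n. h ^ Suc (Suc n))"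
      using suminf_split_head[OF summ1] by (simp add: w_def)
    also have "(\<Sum>n. h ^ Suc (Suc n)) = (\<Sum>n. h ^ Suc n * h)"
      by (simp only: power_Suc2)
    also have "\<dots> = w * h"
      unfolding w_def by (rule suminf_mult2[OF summ1, symmetric])
    finally show ?thesis by simp
  qed
  ultimately show thesis using that by blast
qed

text \<open>
  Let \<open>a = f y\<close> and suppose \<open>s = \<parallel>a\<parallel> > \<parallel>y\<parallel>\<close>. Then \<open>h = y* y / s\<^sup>2\<close> has norm below 1 and so has a
  quasi-inverse in \<open>I\<close>; applying \<open>f\<close>, the matrix \<open>b = a* a / s\<^sup>2\<close> has a quasi-inverse \<open>c\<close>,
  that is, \<open>c = b + c b\<close>. On the other hand, if \<open>v\<close> is a unit vector with \<open>\<parallel>a v\<parallel>\<close> close to \<open>s\<close>, then \<open>b v\<close>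
  is close to \<open>v\<close>, while \<open>b v = - c (b v - v)\<close>. Hence \<open>\<parallel>a v\<parallel>\<close> stays away from \<open>s\<close>, which
  contradicts the definition of \<open>s\<close> as a supremum.
\<close>

lemma matrix_hom_contractive:
  fixes I :: "'a::cstar_algebra_1 set"
  assumes I: "cstar_subalgebra univ_alg I" and hom: "star_hom (subalg I p) (cmat_alg k) f" and y: "y \<in> I"
  shows "opnorm k (f y) \<le> norm y"
proof (rule ccontr)
  assume "\<not> opnorm k (f y) \<le> norm y"
  define s where "s = opnorm k (f y)"
  then have ys: "norm y < s" using \<open>\<not> opnorm k (f y) \<le> norm y\<close> by simp
  then have s: "s > 0" using norm_ge_zero[of y] by linarith
  define a where "a = f y"
  note sub = I[unfolded cstar_subalgebra_univ_alg]
  note f_rules = hom[unfolded star_hom_subalg_matrix]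
  define h where "h = scaleC (complex_of_real (1 / s\<^sup>2)) (adj y * y)"
  define b where "b = (\<lambda>i j. complex_of_real (1 / s\<^sup>2) * mmul k (madj a) a i j)"
  have hI: "h \<in> I" using sub y by (simp add: h_def)
  have fh: "f h = b" using f_rules sub y by (simp add: h_def b_def a_def)
  have "norm h = (norm y / s)\<^sup>2"
    by (simp add: h_def norm_scaleC cstar_identity power_divide norm_divide norm_power)
  also have "\<dots> < 1"
    using ys s by (simp add: power_less_one_iff abs_square_less_1)
  finally obtain w where wI: "w \<in> I" and w: "w = h + w * h"
    using quasi_inverse_in_closed_subalgebra[OF I hI] by blast
  define c where "c = f w"
  have "c = f (h + w * h)" unfolding c_def by (rule arg_cong[OF w])
  also have "\<dots> = (\<lambda>i j. b i j + mmul k c b i j)"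
    using f_rules wI hI sub fh by (simp add: c_def)
  finally have c: "c = (\<lambda>i j. b i j + mmul k c b i j)" .
  define C where "C = opnorm k c + 1"
  have C: "C \<ge> 1" by (simp add: C_def)
  (* The estimate t^2 <= 2 C^2 (1 - t), proved below for t = |a v|^2 / s^2, forces t <= m:
     if t > 1/2, the left-hand side is at least 1/4. *)
  define m where "m = max (1/2) (1 - 1 / (8 * C\<^sup>2))"
  have m: "0 < m" "m < 1" using C by (auto simp: m_def)
  have key: "(vnorm k (mvec k a v))\<^sup>2 \<le> m * s\<^sup>2" if v: "vnorm k v \<le> 1" for v
  proof -
    define \<tau> where "\<tau> = (vnorm k (mvec k a v))\<^sup>2 / s\<^sup>2"
    define d where "d = (\<lambda>i. mvec k b v i - v i)"
    have \<tau>0: "\<tau> \<ge> 0" by (simp add: \<tau>_def)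
    have bv: "mvec k b v = (\<lambda>i. complex_of_real (1 / s\<^sup>2) * mvec k (madj a) (mvec k a v) i)"
      unfolding mvec_mmul[symmetric] by (simp add: b_def mvec_def sum_distrib_left mult_ac)
    have inner: "(\<Sum>i<k. cnj (v i) * mvec k b v i) = complex_of_real \<tau>"
    proof -
      have "(\<Sum>i<k. cnj (v i) * mvec k b v i)
          = complex_of_real (1 / s\<^sup>2) * (\<Sum>i<k. cnj (v i) * mvec k (madj a) (mvec k a v) i)"
        unfolding bv by (simp add: sum_distrib_left mult_ac)
      also have "\<dots> = complex_of_real \<tau>"
        unfolding mvec_adjoint sum_cnj_self \<tau>_def by simp
      finally show ?thesis .
    qed
    have bv1: "vnorm k (mvec k b v) \<le> 1"
    proof -
      have "vnorm k (mvec k b v) = (1 / s\<^sup>2) * vnorm k (mvec k (madj a) (mvec k a v))"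
        unfolding bv vnorm_scale by (simp add: norm_divide norm_power)
      also have "\<dots> \<le> (1 / s\<^sup>2) * (s * (s * 1))"
      proof (intro mult_left_mono)
        have "vnorm k (mvec k (madj a) (mvec k a v)) \<le> s * vnorm k (mvec k a v)"
          using vnorm_mvec_le[of k "madj a" "mvec k a v"] by (simp add: a_def s_def)
        also have "\<dots> \<le> s * (s * vnorm k v)"
          using vnorm_mvec_le[of k a v] s by (intro mult_left_mono) (auto simp: a_def s_def)
        also have "\<dots> \<le> s * (s * 1)"
          using s v by (intro mult_left_mono) auto
        finally show "vnorm k (mvec k (madj a) (mvec k a v)) \<le> s * (s * 1)" .
      qed auto
      also have "\<dots> = 1" using s by (simp add: power2_eq_square)
      finally show ?thesis .
    qed
    have \<tau>1: "\<tau> \<le> vnorm k (mvec k b v)"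
    proof -
      have "\<tau> = cmod (\<Sum>i<k. cnj (v i) * mvec k b v i)" unfolding inner using \<tau>0 by simp
      also have "\<dots> \<le> vnorm k v * vnorm k (mvec k b v)" by (rule cauchy_schwarz_vnorm)
      also have "\<dots> \<le> 1 * vnorm k (mvec k b v)" by (intro mult_right_mono v) auto
      finally show ?thesis by simp
    qed
    have d2: "(vnorm k d)\<^sup>2 \<le> 2 * (1 - \<tau>)"
    proof -
      have "(vnorm k d)\<^sup>2 = (vnorm k (mvec k b v))\<^sup>2 - 2 * \<tau> + (vnorm k v)\<^sup>2"
        unfolding d_def vnorm_diff_power2 inner by simp
      moreover have "(vnorm k (mvec k b v))\<^sup>2 \<le> 1" "(vnorm k v)\<^sup>2 \<le> 1"
        using bv1 v by (simp_all add: power_le_one)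
      ultimately show ?thesis by (simp add: algebra_simps)
    qed
    \<comment> \<open>Applying \<open>c = b + c b\<close> to \<open>v\<close> gives \<open>b v = - c (b v - v)\<close>.\<close>
    have "mvec k c v = (\<lambda>i. mvec k b v i + mvec k (mmul k c b) v i)"
      by (subst c) (simp add: mvec_def distrib_right sum.distrib)
    then have cv: "mvec k c v i = mvec k b v i + mvec k c (mvec k b v) i" for i
      by (simp add: mvec_mmul)
    have "mvec k c d = (\<lambda>i. mvec k c (mvec k b v) i - mvec k c v i)"
      unfolding d_def by (subst (1 2 4) mvec_def) (simp add: right_diff_distrib sum_subtractf)
    then have "mvec k c d = (\<lambda>i. (-1) * mvec k b v i)" by (simp add: cv)
    then have "vnorm k (mvec k b v) = vnorm k (mvec k c d)"
      using vnorm_scale[of k "-1" "mvec k b v"] by simp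
    then have "\<tau> \<le> opnorm k c * vnorm k d"
      using \<tau>1 vnorm_mvec_le[of k c d] by simp
    also have "\<dots> \<le> C * vnorm k d"
      by (intro mult_right_mono) (simp_all add: C_def)
    finally have "\<tau> \<le> C * vnorm k d" .
    then have "\<tau>\<^sup>2 \<le> C\<^sup>2 * (vnorm k d)\<^sup>2"
      using \<tau>0 by (metis power_mono power_mult_distrib)
    also have "\<dots> \<le> C\<^sup>2 * (2 * (1 - \<tau>))"
      by (intro mult_left_mono d2) auto
    also have "\<dots> = 2 * C\<^sup>2 * (1 - \<tau>)" by (simp only: mult_ac)
    finally have quad: "\<tau>\<^sup>2 \<le> 2 * C\<^sup>2 * (1 - \<tau>)" .
    have "\<tau> \<le> m"
    proof (cases "\<tau> \<le> 1/2")
      case False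
      then have "1/4 \<le> \<tau>\<^sup>2"
        using power_mono[of "1/2" \<tau> 2] by (simp add: power2_eq_square)
      then have "1/4 \<le> 2 * C\<^sup>2 * (1 - \<tau>)" using quad by simp
      then have "1 \<le> (1 - \<tau>) * (8 * C\<^sup>2)" by (simp add: mult_ac)
      moreover have "0 < 8 * C\<^sup>2" using C by simp
      ultimately have "1 / (8 * C\<^sup>2) \<le> 1 - \<tau>" by (simp only: pos_divide_le_eq)
      then have "\<tau> \<le> 1 - 1 / (8 * C\<^sup>2)" by argo
      then show ?thesis unfolding m_def by (rule max.coboundedI2)
    qed (simp add: m_def)
    moreover have "0 < s\<^sup>2" using s by simp
    ultimately show ?thesis unfolding \<tau>_def by (simp only: pos_divide_le_eq)
  qed
  have "s \<le> sqrt m * s"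
  proof -
    have "opnorm k a \<le> sqrt m * s"
    proof (rule opnorm_least)
      fix v assume "vnorm k v \<le> 1"
      from key[OF this] have "vnorm k (mvec k a v) \<le> sqrt (m * s\<^sup>2)" by (rule real_le_rsqrt)
      then show "vnorm k (mvec k a v) \<le> sqrt m * s" using s by (simp add: real_sqrt_mult)
    qed
    then show ?thesis by (simp add: a_def s_def)
  qed
  moreover have "sqrt m < 1" using m by simp
  ultimately have "sqrt m * s < 1 * s" using s by (intro mult_strict_right_mono)
  with \<open>s \<le> sqrt m * s\<close> show False by simp
qed

section \<open>Matrix coordinates on algebras of class I\<close>

lemma C01_simps [simp]:
  "carrier C01 = {f \<in> extensional {0..1}. continuous_on {0..1} f}"
  "f \<otimes>\<^bsub>C01\<^esub> g = (\<lambda>t\<in>{0..1}. f t * g t)"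
  "\<zero>\<^bsub>C01\<^esub> = (\<lambda>t\<in>{0..1}. 0)"
  "f \<oplus>\<^bsub>C01\<^esub> g = (\<lambda>t\<in>{0..1}. f t + g t)"
  "c \<odot>\<^bsub>C01\<^esub> f = (\<lambda>t\<in>{0..1}. c * f t)"
  "star C01 f = (\<lambda>t\<in>{0..1}. cnj (f t))"
  by (simp_all add: C01_def)

lemma restrict_in_C01:
  assumes "continuous_on {0..1} f" shows "restrict f {0..1} \<in> carrier C01"
proof -
  have "continuous_on {0..1} (restrict f {0..1})"
    using assms by (rule continuous_on_eq) (simp only: restrict_apply if_True)
  then show ?thesis
    by (simp only: C01_simps mem_Collect_eq restrict_extensional simp_thms)
qed

lemma C01_abelian_monoid: "abelian_monoid C01"
proof (rule abelian_monoidI)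
  fix f g assume "f \<in> carrier C01" "g \<in> carrier C01"
  then show "f \<oplus>\<^bsub>C01\<^esub> g \<in> carrier C01"
    unfolding C01_simps(4) by (intro restrict_in_C01) (auto intro: continuous_on_mult continuous_on_add)
next
  show "\<zero>\<^bsub>C01\<^esub> \<in> carrier C01"
    unfolding C01_simps(3) by (rule restrict_in_C01) simp
next
  fix f g h :: "real \<Rightarrow> complex"
  show "(f \<oplus>\<^bsub>C01\<^esub> g) \<oplus>\<^bsub>C01\<^esub> h = f \<oplus>\<^bsub>C01\<^esub> (g \<oplus>\<^bsub>C01\<^esub> h)"
    by (simp add: fun_eq_iff add.assoc)
  show "f \<oplus>\<^bsub>C01\<^esub> g = g \<oplus>\<^bsub>C01\<^esub> f"
    by (simp add: fun_eq_iff add.commute)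
  assume "f \<in> carrier C01"
  then have f: "f t = undefined" if "t \<notin> {0..1}" for t
    unfolding C01_simps(1) using that by (blast intro: extensional_arb)
  show "\<zero>\<^bsub>C01\<^esub> \<oplus>\<^bsub>C01\<^esub> f = f"
  proof
    fix t show "(\<zero>\<^bsub>C01\<^esub> \<oplus>\<^bsub>C01\<^esub> f) t = f t"
      using f[of t] by (cases "t \<in> {0..1}") simp_all
  qed
qed

text \<open>
  The product in \<open>mat_alg k C01\<close> is formed with the abstract sum of the additive monoid \<open>C01\<close>; evaluation at a point turns it into a sum of complex numbers.
\<close>

lemma C01_finsum:
  assumes "finite A" "\<And>i. i \<in> A \<Longrightarrow> f i \<in> carrier C01" "t \<in> {0..1}"
  shows "(\<Oplus>\<^bsub>C01\<^esub>i\<in>A. f i) t = (\<Sum>i\<in>A. f i t)"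
  using assms(1,2)
proof (induction A rule: finite_induct)
  interpret abelian_monoid C01 by (rule C01_abelian_monoid)
  { case empty show ?case using assms(3) by simp }
  { case (insert x F)
    have "(\<Oplus>\<^bsub>C01\<^esub>i\<in>insert x F. f i) = f x \<oplus>\<^bsub>C01\<^esub> (\<Oplus>\<^bsub>C01\<^esub>i\<in>F. f i)"
      by (rule finsum_insert) (use insert in auto)
    then show ?case using insert assms(3) by simp }
qed

lemma star_iso_imp_star_hom: "star_iso R S f \<Longrightarrow> star_hom R S f"
  unfolding star_iso_def star_hom_def bij_betw_def by blast

lemma star_hom_comp: "star_hom R S f \<Longrightarrow> star_hom S T g \<Longrightarrow> star_hom R T (\<lambda>x. g (f x))"
  unfolding star_hom_def by simp

lemma star_hom_direct_sum: "i < n \<Longrightarrow> star_hom (direct_sum_alg n B) (B i) (\<lambda>x. x i)"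
  by (auto simp: star_hom_def direct_sum_alg_def)

lemma carrier_mat_alg:
  "a \<in> carrier (mat_alg k R) \<longleftrightarrow>
    (\<forall>i j. if i < k \<and> j < k then a i j \<in> carrier R else a i j = \<zero>\<^bsub>R\<^esub>)"
  by (simp add: mat_alg_def)

lemma mat_alg_C01_entry: "x \<in> carrier (mat_alg k C01) \<Longrightarrow> x i j \<in> carrier C01"
  using abelian_monoid.zero_closed[OF C01_abelian_monoid] unfolding carrier_mat_alg by metis

lemma star_hom_evaluation:
  assumes t: "t \<in> {0..1}"
  shows "star_hom (mat_alg k C01) (cmat_alg k) (\<lambda>x i j. x i j t)"
proof -
  note entry = mat_alg_C01_entry
  have mult: "(x \<otimes>\<^bsub>mat_alg k C01\<^esub> y) i j t = mmul k (\<lambda>i j. x i j t) (\<lambda>i j. y i j t) i j"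
    if "x \<in> carrier (mat_alg k C01)" "y \<in> carrier (mat_alg k C01)" for x y i j
  proof -
    have c: "x i l \<otimes>\<^bsub>C01\<^esub> y l j \<in> carrier C01" for l
      using entry[OF that(1), of i l] entry[OF that(2), of l j]
      unfolding C01_simps(2) by (intro restrict_in_C01) (auto intro: continuous_on_mult continuous_on_add)
    have "(x \<otimes>\<^bsub>mat_alg k C01\<^esub> y) i j t = (\<Oplus>\<^bsub>C01\<^esub>l\<in>{..<k}. x i l \<otimes>\<^bsub>C01\<^esub> y l j) t"
      by (simp add: mat_alg_def)
    also have "\<dots> = (\<Sum>l<k. (x i l \<otimes>\<^bsub>C01\<^esub> y l j) t)"
      by (rule C01_finsum) (use c t in auto)
    finally show ?thesis using t by (simp add: mmul_def)
  qed
  have zero: "x i j t = 0" if "x \<in> carrier (mat_alg k C01)" "\<not> (i < k \<and> j < k)" for x i j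
    using that t by (auto simp: mat_alg_def)
  show ?thesis
    unfolding star_hom_def
  proof (intro conjI ballI allI)
    fix x assume x: "x \<in> carrier (mat_alg k C01)"
    show "(\<lambda>i j. x i j t) \<in> carrier (cmat_alg k)" using zero[OF x] by simp
    show "(\<lambda>i j. star (mat_alg k C01) x i j t) = star (cmat_alg k) (\<lambda>i j. x i j t)"
      using t by (simp add: mat_alg_def madj_def adj_complex_def)
    show "(\<lambda>i j. (c \<odot>\<^bsub>mat_alg k C01\<^esub> x) i j t) = c \<odot>\<^bsub>cmat_alg k\<^esub> (\<lambda>i j. x i j t)" for c
      using t by (simp add: mat_alg_def scaleC_complex_def)
    fix y assume y: "y \<in> carrier (mat_alg k C01)"
    show "(\<lambda>i j. (x \<oplus>\<^bsub>mat_alg k C01\<^esub> y) i j t) = (\<lambda>i j. x i j t) \<oplus>\<^bsub>cmat_alg k\<^esub> (\<lambda>i j. y i j t)"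
      using t by (simp add: mat_alg_def)
    show "(\<lambda>i j. (x \<otimes>\<^bsub>mat_alg k C01\<^esub> y) i j t) = (\<lambda>i j. x i j t) \<otimes>\<^bsub>cmat_alg k\<^esub> (\<lambda>i j. y i j t)"
      using mult[OF x y] by (simp add: fun_eq_iff)
  qed
qed

text \<open>
  A full matrix algebra is treated as an algebra of constant matrix-valued functions on \<open>[0,1]\<close>, so
  that both kinds of summands are covered; \<open>c\<close> tells whether the entries have to be constant.
\<close>

definition coeff_functions :: "bool \<Rightarrow> (real \<Rightarrow> complex) set" where
  "coeff_functions c =
    {g. continuous_on {0..1} g \<and> (c \<longrightarrow> (\<forall>s\<in>{0..1}. \<forall>t\<in>{0..1}. g s = g t))}"

text \<open>
  \<open>E x l t\<close> is the value at \<open>t\<close> of the component of \<open>x\<close> in the summand with index \<open>l\<close>, a matrix of size \<open>k l\<close>.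
  The four conditions say that \<open>E\<close> identifies \<open>R\<close> with the direct sum over \<open>l < n\<close> of the algebras of
  all matrix functions with entries in \<open>coeff_functions (c l)\<close>: evaluations are *-homomorphisms,
  they separate points, their entries are admissible functions, and all families of admissible
  entries occur.
\<close>

definition coordinates ::
  "('a, 'x) star_alg_scheme \<Rightarrow> nat \<Rightarrow> (nat \<Rightarrow> nat) \<Rightarrow> (nat \<Rightarrow> bool) \<Rightarrow>
    ('a \<Rightarrow> nat \<Rightarrow> real \<Rightarrow> nat \<Rightarrow> nat \<Rightarrow> complex) \<Rightarrow> bool" where
  "coordinates R n k c E \<longleftrightarrow>
    (\<forall>l<n. \<forall>t\<in>{0..1}. star_hom R (cmat_alg (k l)) (\<lambda>x. E x l t)) \<and>
    (\<forall>x\<in>carrier R. \<forall>y\<in>carrier R. (\<forall>l<n. \<forall>t\<in>{0..1}. E x l t = E y l t) \<longrightarrow> x = y) \<and>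
    (\<forall>x\<in>carrier R. \<forall>l<n. \<forall>i j. (\<lambda>t. E x l t i j) \<in> coeff_functions (c l)) \<and>
    (\<forall>G. (\<forall>l i j. G l i j \<in> coeff_functions (c l)) \<longrightarrow>
      (\<exists>x\<in>carrier R. \<forall>l<n. \<forall>t\<in>{0..1}.
        E x l t = (\<lambda>i j. if i < k l \<and> j < k l then G l i j t else 0)))"

lemma coordinates_hom:
  "coordinates R n k c E \<Longrightarrow> l < n \<Longrightarrow> t \<in> {0..1} \<Longrightarrow> star_hom R (cmat_alg (k l)) (\<lambda>x. E x l t)"
  by (simp only: coordinates_def) 

lemma coordinates_inj:
  assumes "coordinates R n k c E" "x \<in> carrier R" "y \<in> carrier R"
    and "\<And>l t. l < n \<Longrightarrow> t \<in> {0..1} \<Longrightarrow> E x l t = E y l t"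
  shows "x = y"
proof -
  have "\<forall>x\<in>carrier R. \<forall>y\<in>carrier R. (\<forall>l<n. \<forall>t\<in>{0..1}. E x l t = E y l t) \<longrightarrow> x = y"
    using assms(1) unfolding coordinates_def by (elim conjE)
  with assms(2-) show ?thesis by blast
qed

lemma coordinates_coeff:
  "coordinates R n k c E \<Longrightarrow> x \<in> carrier R \<Longrightarrow> l < n \<Longrightarrow> (\<lambda>t. E x l t i j) \<in> coeff_functions (c l)"
  by (simp only: coordinates_def)

lemma coordinates_surj:
  assumes "coordinates R n k c E" "\<And>l i j. G l i j \<in> coeff_functions (c l)"
  obtains x where "x \<in> carrier R"
    "\<And>l t. l < n \<Longrightarrow> t \<in> {0..1} \<Longrightarrow> E x l t = (\<lambda>i j. if i < k l \<and> j < k l then G l i j t else 0)"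
proof -
  have "\<forall>G. (\<forall>l i j. G l i j \<in> coeff_functions (c l)) \<longrightarrow>
      (\<exists>x\<in>carrier R. \<forall>l<n. \<forall>t\<in>{0..1}.
        E x l t = (\<lambda>i j. if i < k l \<and> j < k l then G l i j t else 0))"
    using assms(1) unfolding coordinates_def by (elim conjE)
  with assms(2) that show thesis by blast
qed

lemma coordinates_cmat_alg: "coordinates (cmat_alg k) 1 (\<lambda>_. k) (\<lambda>_. True) (\<lambda>x l t. x)"
proof -
  have "\<exists>x\<in>carrier (cmat_alg k). \<forall>t\<in>{0..1}. x = (\<lambda>i j. if i < k \<and> j < k then G i j t else 0)"
    if G: "\<And>i j. G i j \<in> coeff_functions True" for G :: "nat \<Rightarrow> nat \<Rightarrow> real \<Rightarrow> complex"
  proof (intro bexI ballI)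
    fix t :: real assume "t \<in> {0..1}"
    moreover have "(0::real) \<in> {0..1}" by simp
    ultimately have "G i j 0 = G i j t" for i j
      using G[of i j] unfolding coeff_functions_def by blast
    then show "(\<lambda>i j. if i < k \<and> j < k then G i j 0 else 0) = (\<lambda>i j. if i < k \<and> j < k then G i j t else 0)"
      by (simp add: fun_eq_iff)
  qed simp
  note surj = this
  have one: "(1::nat) = Suc 0" and t0: "\<exists>t. t \<in> {0..1::real}"
    by (auto intro: exI[of _ 0])
  show ?thesis
    unfolding coordinates_def
  proof (intro conjI allI impI ballI)
    show "star_hom (cmat_alg k) (cmat_alg k) (\<lambda>x. x)"
      unfolding star_hom_def by blast
  next
    fix x y assume "\<forall>l<1::nat. \<forall>t\<in>{0..1::real}. x = (y :: nat \<Rightarrow> nat \<Rightarrow> complex)"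
    then show "x = y" using t0 zero_less_one by blast
  next
    fix x :: "nat \<Rightarrow> nat \<Rightarrow> complex" and i j
    show "(\<lambda>t. x i j) \<in> coeff_functions True"
      unfolding coeff_functions_def by simp
  next
    fix G :: "nat \<Rightarrow> nat \<Rightarrow> nat \<Rightarrow> real \<Rightarrow> complex"
    assume "\<forall>l i j. G l i j \<in> coeff_functions True"
    then have "\<exists>x\<in>carrier (cmat_alg k). \<forall>t\<in>{0..1}. x = (\<lambda>i j. if i < k \<and> j < k then G 0 i j t else 0)"
      by (intro surj) blast
    then show "\<exists>x\<in>carrier (cmat_alg k). \<forall>l<1. \<forall>t\<in>{0..1}.
        x = (\<lambda>i j. if i < k \<and> j < k then G l i j t else 0)"
      by (simp only: less_one simp_thms)
  qed
qed

lemma coordinates_mat_alg_C01: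
  "coordinates (mat_alg k C01) 1 (\<lambda>_. k) (\<lambda>_. False) (\<lambda>x l t i j. x i j t)"
  unfolding coordinates_def
proof (intro conjI allI impI ballI)
  show "star_hom (mat_alg k C01) (cmat_alg k) (\<lambda>x i j. x i j t)" if "t \<in> {0..1}" for t
    using that by (rule star_hom_evaluation)
next
  fix x y assume x: "x \<in> carrier (mat_alg k C01)" and y: "y \<in> carrier (mat_alg k C01)"
    and eq: "\<forall>l<1::nat. \<forall>t\<in>{0..1}. (\<lambda>i j. x i j t) = (\<lambda>i j. y i j t)"
  have "x i j \<in> extensional {0..1}" "y i j \<in> extensional {0..1}" for i j
    using mat_alg_C01_entry[OF x, of i j] mat_alg_C01_entry[OF y, of i j]
    unfolding C01_simps(1) by blast+
  moreover have "x i j t = y i j t" if "t \<in> {0..1}" for i j t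
  proof -
    have "(\<lambda>i j. x i j t) = (\<lambda>i j. y i j t)" using eq that zero_less_one by blast
    then show ?thesis by (rule fun_cong[OF fun_cong])
  qed
  ultimately have "x i j = y i j" for i j
    by (intro extensionalityI[of "x i j" "{0..1}" "y i j"])
  then show "x = y" by (simp add: fun_eq_iff)
next
  fix x i j assume "x \<in> carrier (mat_alg k C01)"
  from mat_alg_C01_entry[OF this, of i j] show "(\<lambda>t. x i j t) \<in> coeff_functions False"
    unfolding C01_simps(1) coeff_functions_def by blast
next
  fix G :: "nat \<Rightarrow> nat \<Rightarrow> nat \<Rightarrow> real \<Rightarrow> complex"
  assume "\<forall>l i j. G l i j \<in> coeff_functions False"
  then have "continuous_on {0..1} (G l i j)" for l i j
    by (simp add: coeff_functions_def)
  then have "(\<lambda>i j. if i < k \<and> j < k then restrict (G 0 i j) {0..1} else \<zero>\<^bsub>C01\<^esub>) \<in> carrier (mat_alg k C01)"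
    unfolding carrier_mat_alg using restrict_in_C01 by (simp del: C01_simps)
  then show "\<exists>x\<in>carrier (mat_alg k C01). \<forall>l<1. \<forall>t\<in>{0..1}.
      (\<lambda>i j. x i j t) = (\<lambda>i j. if i < k \<and> j < k then G l i j t else 0)"
    by (rule bexI[rotated]) (auto simp: fun_eq_iff)
qed

text \<open>
  Coordinates only refer to the operations on elements of the carrier; hence they can be pulled back along a
  *-isomorphism.
\<close>

lemma coordinates_star_iso:
  assumes "star_iso R S \<phi>" "coordinates S n k c E"
  shows "coordinates R n k c (\<lambda>x. E (\<phi> x))"
proof -
  have b: "bij_betw \<phi> (carrier R) (carrier S)" using assms(1) by (simp add: star_iso_def)
  have mem: "\<phi> x \<in> carrier S" if "x \<in> carrier R" for x using b that by (rule bij_betwE[rule_format])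
  have inj: "x = y" if "x \<in> carrier R" "y \<in> carrier R" "\<phi> x = \<phi> y" for x y
    using b that by (auto simp: bij_betw_def inj_on_def)
  have surj: "\<exists>x\<in>carrier R. \<phi> x = s" if "s \<in> carrier S" for s
    using that unfolding bij_betw_imp_surj_on[OF b, symmetric] by blast
  show ?thesis
    unfolding coordinates_def
  proof (intro conjI allI impI ballI)
    fix l t assume "l < n" "t \<in> {0..1::real}"
    from star_hom_comp[OF star_iso_imp_star_hom[OF assms(1)] coordinates_hom[OF assms(2) this]]
    show "star_hom R (cmat_alg (k l)) (\<lambda>x. E (\<phi> x) l t)" .
  next
    fix x y assume "x \<in> carrier R" "y \<in> carrier R"
      and eq: "\<forall>l<n. \<forall>t\<in>{0..1}. E (\<phi> x) l t = E (\<phi> y) l t"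
    moreover from this have "\<phi> x = \<phi> y"
      by (intro coordinates_inj[OF assms(2) mem mem]) blast+
    ultimately show "x = y" by (intro inj)
  next
    fix x l i j assume "x \<in> carrier R" "l < n"
    then show "(\<lambda>t. E (\<phi> x) l t i j) \<in> coeff_functions (c l)"
      by (intro coordinates_coeff[OF assms(2)] mem)
  next
    fix G :: "nat \<Rightarrow> nat \<Rightarrow> nat \<Rightarrow> real \<Rightarrow> complex"
    assume "\<forall>l i j. G l i j \<in> coeff_functions (c l)"
    then obtain s where s: "s \<in> carrier S"
      "\<And>l t. l < n \<Longrightarrow> t \<in> {0..1} \<Longrightarrow> E s l t = (\<lambda>i j. if i < k l \<and> j < k l then G l i j t else 0)"
      using coordinates_surj[OF assms(2), of G] by metis
    obtain x where "x \<in> carrier R" "\<phi> x = s" using surj[OF s(1)] by blast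
    with s(2) show "\<exists>x\<in>carrier R. \<forall>l<n. \<forall>t\<in>{0..1}.
        E (\<phi> x) l t = (\<lambda>i j. if i < k l \<and> j < k l then G l i j t else 0)"
      by blast
  qed
qed

lemma coordinates_direct_sum:
  assumes "\<And>l. l < n \<Longrightarrow> coordinates (B l) 1 (\<lambda>_. k l) (\<lambda>_. c l) (e l)"
  shows "coordinates (direct_sum_alg n B) n k c (\<lambda>x l. e l (x l) 0)"
  unfolding coordinates_def
proof (intro conjI allI impI ballI)
  fix l t assume l: "l < n" and t: "t \<in> {0..1::real}"
  show "star_hom (direct_sum_alg n B) (cmat_alg (k l)) (\<lambda>x. e l (x l) 0 t)"
    using star_hom_direct_sum[OF l, of B] coordinates_hom[OF assms[OF l] zero_less_one t]
    by (rule star_hom_comp)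
next
  fix x y assume x: "x \<in> carrier (direct_sum_alg n B)" and y: "y \<in> carrier (direct_sum_alg n B)"
    and eq: "\<forall>l<n. \<forall>t\<in>{0..1}. e l (x l) 0 t = e l (y l) 0 t"
  have "x l = y l" if l: "l < n" for l
  proof (rule coordinates_inj[OF assms[OF l]])
    show "x l \<in> carrier (B l)" "y l \<in> carrier (B l)"
      using x y l by (auto simp: direct_sum_alg_def)
    show "e l (x l) m t = e l (y l) m t" if "m < 1" "t \<in> {0..1}" for m t
      using eq l that unfolding less_one by blast
  qed
  then show "x = y"
    using x y by (intro PiE_ext[of x "{..<n}" "\<lambda>i. carrier (B i)" y]) (auto simp: direct_sum_alg_def)
next
  fix x l i j assume "x \<in> carrier (direct_sum_alg n B)" and l: "l < n"
  then have "x l \<in> carrier (B l)" by (auto simp: direct_sum_alg_def)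
  then show "(\<lambda>t. e l (x l) 0 t i j) \<in> coeff_functions (c l)"
    by (rule coordinates_coeff[OF assms[OF l] _ zero_less_one])
next
  fix G :: "nat \<Rightarrow> nat \<Rightarrow> nat \<Rightarrow> real \<Rightarrow> complex"
  assume G: "\<forall>l i j. G l i j \<in> coeff_functions (c l)"
  have "\<exists>x\<in>carrier (B l). \<forall>t\<in>{0..1}. e l x 0 t = (\<lambda>i j. if i < k l \<and> j < k l then G l i j t else 0)"
    if l: "l < n" for l
  proof (rule coordinates_surj[OF assms[OF l], of "\<lambda>m. G l"])
    show "G l i j \<in> coeff_functions (c l)" for i j using G by blast
    fix x assume "x \<in> carrier (B l)" "\<And>m t. m < 1 \<Longrightarrow> t \<in> {0..1} \<Longrightarrow>
      e l x m t = (\<lambda>i j. if i < k l \<and> j < k l then G l i j t else 0)"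
    then show ?thesis using zero_less_one by blast
  qed
  then have "\<forall>l. \<exists>x. l < n \<longrightarrow> x \<in> carrier (B l) \<and>
      (\<forall>t\<in>{0..1}. e l x 0 t = (\<lambda>i j. if i < k l \<and> j < k l then G l i j t else 0))"
    by blast
  then obtain x where x: "\<forall>l. l < n \<longrightarrow> x l \<in> carrier (B l) \<and>
      (\<forall>t\<in>{0..1}. e l (x l) 0 t = (\<lambda>i j. if i < k l \<and> j < k l then G l i j t else 0))"
    unfolding choice_iff by blast
  show "\<exists>x\<in>carrier (direct_sum_alg n B). \<forall>l<n. \<forall>t\<in>{0..1}.
      e l (x l) 0 t = (\<lambda>i j. if i < k l \<and> j < k l then G l i j t else 0)"
  proof (rule bexI[of _ "restrict x {..<n}"], intro allI impI ballI)
    show "restrict x {..<n} \<in> carrier (direct_sum_alg n B)"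
      using x by (simp add: direct_sum_alg_def)
    fix l t assume "l < n" "t \<in> {0..1::real}"
    then show "e l (restrict x {..<n} l) 0 t = (\<lambda>i j. if i < k l \<and> j < k l then G l i j t else 0)"
      using x by simp
  qed
qed

lemma class_I_coordinates:
  assumes "in_class_I R"
  obtains n k c E where "n > 0" "\<And>l. l < n \<Longrightarrow> k l \<ge> 1" "coordinates R n k c E"
proof -
  from assms obtain n and B :: "nat \<Rightarrow> 'a star_alg" where n: "n > 0"
    and B: "\<And>i. i < n \<Longrightarrow> \<exists>k\<ge>1. star_isomorphic (B i) (cmat_alg k) \<or> star_isomorphic (B i) (mat_alg k C01)"
    and iso: "star_isomorphic R (direct_sum_alg n B)"
    unfolding in_class_I_def by blast
  have "\<exists>k c e. k \<ge> 1 \<and> coordinates (B i) 1 (\<lambda>_. k) (\<lambda>_. c) e" if i: "i < n" for i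
  proof -
    from B[OF i] obtain k where k: "k \<ge> 1"
      and "(\<exists>\<phi>. star_iso (B i) (cmat_alg k) \<phi>) \<or> (\<exists>\<phi>. star_iso (B i) (mat_alg k C01) \<phi>)"
      unfolding star_isomorphic_def by blast
    from this(2) show ?thesis
    proof (elim disjE exE)
      fix \<phi> assume "star_iso (B i) (cmat_alg k) \<phi>"
      from k coordinates_star_iso[OF this coordinates_cmat_alg] show ?thesis
        by (intro exI conjI)
    next
      fix \<phi> assume "star_iso (B i) (mat_alg k C01) \<phi>"
      from k coordinates_star_iso[OF this coordinates_mat_alg_C01] show ?thesis
        by (intro exI conjI)
    qed
  qed
  then have "\<forall>i. \<exists>k c e. i < n \<longrightarrow> k \<ge> 1 \<and> coordinates (B i) 1 (\<lambda>_. k) (\<lambda>_. c) e"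
    by blast
  then obtain k c e where "\<forall>i. i < n \<longrightarrow> k i \<ge> 1 \<and> coordinates (B i) 1 (\<lambda>_. k i) (\<lambda>_. c i) (e i)"
    unfolding choice_iff by blast
  then have k: "k i \<ge> 1" and e: "coordinates (B i) 1 (\<lambda>_. k i) (\<lambda>_. c i) (e i)" if "i < n" for i
    using that by blast+
  obtain \<phi> where \<phi>: "star_iso R (direct_sum_alg n B) \<phi>"
    using iso unfolding star_isomorphic_def by blast
  show thesis
    by (rule that[OF n k coordinates_star_iso[OF \<phi> coordinates_direct_sum[OF e]]])
qed

section \<open>Point evaluations determine the norm\<close>

lemma coeff_functionsI:
  assumes "continuous_on {0..1} g" "\<And>s t. c \<Longrightarrow> s \<in> {0..1} \<Longrightarrow> t \<in> {0..1} \<Longrightarrow> g s = g t"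
  shows "g \<in> coeff_functions c"
  unfolding coeff_functions_def using assms by blast

lemma zero_in_coeff_functions: "(\<lambda>t. 0) \<in> coeff_functions c"
  by (simp add: coeff_functions_def)

text \<open>
  A real function \<open>h\<close> with \<open>\<bar>h\<bar> \<le> r\<close> is \<open>r/2\<close> times the sum of \<open>u\<close> and its conjugate, where
  \<open>u = h/r + \<i> sqrt (1 - (h/r)\<^sup>2)\<close> is unimodular. This is applied to the real and the
  imaginary part of \<open>g\<close>; the formula keeps constant functions constant.
\<close>

lemma coeff_functions_unitary_decomposition:
  assumes g: "g \<in> coeff_functions c" and r: "r > 0" and le: "\<And>t. t \<in> {0..1} \<Longrightarrow> cmod (g t) \<le> r"
  obtains u v where "u \<in> coeff_functions c" "(\<lambda>t. cnj (u t)) \<in> coeff_functions c"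
    "v \<in> coeff_functions c" "(\<lambda>t. cnj (v t)) \<in> coeff_functions c"
    "\<And>t. t \<in> {0..1} \<Longrightarrow> cmod (u t) = 1" "\<And>t. t \<in> {0..1} \<Longrightarrow> cmod (v t) = 1"
    "\<And>t. t \<in> {0..1} \<Longrightarrow> g t = complex_of_real (r/2) * (u t + cnj (u t) + \<i> * (v t + cnj (v t)))"
proof -
  define w where "w h t = Complex (h (g t) / r) (sqrt (1 - (h (g t) / r)\<^sup>2))" for h :: "complex \<Rightarrow> real" and t :: real
  have cont: "continuous_on {0..1} g" and const: "c \<Longrightarrow> s \<in> {0..1} \<Longrightarrow> t \<in> {0..1} \<Longrightarrow> g s = g t" for s t
    using g unfolding coeff_functions_def by blast+
  have w: "w h \<in> coeff_functions c" "(\<lambda>t. cnj (w h t)) \<in> coeff_functions c"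
    if h: "continuous_on UNIV h" for h
  proof -
    have "continuous_on {0..1} (\<lambda>t. h (g t))"
      by (rule continuous_on_compose2[OF h cont]) (rule subset_UNIV)
    then have ch: "continuous_on {0..1} (\<lambda>t. h (g t) / r)"
      using r by (intro continuous_on_divide continuous_on_const) auto
    have cont_w: "continuous_on {0..1} (w h)"
      unfolding w_def by (intro continuous_on_Complex continuous_on_real_sqrt continuous_on_diff
          continuous_on_power continuous_on_const ch)
    have const_w: "w h s = w h t" if "c" "s \<in> {0..1}" "t \<in> {0..1}" for s t
      unfolding w_def by (simp only: const[OF that])
    show "w h \<in> coeff_functions c"
      using cont_w const_w by (rule coeff_functionsI)
    show "(\<lambda>t. cnj (w h t)) \<in> coeff_functions c"
      by (rule coeff_functionsI[OF continuous_on_cnj[OF cont_w] arg_cong[OF const_w]])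
  qed
  have unit: "cmod (w h t) = 1" if t: "t \<in> {0..1}" and h: "\<And>z. \<bar>h z\<bar> \<le> cmod z" for h t
  proof -
    have "\<bar>h (g t) / r\<bar> \<le> 1" using order_trans[OF h le[OF t]] r by simp
    then have "(h (g t) / r)\<^sup>2 \<le> 1" by (simp add: abs_square_le_1)
    then show ?thesis by (simp add: w_def cmod_def)
  qed
  have sum: "w h t + cnj (w h t) = complex_of_real (2 / r * h (g t))" for h t
    by (simp add: w_def complex_eq_iff)
  have "g t = complex_of_real (r/2) * (w Re t + cnj (w Re t) + \<i> * (w Im t + cnj (w Im t)))" for t
    unfolding sum using r by (simp add: complex_eq_iff)
  moreover have "continuous_on UNIV Re" "continuous_on UNIV Im"
    by (intro continuous_on_Re continuous_on_Im continuous_on_id)+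
  ultimately show thesis
    by (intro that[of "w Re" "w Im"] w unit abs_Re_le_cmod abs_Im_le_cmod)
qed

lemma sum_in_subalgebra:
  assumes I: "cstar_subalgebra univ_alg I" and "finite P" "\<And>x. x \<in> P \<Longrightarrow> z x \<in> I"
  shows "(\<Sum>x\<in>P. z x) \<in> I"
  using assms(2,3)
  by (induction P rule: finite_induct) (use I in \<open>simp_all add: cstar_subalgebra_univ_alg\<close>)

lemma star_hom_matrix_sum:
  assumes I: "cstar_subalgebra univ_alg I" and hom: "star_hom (subalg I p) (cmat_alg k) f"
    and P: "finite P" "\<And>x. x \<in> P \<Longrightarrow> z x \<in> I"
  shows "f (\<Sum>x\<in>P. z x) = (\<lambda>i j. \<Sum>x\<in>P. f (z x) i j)"
  using P
proof (induction P rule: finite_induct)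
  case empty
  have "f (scaleC 0 0) = (\<lambda>i j. 0 * f 0 i j)"
    using hom I unfolding star_hom_subalg_matrix cstar_subalgebra_univ_alg by blast
  then show ?case using I by (simp add: cstar_subalgebra_univ_alg)
next
  case (insert x F)
  then have F: "z x \<in> I" "(\<Sum>x\<in>F. z x) \<in> I" "f (\<Sum>x\<in>F. z x) = (\<lambda>i j. \<Sum>x\<in>F. f (z x) i j)"
    by (auto intro!: sum_in_subalgebra[OF I])
  then have "f (z x + (\<Sum>x\<in>F. z x)) = (\<lambda>i j. f (z x) i j + f (\<Sum>x\<in>F. z x) i j)"
    using hom unfolding star_hom_subalg_matrix by blast
  then show ?case using insert F by simp
qed

context
  fixes I :: "'a::cstar_algebra_1 set" and p n k c E
  assumes I: "cstar_subalgebra univ_alg I" and co: "coordinates (subalg I p) n k c E"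
begin

lemma evaluation_hom: "l < n \<Longrightarrow> t \<in> {0..1} \<Longrightarrow> star_hom (subalg I p) (cmat_alg (k l)) (\<lambda>x. E x l t)"
  using co by (rule coordinates_hom)

lemma evaluation_simps:
  assumes "l < n" "t \<in> {0..1}" "x \<in> I"
  shows "\<not> (i < k l \<and> j < k l) \<Longrightarrow> E x l t i j = 0"
    and "y \<in> I \<Longrightarrow> E (x + y) l t = (\<lambda>i j. E x l t i j + E y l t i j)"
    and "y \<in> I \<Longrightarrow> E (x * y) l t = mmul (k l) (E x l t) (E y l t)"
    and "E (scaleC z x) l t = (\<lambda>i j. z * E x l t i j)"
    and "E (adj x) l t = madj (E x l t)"
  using evaluation_hom[OF assms(1,2)] assms(3) unfolding star_hom_subalg_matrix by blast+

lemma eq_if_coordinates_eq: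
  assumes "x \<in> I" "y \<in> I" "\<And>l t. l < n \<Longrightarrow> t \<in> {0..1} \<Longrightarrow> E x l t = E y l t"
  shows "x = y"
  by (rule coordinates_inj[OF co]) (use assms in simp_all)

lemma subalgebra_closed:
  "x \<in> I \<Longrightarrow> y \<in> I \<Longrightarrow> x + y \<in> I" "x \<in> I \<Longrightarrow> y \<in> I \<Longrightarrow> x * y \<in> I" "x \<in> I \<Longrightarrow> scaleC z x \<in> I"
  "x \<in> I \<Longrightarrow> adj x \<in> I"
  using I unfolding cstar_subalgebra_univ_alg by blast+

text \<open>
  For the element \<open>y = u e\<^sub>a\<^sub>b\<close> with unimodular \<open>u\<close>, all evaluations of \<open>y* y\<close> are those of the matrix unit
  \<open>e\<^sub>b\<^sub>b\<close>. Since evaluations separate points, \<open>y* y\<close> is a projection, and \<open>\<parallel>y\<parallel>\<^sup>2 = \<parallel>y* y\<parallel> \<le> 1\<close>. This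
  is the step where the algebraic structure alone controls the norm of the ambient algebra.
\<close>

lemma unimodular_entry:
  assumes "l < n" "a < k l" "b < k l" and u: "u \<in> coeff_functions (c l)"
    and un: "\<And>t. t \<in> {0..1} \<Longrightarrow> cmod (u t) = 1"
  obtains y where "y \<in> I" "norm y \<le> 1"
    "\<And>m t. m < n \<Longrightarrow> t \<in> {0..1} \<Longrightarrow> E y m t = (\<lambda>i j. if m = l \<and> i = a \<and> j = b then u t else 0)"
proof -
  define G where "G m i j = (if m = l \<and> i = a \<and> j = b then u else (\<lambda>t. 0))" for m i j
  have "G m i j \<in> coeff_functions (c m)" for m i j
    using u zero_in_coeff_functions by (simp add: G_def)
  then obtain y where y: "y \<in> carrier (subalg I p)" and Ey:
    "\<And>m t. m < n \<Longrightarrow> t \<in> {0..1} \<Longrightarrow> E y m t = (\<lambda>i j. if i < k m \<and> j < k m then G m i j t else 0)"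
    using coordinates_surj[OF co, of G] by blast
  have yI: "y \<in> I" using y by simp
  have E: "E y m t = (\<lambda>i j. if m = l \<and> i = a \<and> j = b then u t else 0)" if "m < n" "t \<in> {0..1}" for m t
    unfolding Ey[OF that] using assms(2,3) by (auto simp: G_def fun_eq_iff)
  define q where "q = adj y * y"
  have qI: "q \<in> I" using yI by (simp add: q_def subalgebra_closed)
  have Eq: "E q m t = (\<lambda>i j. if m = l \<and> i = b \<and> j = b then 1 else 0)" if m: "m < n" and t: "t \<in> {0..1}" for m t
  proof -
    have *: "E q m t = mmul (k m) (madj (E y m t)) (E y m t)"
      unfolding q_def using evaluation_simps(3,5)[OF m t] yI subalgebra_closed by simp
    have u1: "cnj (u t) * u t = 1"
      using un[OF t] complex_norm_square[of "u t"] by (simp add: mult.commute)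
    have "(\<Sum>x<k m. cnj (if m = l \<and> x = a \<and> i = b then u t else 0) * (if m = l \<and> x = a \<and> j = b then u t else 0))
        = (\<Sum>x<k m. if x = a then (if m = l \<and> i = b \<and> j = b then 1 else 0) else 0)" for i j
      by (rule sum.cong) (auto simp: u1)
    then show ?thesis
      unfolding * E[OF m t] mmul_def madj_def using assms(2) by (auto simp: fun_eq_iff)
  qed
  have "q * q = q"
  proof (rule eq_if_coordinates_eq)
    show "q * q \<in> I" "q \<in> I" using qI subalgebra_closed by auto
    fix m t assume m: "m < n" and t: "t \<in> {0..1::real}"
    have "(\<Sum>x<k m. (if m = l \<and> i = b \<and> x = b then 1 else 0) * (if m = l \<and> x = b \<and> j = b then 1 else 0))
        = (\<Sum>x<k m. if x = b then (if m = l \<and> i = b \<and> j = b then 1 else 0) else (0::complex))" for i j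
      by (rule sum.cong) auto
    then show "E (q * q) m t = E q m t"
      unfolding evaluation_simps(3)[OF m t qI qI] Eq[OF m t] mmul_def using assms(3) by (auto simp: fun_eq_iff)
  qed
  moreover have "adj q = q" by (simp add: q_def adj_mult adj_adj)
  ultimately have "norm q \<le> 1" by (rule norm_projection_le_1)
  then have "norm y \<le> 1" by (simp add: q_def cstar_identity abs_square_le_1)
  from that[OF yI this E] show thesis .
qed

lemma bounded_entry:
  assumes l: "l < n" "a < k l" "b < k l" and g: "g \<in> coeff_functions (c l)"
    and r: "r > 0" and le: "\<And>t. t \<in> {0..1} \<Longrightarrow> cmod (g t) \<le> r"
  obtains y where "y \<in> I" "norm y \<le> 2 * r"
    "\<And>m t. m < n \<Longrightarrow> t \<in> {0..1} \<Longrightarrow> E y m t = (\<lambda>i j. if m = l \<and> i = a \<and> j = b then g t else 0)"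
proof -
  obtain u v where uv: "u \<in> coeff_functions (c l)" "(\<lambda>t. cnj (u t)) \<in> coeff_functions (c l)"
    "v \<in> coeff_functions (c l)" "(\<lambda>t. cnj (v t)) \<in> coeff_functions (c l)"
    and un: "\<And>t. t \<in> {0..1} \<Longrightarrow> cmod (u t) = 1" "\<And>t. t \<in> {0..1} \<Longrightarrow> cmod (v t) = 1"
    and dec: "\<And>t. t \<in> {0..1} \<Longrightarrow> g t = complex_of_real (r/2) * (u t + cnj (u t) + \<i> * (v t + cnj (v t)))"
    using coeff_functions_unitary_decomposition[OF g r le] by metis
  define ent where "ent y h \<longleftrightarrow> y \<in> I \<and> norm y \<le> 1 \<and> (\<forall>m<n. \<forall>t\<in>{0..1}.
      E y m t = (\<lambda>i j. if m = l \<and> i = a \<and> j = b then h t else 0))" for y and h :: "real \<Rightarrow> complex"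
  have ex: "\<exists>y. ent y h" if h: "h \<in> coeff_functions (c l)" "\<And>t. t \<in> {0..1} \<Longrightarrow> cmod (h t) = 1" for h
    by (rule unimodular_entry[OF l h]) (auto simp: ent_def)
  obtain y1 y2 y3 y4 where y: "ent y1 u" "ent y2 (\<lambda>t. cnj (u t))" "ent y3 v" "ent y4 (\<lambda>t. cnj (v t))"
    using ex[OF uv(1)] ex[OF uv(2)] ex[OF uv(3)] ex[OF uv(4)] un by auto
  define y where "y = scaleC (complex_of_real (r/2)) ((y1 + y2) + scaleC \<i> (y3 + y4))"
  have yI: "y1 \<in> I" "y2 \<in> I" "y3 \<in> I" "y4 \<in> I" using y by (auto simp: ent_def)
  have "norm ((y1 + y2) + scaleC \<i> (y3 + y4)) \<le> norm (y1 + y2) + norm (y3 + y4)"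
    using norm_triangle_ineq[of "y1 + y2" "scaleC \<i> (y3 + y4)"] by (simp add: norm_scaleC)
  also have "\<dots> \<le> 4"
    using norm_triangle_ineq[of y1 y2] norm_triangle_ineq[of y3 y4] y by (simp add: ent_def)
  finally have "norm y \<le> (r/2) * 4"
    unfolding y_def norm_scaleC using r by (simp del: of_real_divide)
  then have ny: "norm y \<le> 2 * r" by simp
  have "E y m t = (\<lambda>i j. if m = l \<and> i = a \<and> j = b then g t else 0)" if mt: "m < n" "t \<in> {0..1}" for m t
  proof -
    have Ey: "E y m t = (\<lambda>i j. complex_of_real (r/2) *
        (E y1 m t i j + E y2 m t i j + \<i> * (E y3 m t i j + E y4 m t i j)))"
      unfolding y_def using yI by (simp add: evaluation_simps[OF mt] subalgebra_closed)
    have Ei: "E y1 m t = (\<lambda>i j. if m = l \<and> i = a \<and> j = b then u t else 0)"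
      "E y2 m t = (\<lambda>i j. if m = l \<and> i = a \<and> j = b then cnj (u t) else 0)"
      "E y3 m t = (\<lambda>i j. if m = l \<and> i = a \<and> j = b then v t else 0)"
      "E y4 m t = (\<lambda>i j. if m = l \<and> i = a \<and> j = b then cnj (v t) else 0)"
      using y mt unfolding ent_def by blast+
    show ?thesis
      unfolding Ey Ei dec[OF mt(2)] by (intro ext) simp
  qed
  with ny show thesis using that[of y] yI by (simp add: y_def subalgebra_closed)
qed

text \<open>
  Every element is the sum of its matrix entries, and the number of entries depends only on the
  algebra. The constant \<open>C\<close> is twice that number.
\<close>

lemma norm_le_const_mult_coordinates:
  obtains C where "\<And>y r. y \<in> I \<Longrightarrow> r > 0 \<Longrightarrow>
    (\<And>l t. l < n \<Longrightarrow> t \<in> {0..1} \<Longrightarrow> opnorm (k l) (E y l t) \<le> r) \<Longrightarrow> norm y \<le> C * r"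
proof -
  define P where "P = (SIGMA l:{..<n}. {..<k l} \<times> {..<k l})"
  have fin: "finite P" by (simp add: P_def)
  have "norm y \<le> (2 * real (card P)) * r"
    if y: "y \<in> I" and r: "r > 0"
      and le: "\<And>l t. l < n \<Longrightarrow> t \<in> {0..1} \<Longrightarrow> opnorm (k l) (E y l t) \<le> r" for y r
  proof -
    have "\<exists>z. z \<in> I \<and> norm z \<le> 2 * r \<and> (\<forall>m<n. \<forall>t\<in>{0..1}.
        E z m t = (\<lambda>i j. if x = (m, i, j) then E y m t i j else 0))" if "x \<in> P" for x
    proof -
      obtain l a b where x: "x = (l, a, b)" by (metis prod_cases3)
      then have l: "l < n" "a < k l" "b < k l" using that by (auto simp: P_def)
      have "(\<lambda>t. E y l t a b) \<in> coeff_functions (c l)"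
        by (rule coordinates_coeff[OF co _ l(1)]) (use y in simp)
      moreover have "cmod (E y l t a b) \<le> r" if "t \<in> {0..1}" for t
        using opnorm_entry[OF l(2,3)] le[OF l(1) that] by (rule order_trans)
      ultimately obtain z where z: "z \<in> I" "norm z \<le> 2 * r"
        "\<And>m t. m < n \<Longrightarrow> t \<in> {0..1} \<Longrightarrow> E z m t = (\<lambda>i j. if m = l \<and> i = a \<and> j = b then E y l t a b else 0)"
        using bounded_entry[OF l _ r] by blast
      have "E z m t = (\<lambda>i j. if x = (m, i, j) then E y m t i j else 0)" if "m < n" "t \<in> {0..1}" for m t
        unfolding z(3)[OF that] x by (auto simp: fun_eq_iff)
      with z(1,2) show ?thesis by blast
    qed
    then have "\<forall>x. \<exists>z. x \<in> P \<longrightarrow> z \<in> I \<and> norm z \<le> 2 * r \<and> (\<forall>m<n. \<forall>t\<in>{0..1}.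
        E z m t = (\<lambda>i j. if x = (m, i, j) then E y m t i j else 0))" by blast
    then obtain z where z: "\<forall>x. x \<in> P \<longrightarrow> z x \<in> I \<and> norm (z x) \<le> 2 * r \<and> (\<forall>m<n. \<forall>t\<in>{0..1}.
        E (z x) m t = (\<lambda>i j. if x = (m, i, j) then E y m t i j else 0))"
      unfolding choice_iff by blast
    have zI: "z x \<in> I" and zn: "norm (z x) \<le> 2 * r" if "x \<in> P" for x using z that by blast+
    have zE: "E (z x) m t = (\<lambda>i j. if x = (m, i, j) then E y m t i j else 0)"
      if "x \<in> P" "m < n" "t \<in> {0..1}" for x m t using z that by blast
    have "y = (\<Sum>x\<in>P. z x)"
    proof (rule eq_if_coordinates_eq[OF y sum_in_subalgebra[OF I fin, of z, OF zI]])
      fix m t assume mt: "m < n" "t \<in> {0..1::real}"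
      note S = star_hom_matrix_sum[OF I evaluation_hom[OF mt] fin, of z, OF zI]
      have "(\<Sum>x\<in>P. E (z x) m t i j) = E y m t i j" for i j
      proof -
        have "(\<Sum>x\<in>P. E (z x) m t i j) = (\<Sum>x\<in>P. if x = (m, i, j) then E y m t i j else 0)"
          by (rule sum.cong[OF refl]) (simp add: zE[OF _ mt])
        also have "\<dots> = (if (m, i, j) \<in> P then E y m t i j else 0)"
          using fin by simp
        also have "\<dots> = E y m t i j"
          using evaluation_simps(1)[OF mt y] mt by (auto simp: P_def)
        finally show ?thesis .
      qed
      then show "E y m t = E (\<Sum>x\<in>P. z x) m t" using S by (simp add: fun_eq_iff)
    qed
    then have "norm y \<le> (\<Sum>x\<in>P. norm (z x))" by (simp add: norm_sum)
    also have "\<dots> \<le> real (card P) * (2 * r)" by (rule sum_bounded_above) (rule zn)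
    finally show ?thesis by (simp add: mult_ac)
  qed
  then show thesis by (rule that)
qed

lemma opnorm_coordinate_power:
  assumes h: "h \<in> I" and lt: "l < n" "t \<in> {0..1}" and le: "opnorm (k l) (E h l t) \<le> s"
  shows "h ^ Suc m \<in> I \<and> opnorm (k l) (E (h ^ Suc m) l t) \<le> s ^ Suc m"
proof (induction m)
  case 0
  then show ?case using h le by simp
next
  case (Suc m)
  have "opnorm (k l) (mmul (k l) (E h l t) (E (h ^ Suc m) l t)) \<le> s * s ^ Suc m"
    using opnorm_mult by (rule order_trans) (use Suc le in \<open>intro mult_mono, auto intro: order_trans[OF opnorm_nonneg]\<close>)
  then show ?case
    using evaluation_simps(3)[OF lt h, of "h ^ Suc m"] Suc h subalgebra_closed(2) by (simp del: power_Suc add: power_Suc[of _ "Suc m"])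
qed

text \<open>
  If all evaluations of \<open>y\<close> had norm at most \<open>r < \<parallel>y\<parallel>\<close>, those of \<open>h = y* y\<close> would be bounded by \<open>r\<^sup>2\<close>, and
  those of \<open>h^N\<close> by \<open>r^(2 N)\<close>. For \<open>N = 2^j\<close> the C*-identity gives \<open>\<parallel>h^N\<parallel> = \<parallel>y\<parallel>^(2 N)\<close>, so
  \<open>(\<parallel>y\<parallel>/r)^(2 N) \<le> C\<close> for all \<open>j\<close>, which is impossible.
\<close>

lemma evaluations_norming:
  assumes n: "n > 0" and y: "y \<in> I" and \<epsilon>: "\<epsilon> > 0"
  obtains l t where "l < n" "t \<in> {0..1}" "norm y - \<epsilon> < opnorm (k l) (E y l t)"
proof (rule ccontr)
  note witness = that
  assume "\<not> thesis"
  then have le0: "opnorm (k l) (E y l t) \<le> norm y - \<epsilon>" if "l < n" "t \<in> {0..1}" for l t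
    using witness[OF that] by (intro leI) blast
  have "0 \<le> norm y - \<epsilon>"
    by (rule order_trans[OF opnorm_nonneg le0[of 0 0]]) (use n in simp_all)
  (* The bound norm y - eps may be zero; the larger r is positive. *)
  define r where "r = norm y - \<epsilon> / 2"
  have r: "r > 0" "r < norm y" using \<open>0 \<le> norm y - \<epsilon>\<close> \<epsilon> by (auto simp: r_def)
  have le: "opnorm (k l) (E y l t) \<le> r" if "l < n" "t \<in> {0..1}" for l t
    using le0[OF that] \<epsilon> by (simp add: r_def)
  define h where "h = adj y * y"
  have hI: "h \<in> I" using y by (simp add: h_def subalgebra_closed)
  have h_le: "opnorm (k l) (E h l t) \<le> r\<^sup>2" if lt: "l < n" "t \<in> {0..1}" for l t
  proof -
    have "E h l t = mmul (k l) (madj (E y l t)) (E y l t)"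
      unfolding h_def using y subalgebra_closed(4) by (simp add: evaluation_simps(3,5)[OF lt])
    then have "opnorm (k l) (E h l t) \<le> opnorm (k l) (E y l t) * opnorm (k l) (E y l t)"
      using opnorm_mult[of "k l" "madj (E y l t)" "E y l t"] by simp
    also have "\<dots> \<le> r * r" using le[OF lt] r by (intro mult_mono) auto
    finally show ?thesis by (simp add: power2_eq_square)
  qed
  have sa: "adj (h ^ m) = h ^ m" if "m > 0" for m
    using that
  proof (induction m rule: nat_induct_non_zero)
    case 1
    then show ?case by (simp add: h_def adj_mult adj_adj)
  next
    case (Suc m)
    then show ?case
      by (subst power_Suc) (simp only: adj_mult, simp add: h_def adj_mult adj_adj power_commutes)
  qed
  (* The C*-identity gives the norm of a square of a self-adjoint element, hence only exponents
     that are powers of two. *)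
  have npow: "norm (h ^ 2 ^ j) = ((norm y)\<^sup>2) ^ 2 ^ j" for j
  proof (induction j)
    case 0
    then show ?case by (simp add: h_def cstar_identity)
  next
    case (Suc j)
    have "norm (h ^ 2 ^ Suc j) = norm (adj (h ^ 2 ^ j) * h ^ 2 ^ j)"
      by (simp add: sa power_add[symmetric] mult_2)
    also have "\<dots> = ((norm y)\<^sup>2) ^ 2 ^ Suc j"
      unfolding cstar_identity Suc by (simp add: power_mult[symmetric] mult_ac)
    finally show ?case .
  qed
  obtain C where C: "\<And>y r. y \<in> I \<Longrightarrow> r > 0 \<Longrightarrow>
    (\<And>l t. l < n \<Longrightarrow> t \<in> {0..1} \<Longrightarrow> opnorm (k l) (E y l t) \<le> r) \<Longrightarrow> norm y \<le> C * r"
    using norm_le_const_mult_coordinates by blast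
  have bound: "((norm y)\<^sup>2 / r\<^sup>2) ^ 2 ^ j \<le> C" for j
  proof -
    obtain m where m: "2 ^ j = Suc m" by (metis not0_implies_Suc power_not_zero zero_neq_numeral)
    have "h ^ 2 ^ j \<in> I" unfolding m
      using opnorm_coordinate_power[OF hI n _ h_le[OF n], of 0] by auto
    moreover have "opnorm (k l) (E (h ^ 2 ^ j) l t) \<le> (r\<^sup>2) ^ 2 ^ j" if "l < n" "t \<in> {0..1}" for l t
      unfolding m using opnorm_coordinate_power[OF hI that h_le[OF that]] by blast
    ultimately have "norm (h ^ 2 ^ j) \<le> C * (r\<^sup>2) ^ 2 ^ j"
      using r by (intro C) auto
    then show ?thesis
      unfolding npow using r by (simp add: power_divide divide_le_eq)
  qed
  have "1 < (norm y)\<^sup>2 / r\<^sup>2"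
    using r by (simp add: power_strict_mono)
  moreover from this obtain N where "C < ((norm y)\<^sup>2 / r\<^sup>2) ^ N"
    using real_arch_pow by blast
  moreover have "((norm y)\<^sup>2 / r\<^sup>2) ^ N \<le> ((norm y)\<^sup>2 / r\<^sup>2) ^ 2 ^ N"
    using \<open>1 < (norm y)\<^sup>2 / r\<^sup>2\<close> less_exp[of N] by (intro power_increasing) auto
  ultimately show False using bound[of N] by linarith
qed

end

theorem class_I_matrix_representation:
  fixes I :: "'a::cstar_algebra_1 set"
  assumes I: "cstar_subalgebra univ_alg I" and cI: "in_class_I (subalg I p)"
    and y: "y \<in> I" and \<epsilon>: "\<epsilon> > 0"
  obtains k f where "k \<ge> 1" "star_hom (subalg I p) (cmat_alg k) f"
    "\<And>x. x \<in> I \<Longrightarrow> opnorm k (f x) \<le> norm x" "norm y - \<epsilon> < opnorm k (f y)"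
proof -
  obtain n k c E where n: "n > 0" and k: "\<And>l. l < n \<Longrightarrow> k l \<ge> 1" and co: "coordinates (subalg I p) n k c E"
    using class_I_coordinates[OF cI] by blast
  obtain l t where l: "l < n" and t: "t \<in> {0..1}" and gt: "norm y - \<epsilon> < opnorm (k l) (E y l t)"
    using evaluations_norming[OF I co n y \<epsilon>] by blast
  have hom: "star_hom (subalg I p) (cmat_alg (k l)) (\<lambda>x. E x l t)"
    using co l t by (rule coordinates_hom)
  show thesis
    by (rule that[OF k[OF l] hom matrix_hom_contractive[OF I hom] gt])
qed

section \<open>Asymptotic embeddings of tracially AI algebras\<close>

lemma tendsto_zero_squeeze:
  fixes a b :: "nat \<Rightarrow> real"
  assumes "\<And>n. 0 \<le> a n" "\<And>n. a n \<le> b n" "b \<longlonglongrightarrow> 0"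
  shows "a \<longlonglongrightarrow> 0"
  by (rule tendsto_sandwich[OF _ _ tendsto_const assms(3)]) (use assms(1,2) in simp_all)

text \<open>
  The maps \<open>\<phi> n\<close> are arbitrary functions; only their defects from being *-homomorphisms are required
  to tend to zero. The last two conditions together say \<open>limsup \<parallel>\<phi> n x\<parallel> = \<parallel>x\<parallel>\<close>.
\<close>

definition asymptotic_embedding ::
  "(nat \<Rightarrow> nat) \<Rightarrow> (nat \<Rightarrow> 'a::cstar_algebra_1 \<Rightarrow> nat \<Rightarrow> nat \<Rightarrow> complex) \<Rightarrow> bool" where
  "asymptotic_embedding m \<phi> \<longleftrightarrow>
    (\<forall>n x. \<phi> n x \<in> carrier (cmat_alg (m n))) \<and>
    (\<forall>x. \<exists>B. \<forall>n. opnorm (m n) (\<phi> n x) \<le> B) \<and>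
    (\<forall>x y. (\<lambda>n. mat_dist (m n) (\<phi> n (x + y)) (\<lambda>i j. \<phi> n x i j + \<phi> n y i j)) \<longlonglongrightarrow> 0) \<and>
    (\<forall>x y. (\<lambda>n. mat_dist (m n) (\<phi> n (x * y)) (mmul (m n) (\<phi> n x) (\<phi> n y))) \<longlonglongrightarrow> 0) \<and>
    (\<forall>c x. (\<lambda>n. mat_dist (m n) (\<phi> n (scaleC c x)) (\<lambda>i j. c * \<phi> n x i j)) \<longlonglongrightarrow> 0) \<and>
    (\<forall>x. (\<lambda>n. mat_dist (m n) (\<phi> n (adj x)) (madj (\<phi> n x))) \<longlonglongrightarrow> 0) \<and>
    (\<forall>x \<delta>. \<delta> > 0 \<longrightarrow> (\<forall>\<^sub>F n in sequentially. opnorm (m n) (\<phi> n x) < norm x + \<delta>)) \<and>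
    (\<forall>x \<delta>. \<delta> > 0 \<longrightarrow> (\<exists>\<^sub>F n in sequentially. norm x - \<delta> < opnorm (m n) (\<phi> n x)))"

lemma adj_one: "adj 1 = (1 :: 'a::cstar_algebra_1)"
  by (metis adj_adj adj_mult mult_1_right)

lemma positive_one: "positive (1 :: 'a::cstar_algebra_1)"
proof -
  have "z = 1" if z: "z \<in> spectrum (1 :: 'a)" for z
  proof (rule ccontr)
    assume "z \<noteq> 1"
    have e: "scaleC z 1 - 1 = scaleC (z - 1) (1 :: 'a)"
      using scaleC_add_left[of z "-1" "1 :: 'a"] by (simp add: scaleC_minus_one)
    have one: "scaleC 1 1 = (1 :: 'a)" using scaleC_of_real[of 1 "1 :: 'a"] by simp
    have "(scaleC z 1 - 1) * scaleC (1 / (z - 1)) 1 = (1 :: 'a)"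
      "scaleC (1 / (z - 1)) 1 * (scaleC z 1 - 1) = (1 :: 'a)"
      unfolding e using \<open>z \<noteq> 1\<close> by (simp_all add: mult_scaleC_left mult_scaleC_right scaleC_scaleC one)
    then show False using z unfolding spectrum_def by blast
  qed
  then have "\<forall>z\<in>spectrum (1 :: 'a). z \<in> \<real> \<and> Re z \<ge> 0"
    by (metis Reals_1 one_complex.simps(1) zero_le_one)
  then show ?thesis by (simp add: positive_def adj_one)
qed

lemma full_one: "full (1 :: 'a::cstar_algebra_1)"
proof -
  have "J = UNIV" if J: "closed_ideal J" "1 \<in> J" for J :: "'a set"
  proof -
    interpret ideal J univ_alg using J(1) by (simp add: closed_ideal_def)
    show ?thesis using one_imp_carrier J(2) by simp
  qed
  then show ?thesis unfolding full_def by blast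
qed

text \<open>
  The definition of tracially AI algebras is applied with the full positive element 1. The element
  whose norm the compression should preserve must be nonzero there, so 1 is taken instead of \<open>b\<close> in
  case \<open>b = 0\<close>; the estimate for \<open>b\<close> is then trivial.
\<close>

lemma TAI_approximation:
  fixes F :: "'a::cstar_algebra_1 set"
  assumes tai: "TAI TYPE('a)" and F: "finite F" and \<epsilon>: "\<epsilon> > 0"
  obtains p I where "p * p = p" "adj p = p" "cstar_subalgebra univ_alg I" "in_class_I (subalg I p)"
    "\<And>x. x \<in> F \<Longrightarrow> norm (x * p - p * x) < \<epsilon>" "\<And>x. x \<in> F \<Longrightarrow> \<exists>y\<in>I. norm (p * x * p - y) < \<epsilon>"
    "norm b - \<epsilon> \<le> norm (p * b * p)"
proof -
  define b' where "b' = (if b = 0 then 1 else b)"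
  have "b' \<noteq> 0" by (simp add: b'_def)
  have ex: "\<exists>p I. p \<in> projections univ_alg \<and> p \<noteq> 0 \<and>
      cstar_subalgebra univ_alg I \<and> is_unit_of univ_alg I p \<and> in_class_I (subalg I p) \<and>
      (\<forall>x\<in>insert b' F. norm (x * p - p * x) < \<epsilon>) \<and>
      (\<forall>x\<in>insert b' F. \<exists>y\<in>I. norm (p * x * p - y) < \<epsilon>) \<and>
      norm (p * b' * p) \<ge> norm b' - \<epsilon> \<and> mvn_multiple_le univ_alg 1 (1 - p) p \<and> mvn_le_pos (1 - p) 1"
    by (rule tai[unfolded TAI_def, rule_format]) (use F \<epsilon> \<open>b' \<noteq> 0\<close> positive_one full_one in auto)
  then obtain p I where p: "p \<in> projections univ_alg" and I: "cstar_subalgebra univ_alg I" "in_class_I (subalg I p)"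
    and comm: "\<forall>x\<in>insert b' F. norm (x * p - p * x) < \<epsilon>"
    and appr: "\<forall>x\<in>insert b' F. \<exists>y\<in>I. norm (p * x * p - y) < \<epsilon>"
    and b': "norm b' - \<epsilon> \<le> norm (p * b' * p)"
    by (elim exE conjE)
  show thesis
  proof (rule that[OF _ _ I])
    show "p * p = p" "adj p = p" using p by (simp_all add: projections_def)
    show "norm b - \<epsilon> \<le> norm (p * b * p)"
      using b' \<epsilon> by (cases "b = 0") (simp_all add: b'_def)
  qed (use comm appr in blast)+
qed

text \<open>
  A nearest point of \<open>I\<close> need not exist, hence the tolerance.
\<close>

lemma almost_nearest_point:
  assumes "I \<noteq> {}" "\<epsilon> > 0"
  obtains y where "y \<in> I" "\<And>z. z \<in> I \<Longrightarrow> norm (x - y) \<le> norm (x - z :: 'a::real_normed_vector) + \<epsilon>"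
proof -
  have "infdist x I < infdist x I + \<epsilon>" using assms by simp
  then obtain y where y: "y \<in> I" "dist x y < infdist x I + \<epsilon>"
    using assms(1) cInf_lessD[of "dist x ` I" "infdist x I + \<epsilon>"]
    unfolding infdist_notempty[OF assms(1)] by blast
  have "norm (x - y) \<le> norm (x - z) + \<epsilon>" if "z \<in> I" for z
    using y(2) infdist_le[OF that, of x] by (simp add: dist_norm)
  with y(1) show thesis by (rule that)
qed

text \<open>
  The function \<open>y\<close> is defined on the whole algebra and not only on \<open>F\<close>, although \<open>p x p\<close> may be far
  from \<open>I\<close> for \<open>x\<close> outside \<open>F\<close>. This makes the asymptotic statements below available for all elements at
  once, by approximation with elements of a dense sequence.
\<close>

lemma TAI_matrix_approximation:
  fixes F :: "'a::cstar_algebra_1 set"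
  assumes "TAI TYPE('a)" "finite F" and \<epsilon>: "\<epsilon> > 0"
  obtains p I y k f where "p * p = p" "adj p = p" "cstar_subalgebra univ_alg I"
    "\<And>x. x \<in> F \<Longrightarrow> norm (x * p - p * x) < \<epsilon>" "\<And>x. x \<in> F \<Longrightarrow> \<exists>z\<in>I. norm (p * x * p - z) < \<epsilon>"
    "norm b - \<epsilon> \<le> norm (p * b * p)"
    "\<And>x. y x \<in> I" "\<And>x z. z \<in> I \<Longrightarrow> norm (p * x * p - y x) \<le> norm (p * x * p - z) + \<epsilon>"
    "k \<ge> 1" "star_hom (subalg I p) (cmat_alg k) f"
    "\<And>x. x \<in> I \<Longrightarrow> opnorm k (f x) \<le> norm x" "norm (y b) - \<epsilon> < opnorm k (f (y b))"
proof -
  obtain p I where p: "p * p = p" "adj p = p" and I: "cstar_subalgebra univ_alg I" "in_class_I (subalg I p)"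
    and F: "\<And>x. x \<in> F \<Longrightarrow> norm (x * p - p * x) < \<epsilon>" "\<And>x. x \<in> F \<Longrightarrow> \<exists>y\<in>I. norm (p * x * p - y) < \<epsilon>"
    and b: "norm b - \<epsilon> \<le> norm (p * b * p)"
    using TAI_approximation[OF assms, of b] by metis
  have "I \<noteq> {}" using I(1) by (auto simp: cstar_subalgebra_univ_alg)
  have "\<forall>x. \<exists>y. y \<in> I \<and> (\<forall>z\<in>I. norm (p * x * p - y) \<le> norm (p * x * p - z) + \<epsilon>)"
  proof
    fix x
    obtain y where "y \<in> I" "\<And>z. z \<in> I \<Longrightarrow> norm (p * x * p - y) \<le> norm (p * x * p - z) + \<epsilon>"
      by (rule almost_nearest_point[OF \<open>I \<noteq> {}\<close> \<epsilon>, of "p * x * p"]) (rule that)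
    then show "\<exists>y. y \<in> I \<and> (\<forall>z\<in>I. norm (p * x * p - y) \<le> norm (p * x * p - z) + \<epsilon>)"
      by blast
  qed
  then obtain y where "\<forall>x. y x \<in> I \<and> (\<forall>z\<in>I. norm (p * x * p - y x) \<le> norm (p * x * p - z) + \<epsilon>)"
    unfolding choice_iff by blast
  then have y: "\<And>x. y x \<in> I" "\<And>x z. z \<in> I \<Longrightarrow> norm (p * x * p - y x) \<le> norm (p * x * p - z) + \<epsilon>"
    by blast+
  obtain k f where "k \<ge> 1" "star_hom (subalg I p) (cmat_alg k) f"
    "\<And>x. x \<in> I \<Longrightarrow> opnorm k (f x) \<le> norm x" "norm (y b) - \<epsilon> < opnorm k (f (y b))"
    using class_I_matrix_representation[OF I y(1)[of b] \<epsilon>] by blast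
  from that[OF p I(1) F b y this] show thesis .
qed

lemma opnorm_hom_diff:
  fixes I :: "'a::cstar_algebra_1 set"
  assumes I: "cstar_subalgebra univ_alg I" and hom: "star_hom (subalg I p) (cmat_alg k) f"
    and contr: "\<And>x. x \<in> I \<Longrightarrow> opnorm k (f x) \<le> norm x" and u: "u \<in> I" and v: "v \<in> I"
  shows "opnorm k (\<lambda>i j. f u i j - f v i j) \<le> norm (u - v)"
proof -
  have mv: "scaleC (-1) v \<in> I" using I v by (simp add: cstar_subalgebra_univ_alg)
  have "f (u + scaleC (-1) v) = (\<lambda>i j. f u i j + f (scaleC (-1) v) i j)"
    using hom u mv unfolding star_hom_subalg_matrix by blast
  moreover have "f (scaleC (-1) v) = (\<lambda>i j. (-1) * f v i j)"
    using hom v unfolding star_hom_subalg_matrix by blast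
  moreover have "u + scaleC (-1) v \<in> I" using I u mv unfolding cstar_subalgebra_univ_alg by blast
  ultimately show ?thesis using contr[of "u + scaleC (-1) v"] by (simp add: scaleC_minus_one)
qed

lemma norm_compress_le:
  fixes p :: "'a::cstar_algebra_1"
  assumes "norm p \<le> 1" shows "norm (p * x * p) \<le> norm x"
proof -
  have "norm (p * x * p) \<le> norm p * norm x * norm p"
    by (meson norm_mult_ineq order_trans mult_right_mono norm_ge_zero)
  also have "\<dots> \<le> 1 * norm x * 1" using assms by (intro mult_mono) auto
  finally show ?thesis by simp
qed

text \<open>
  This passes from estimates on the finite sets \<open>{e 0, \<dots>, e n}\<close> to all elements: a quantity that depends on \<open>x\<close> in
  a Lipschitz way and is small at \<open>e j\<close> for \<open>n \<ge> j\<close> tends to zero at every \<open>x\<close>.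
\<close>

lemma tendsto_zero_if_dense_bound:
  fixes e :: "nat \<Rightarrow> 'a::real_normed_vector" and a \<epsilon> :: "nat \<Rightarrow> real"
  assumes dense: "\<And>\<delta>. \<delta> > 0 \<Longrightarrow> \<exists>j. norm (x - e j) < \<delta>"
    and \<epsilon>: "\<epsilon> \<longlonglongrightarrow> 0" and nonneg: "\<And>n. 0 \<le> a n"
    and bound: "\<And>j n. j \<le> n \<Longrightarrow> a n \<le> 2 * norm (x - e j) + 2 * \<epsilon> n"
  shows "a \<longlonglongrightarrow> 0"
proof (rule tendstoI)
  fix \<delta> :: real assume \<delta>: "\<delta> > 0"
  obtain j where j: "norm (x - e j) < \<delta> / 4" using dense[of "\<delta> / 4"] \<delta> by auto
  have "\<forall>\<^sub>F n in sequentially. \<epsilon> n < \<delta> / 4" using order_tendstoD(2)[OF \<epsilon>, of "\<delta> / 4"] \<delta> by simp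
  then show "\<forall>\<^sub>F n in sequentially. dist (a n) 0 < \<delta>"
    using eventually_ge_at_top[of j]
  proof eventually_elim
    case (elim n)
    then show ?case using bound[of j n] nonneg[of n] j by simp
  qed
qed

text \<open>
  The data of \<open>TAI_matrix_approximation\<close> for the finite sets \<open>{e 0, \<dots>, e n}\<close> and tolerances \<open>\<epsilon> n\<close>, where the
  element \<open>b\<close> of step \<open>n\<close> is the term of \<open>e\<close> with index \<open>fst (prod_decode n)\<close>; every index occurs
  infinitely often in this way.
\<close>

locale tracial_approximation =
  fixes e :: "nat \<Rightarrow> 'a::cstar_algebra_1" and \<epsilon> :: "nat \<Rightarrow> real"
    and p :: "nat \<Rightarrow> 'a" and I :: "nat \<Rightarrow> 'a set" and y :: "nat \<Rightarrow> 'a \<Rightarrow> 'a"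
    and m :: "nat \<Rightarrow> nat" and f :: "nat \<Rightarrow> 'a \<Rightarrow> nat \<Rightarrow> nat \<Rightarrow> complex"
  assumes dense: "\<And>x \<delta>. \<delta> > 0 \<Longrightarrow> \<exists>j. norm (x - e j) < \<delta>"
    and \<epsilon>_lim: "\<epsilon> \<longlonglongrightarrow> 0" and \<epsilon>_pos: "\<And>n. 0 < \<epsilon> n"
    and projection: "\<And>n. p n * p n = p n" "\<And>n. adj (p n) = p n"
    and subalgebra: "\<And>n. cstar_subalgebra univ_alg (I n)"
    and commute: "\<And>n j. j \<le> n \<Longrightarrow> norm (e j * p n - p n * e j) < \<epsilon> n"
    and approx: "\<And>n j. j \<le> n \<Longrightarrow> \<exists>z\<in>I n. norm (p n * e j * p n - z) < \<epsilon> n"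
    and large: "\<And>n. norm (e (fst (prod_decode n))) - \<epsilon> n \<le> norm (p n * e (fst (prod_decode n)) * p n)"
    and y_in: "\<And>n x. y n x \<in> I n"
    and y_near: "\<And>n x z. z \<in> I n \<Longrightarrow> norm (p n * x * p n - y n x) \<le> norm (p n * x * p n - z) + \<epsilon> n"
    and hom: "\<And>n. star_hom (subalg (I n) (p n)) (cmat_alg (m n)) (f n)"
    and contractive: "\<And>n x. x \<in> I n \<Longrightarrow> opnorm (m n) (f n x) \<le> norm x"
    and norming: "\<And>n. norm (y n (e (fst (prod_decode n)))) - \<epsilon> n
        < opnorm (m n) (f n (y n (e (fst (prod_decode n)))))"
begin

definition err :: "'a \<Rightarrow> nat \<Rightarrow> real" where "err x n = norm (p n * x * p n - y n x)"

lemma norm_p: "norm (p n) \<le> 1"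
  using projection by (rule norm_projection_le_1)

lemma err_nonneg: "0 \<le> err x n" by (simp add: err_def)

text \<open>
  By density, \<open>x\<close> is close to some \<open>e j\<close>, whose compression is close to \<open>I n\<close> for \<open>n \<ge> j\<close>; as \<open>y n x\<close> is an almost
  nearest point, it is, up to the tolerance, at least as close to the compression of \<open>x\<close>.
\<close>

lemma err_tendsto: "err x \<longlonglongrightarrow> 0"
proof (rule tendsto_zero_if_dense_bound[OF dense \<epsilon>_lim err_nonneg])
  fix j n :: nat assume "j \<le> n"
  then obtain z where z: "z \<in> I n" "norm (p n * e j * p n - z) < \<epsilon> n" using approx by blast
  have eq: "p n * x * p n - z = p n * (x - e j) * p n + (p n * e j * p n - z)"
    by (simp add: algebra_simps)
  have "err x n \<le> norm (p n * x * p n - z) + \<epsilon> n" unfolding err_def by (rule y_near[OF z(1)])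
  also have "\<dots> \<le> norm (x - e j) + \<epsilon> n + \<epsilon> n"
    unfolding eq using norm_triangle_ineq[of "p n * (x - e j) * p n" "p n * e j * p n - z"]
      norm_compress_le[OF norm_p, of n "x - e j"] z(2) by linarith
  also have "\<dots> \<le> 2 * norm (x - e j) + 2 * \<epsilon> n" by simp
  finally show "err x n \<le> 2 * norm (x - e j) + 2 * \<epsilon> n" .
qed (simp)

lemma commutator_tendsto: "(\<lambda>n. norm (x * p n - p n * x)) \<longlonglongrightarrow> 0"
proof (rule tendsto_zero_if_dense_bound[OF dense \<epsilon>_lim norm_ge_zero])
  fix j n :: nat assume jn: "j \<le> n"
  define w where "w = x - e j"
  have eq: "x * p n - p n * x = (w * p n - p n * w) + (e j * p n - p n * e j)"
    by (simp add: w_def algebra_simps)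
  have "norm (w * p n) \<le> norm w" "norm (p n * w) \<le> norm w"
    using norm_mult_ineq[of w "p n"] norm_mult_ineq[of "p n" w] norm_p[of n]
      mult_left_le[of "norm (p n)" "norm w"] mult_left_le_one_le[of "norm w" "norm (p n)"] by simp_all
  then have "norm (w * p n - p n * w) \<le> 2 * norm w"
    using norm_triangle_ineq4[of "w * p n" "p n * w"] by simp
  then have "norm (x * p n - p n * x) \<le> 2 * norm w + \<epsilon> n"
    unfolding eq using norm_triangle_ineq[of "w * p n - p n * w" "e j * p n - p n * e j"] commute[OF jn]
    by linarith
  then show "norm (x * p n - p n * x) \<le> 2 * norm (x - e j) + 2 * \<epsilon> n"
    using \<epsilon>_pos[of n] by (simp add: w_def)
qed simp

lemma norm_y_le: "norm (y n x) \<le> norm x + err x n"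
  using norm_triangle_ineq3[of "y n x" "p n * x * p n"] norm_compress_le[OF norm_p, of n x]
  unfolding err_def by (simp add: norm_minus_commute)

lemma y_asymptotically_additive: "(\<lambda>n. norm (y n (u + v) - (y n u + y n v))) \<longlonglongrightarrow> 0"
proof (rule tendsto_sandwich[OF _ _ tendsto_const])
  have "norm (y n (u + v) - (y n u + y n v)) \<le> err (u + v) n + err u n + err v n" for n
  proof -
    have eq: "y n (u + v) - (y n u + y n v) = (p n * u * p n - y n u) + (p n * v * p n - y n v)
        - (p n * (u + v) * p n - y n (u + v))" by (simp add: algebra_simps)
    show ?thesis
      unfolding err_def eq
      using norm_triangle_ineq4[of "(p n * u * p n - y n u) + (p n * v * p n - y n v)" "p n * (u + v) * p n - y n (u + v)"]
        norm_triangle_ineq[of "p n * u * p n - y n u" "p n * v * p n - y n v"] by linarith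
  qed
  then show "\<forall>\<^sub>F n in sequentially. norm (y n (u + v) - (y n u + y n v)) \<le> err (u + v) n + err u n + err v n"
    by simp
  show "(\<lambda>n. err (u + v) n + err u n + err v n) \<longlonglongrightarrow> 0"
    using tendsto_add[OF tendsto_add[OF err_tendsto[of "u + v"] err_tendsto[of u]] err_tendsto[of v]] by simp
qed simp

lemma y_asymptotically_homogeneous: "(\<lambda>n. norm (y n (scaleC c u) - scaleC c (y n u))) \<longlonglongrightarrow> 0"
proof (rule tendsto_sandwich[OF _ _ tendsto_const])
  have "norm (y n (scaleC c u) - scaleC c (y n u)) \<le> cmod c * err u n + err (scaleC c u) n" for n
  proof -
    have "scaleC c (p n * u * p n - y n u) = scaleC c (p n * u * p n) - scaleC c (y n u)"
      using scaleC_add_right[of c "p n * u * p n - y n u" "y n u"] by (simp add: algebra_simps)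
    then have "y n (scaleC c u) - scaleC c (y n u) = scaleC c (p n * u * p n - y n u)
        - (p n * scaleC c u * p n - y n (scaleC c u))"
      by (simp add: mult_scaleC_left mult_scaleC_right)
    then show ?thesis
      unfolding err_def norm_scaleC[symmetric] by (simp only: norm_triangle_ineq4)
  qed
  then show "\<forall>\<^sub>F n in sequentially. norm (y n (scaleC c u) - scaleC c (y n u)) \<le> cmod c * err u n + err (scaleC c u) n"
    by simp
  show "(\<lambda>n. cmod c * err u n + err (scaleC c u) n) \<longlonglongrightarrow> 0"
    using tendsto_add[OF tendsto_mult_left[OF err_tendsto[of u], of "cmod c"] err_tendsto[of "scaleC c u"]] by simp
qed simp

lemma y_asymptotically_adj: "(\<lambda>n. norm (y n (adj u) - adj (y n u))) \<longlonglongrightarrow> 0"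
proof (rule tendsto_sandwich[OF _ _ tendsto_const])
  have "norm (y n (adj u) - adj (y n u)) \<le> err u n + err (adj u) n" for n
  proof -
    have "adj (p n * u * p n - y n u) = p n * adj u * p n - adj (y n u)"
      by (simp add: adj_diff adj_mult projection mult.assoc)
    then have "y n (adj u) - adj (y n u) = adj (p n * u * p n - y n u)
        - (p n * adj u * p n - y n (adj u))" by simp
    then show ?thesis
      unfolding err_def norm_adj[of "p n * u * p n - y n u", symmetric] by (simp only: norm_triangle_ineq4)
  qed
  then show "\<forall>\<^sub>F n in sequentially. norm (y n (adj u) - adj (y n u)) \<le> err u n + err (adj u) n"
    by simp
  show "(\<lambda>n. err u n + err (adj u) n) \<longlonglongrightarrow> 0"
    using tendsto_add[OF err_tendsto[of u] err_tendsto[of "adj u"]] by simp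
qed simp

text \<open>
  With \<open>q = p n\<close>, the identity \<open>q u q v q - q u v q = q (u q - q u) v q\<close> shows that compression by \<open>q\<close> is
  multiplicative up to the commutator of \<open>q\<close> and \<open>u\<close>.
\<close>

lemma y_asymptotically_multiplicative: "(\<lambda>n. norm (y n (u * v) - y n u * y n v)) \<longlonglongrightarrow> 0"
proof (rule tendsto_sandwich[OF _ _ tendsto_const])
  have "norm (y n (u * v) - y n u * y n v) \<le> err (u * v) n + norm (u * p n - p n * u) * norm v
      + err u n * norm v + (norm u + err u n) * err v n" for n
  proof -
    let ?q = "p n" and ?U = "p n * u * p n" and ?V = "p n * v * p n"
    have qq: "?q * (?q * x) = ?q * x" for x by (simp add: projection mult.assoc[symmetric])
    have cut: "?U * ?V - ?q * (u * v) * ?q = ?q * ((u * ?q - ?q * u) * v) * ?q"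
      by (simp add: algebra_simps qq)
    have eq: "y n u * y n v - y n (u * v) = (?q * (u * v) * ?q - y n (u * v))
        + ?q * ((u * ?q - ?q * u) * v) * ?q - (?U - y n u) * ?V - y n u * (?V - y n v)"
      unfolding cut[symmetric] by (simp add: algebra_simps)
    have n1: "norm (?q * ((u * ?q - ?q * u) * v) * ?q) \<le> norm (u * ?q - ?q * u) * norm v"
      by (rule order_trans[OF norm_compress_le[OF norm_p] norm_mult_ineq])
    have n2: "norm ((?U - y n u) * ?V) \<le> err u n * norm v"
      unfolding err_def
      by (rule order_trans[OF norm_mult_ineq]) (intro mult_left_mono norm_compress_le norm_p norm_ge_zero)
    have n3: "norm (y n u * (?V - y n v)) \<le> (norm u + err u n) * err v n"
      unfolding err_def[of v]
      by (rule order_trans[OF norm_mult_ineq]) (intro mult_right_mono norm_y_le norm_ge_zero)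
    have tri: "norm (a + b - c - d) \<le> norm a + norm b + norm c + norm d" for a b c d :: 'a
      using norm_triangle_ineq4[of "a + b - c" d] norm_triangle_ineq4[of "a + b" c] norm_triangle_ineq[of a b]
      by linarith
    have "norm (y n u * y n v - y n (u * v)) \<le> err (u * v) n + norm (u * p n - p n * u) * norm v
      + err u n * norm v + (norm u + err u n) * err v n"
      unfolding eq by (rule order_trans[OF tri]) (use n1 n2 n3 in \<open>unfold err_def[of "u * v"], linarith\<close>)
    then show ?thesis by (simp only: norm_minus_commute)
  qed
  then show "\<forall>\<^sub>F n in sequentially. norm (y n (u * v) - y n u * y n v) \<le> err (u * v) n
      + norm (u * p n - p n * u) * norm v + err u n * norm v + (norm u + err u n) * err v n"
    by simp
  have "(\<lambda>n. err (u * v) n + norm (u * p n - p n * u) * norm v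
      + err u n * norm v + (norm u + err u n) * err v n) \<longlonglongrightarrow> 0 + 0 * norm v + 0 * norm v + (norm u + 0) * 0"
    by (intro tendsto_intros err_tendsto commutator_tendsto)
  then show "(\<lambda>n. err (u * v) n + norm (u * p n - p n * u) * norm v
      + err u n * norm v + (norm u + err u n) * err v n) \<longlonglongrightarrow> 0" by simp
qed simp

lemma f_diff_tendsto:
  assumes "(\<lambda>n. norm (u n - v n)) \<longlonglongrightarrow> 0" "\<And>n. u n \<in> I n" "\<And>n. v n \<in> I n"
  shows "(\<lambda>n. opnorm (m n) (\<lambda>i j. f n (u n) i j - f n (v n) i j)) \<longlonglongrightarrow> 0"
proof (rule tendsto_sandwich[OF _ _ tendsto_const assms(1)])
  show "\<forall>\<^sub>F n in sequentially. opnorm (m n) (\<lambda>i j. f n (u n) i j - f n (v n) i j) \<le> norm (u n - v n)"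
    using opnorm_hom_diff[OF subalgebra hom contractive assms(2,3)] by simp
qed simp

lemma opnorm_f_y_le: "opnorm (m n) (f n (y n x)) \<le> norm x + err x n"
  using contractive[OF y_in] norm_y_le by (rule order_trans)

text \<open>
  At the steps \<open>n\<close> that are assigned to \<open>e j\<close>, compression, passage to \<open>I n\<close> and evaluation all almost preserve the
  norm of \<open>e j\<close>, and \<open>x\<close> inherits this up to its distance from \<open>e j\<close>.
\<close>

lemma opnorm_f_y_ge:
  assumes "fst (prod_decode n) = j"
  shows "norm x - 2 * norm (x - e j) - 2 * \<epsilon> n - err x n - 2 * err (e j) n \<le> opnorm (m n) (f n (y n x))"
proof -
  have 1: "norm (y n (e j)) - \<epsilon> n \<le> opnorm (m n) (f n (y n (e j)))"
    using norming[of n] assms by simp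
  have 2: "norm (e j) - \<epsilon> n \<le> norm (y n (e j)) + err (e j) n"
    using large[of n] norm_triangle_ineq3[of "p n * e j * p n" "y n (e j)"] assms
    unfolding err_def by (simp add: abs_le_iff)
  have "opnorm (m n) (f n (y n (e j))) \<le> opnorm (m n) (\<lambda>i j'. f n (y n (e j)) i j' - f n (y n x) i j')
      + opnorm (m n) (f n (y n x))"
    using opnorm_add[of "m n" "\<lambda>i j'. f n (y n (e j)) i j' - f n (y n x) i j'" "f n (y n x)"] by simp
  also have "opnorm (m n) (\<lambda>i j'. f n (y n (e j)) i j' - f n (y n x) i j') \<le> norm (y n (e j) - y n x)"
    by (rule opnorm_hom_diff[OF subalgebra hom contractive y_in y_in])
  also have "norm (y n (e j) - y n x) \<le> err x n + err (e j) n + norm (x - e j)"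
  proof -
    have eq: "y n (e j) - y n x = (p n * x * p n - y n x) - (p n * e j * p n - y n (e j)) - p n * (x - e j) * p n"
      by (simp add: algebra_simps)
    show ?thesis
      unfolding err_def eq
      using norm_triangle_ineq4[of "(p n * x * p n - y n x) - (p n * e j * p n - y n (e j))" "p n * (x - e j) * p n"]
        norm_triangle_ineq4[of "p n * x * p n - y n x" "p n * e j * p n - y n (e j)"]
        norm_compress_le[OF norm_p, of n "x - e j"] by linarith
  qed
  finally show ?thesis
    using 1 2 norm_triangle_ineq2[of x "e j"] by linarith
qed

text \<open>
  Every defect of \<open>f n \<circ> y n\<close> is the image under the contractive *-homomorphism \<open>f n\<close> of the
  corresponding defect of \<open>y n\<close>.
\<close>

theorem asymptotic_embedding_f_y: "asymptotic_embedding m (\<lambda>n x. f n (y n x))"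
  unfolding asymptotic_embedding_def mat_dist_def
proof (intro conjI allI impI)
  note hom' = hom[unfolded star_hom_subalg_matrix]
  have closed: "u + v \<in> I n" "u * v \<in> I n" "scaleC c u \<in> I n" "adj u \<in> I n"
    if "u \<in> I n" "v \<in> I n" for u v c n
    using subalgebra[of n] that unfolding cstar_subalgebra_univ_alg by blast+
  fix x x' :: 'a and c :: complex
  show "f n (y n x) \<in> carrier (cmat_alg (m n))" for n
    using hom[of n] y_in unfolding star_hom_def by simp
  have "err x n \<le> norm x + \<epsilon> n" for n
    using y_near[of 0 n x] subalgebra[of n] norm_compress_le[OF norm_p, of n x]
    unfolding err_def cstar_subalgebra_univ_alg by force
  then have "opnorm (m n) (f n (y n x)) \<le> norm x + (norm x + \<epsilon> n)" for n
    using order_trans[OF opnorm_f_y_le[of n x] add_left_mono] by blast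
  moreover obtain K where "\<And>n. \<bar>\<epsilon> n\<bar> \<le> K"
    using convergent_imp_Bseq[OF convergentI[OF \<epsilon>_lim]] unfolding Bseq_def by auto
  ultimately show "\<exists>B. \<forall>n. opnorm (m n) (f n (y n x)) \<le> B"
    by (intro exI[of _ "norm x + (norm x + K)"]) (meson abs_le_D1 add_left_mono order_trans)
  have "f n (y n x + y n x') = (\<lambda>i j. f n (y n x) i j + f n (y n x') i j)" for n
    using hom'[of n] y_in by blast
  then show "(\<lambda>n. opnorm (m n) (\<lambda>i j. f n (y n (x + x')) i j - (f n (y n x) i j + f n (y n x') i j))) \<longlonglongrightarrow> 0"
    using f_diff_tendsto[OF y_asymptotically_additive[of x x'] y_in closed(1)[OF y_in y_in]] by simp
  have "f n (y n x * y n x') = mmul (m n) (f n (y n x)) (f n (y n x'))" for n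
    using hom'[of n] y_in by blast
  then show "(\<lambda>n. opnorm (m n) (\<lambda>i j. f n (y n (x * x')) i j - mmul (m n) (f n (y n x)) (f n (y n x')) i j)) \<longlonglongrightarrow> 0"
    using f_diff_tendsto[OF y_asymptotically_multiplicative[of x x'] y_in closed(2)[OF y_in y_in]] by simp
  have "f n (scaleC c (y n x)) = (\<lambda>i j. c * f n (y n x) i j)" for n
    using hom'[of n] y_in by blast
  then show "(\<lambda>n. opnorm (m n) (\<lambda>i j. f n (y n (scaleC c x)) i j - c * f n (y n x) i j)) \<longlonglongrightarrow> 0"
    using f_diff_tendsto[OF y_asymptotically_homogeneous[of c x] y_in closed(3)[OF y_in y_in]] by simp
  have "f n (adj (y n x)) = madj (f n (y n x))" for n
    using hom'[of n] y_in by blast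
  then show "(\<lambda>n. opnorm (m n) (\<lambda>i j. f n (y n (adj x)) i j - madj (f n (y n x)) i j)) \<longlonglongrightarrow> 0"
    using f_diff_tendsto[OF y_asymptotically_adj[of x] y_in closed(4)[OF y_in y_in]] by simp
  fix \<delta> :: real assume \<delta>: "\<delta> > 0"
  have "\<forall>\<^sub>F n in sequentially. err x n < \<delta>"
    using order_tendstoD(2)[OF err_tendsto \<delta>] .
  then show "\<forall>\<^sub>F n in sequentially. opnorm (m n) (f n (y n x)) < norm x + \<delta>"
    by eventually_elim (use opnorm_f_y_le[of _ x] in \<open>smt (verit)\<close>)
  obtain j where j: "norm (x - e j) < \<delta> / 4" using dense[of "\<delta> / 4" x] \<delta> by auto
  have "(\<lambda>n. 2 * \<epsilon> n + err x n + 2 * err (e j) n) \<longlonglongrightarrow> 2 * 0 + 0 + 2 * 0"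
    by (intro tendsto_intros \<epsilon>_lim err_tendsto)
  then have lim0: "(\<lambda>n. 2 * \<epsilon> n + err x n + 2 * err (e j) n) \<longlonglongrightarrow> 0" by simp
  have ev: "\<forall>\<^sub>F n in sequentially. 2 * \<epsilon> n + err x n + 2 * err (e j) n < \<delta> / 2"
    by (rule order_tendstoD(2)[OF lim0]) (use \<delta> in simp)
  have "\<exists>\<^sub>F n in sequentially. fst (prod_decode n) = j"
    unfolding frequently_sequentially
  proof
    fix N show "\<exists>n\<ge>N. fst (prod_decode n) = j"
      by (rule exI[of _ "prod_encode (j, N)"]) (simp add: le_prod_encode_2)
  qed
  from frequently_eventually_conj[OF this ev]
  show "\<exists>\<^sub>F n in sequentially. norm x - \<delta> < opnorm (m n) (f n (y n x))"
  proof (rule frequently_elim1)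
    fix n assume "2 * \<epsilon> n + err x n + 2 * err (e j) n < \<delta> / 2 \<and> fst (prod_decode n) = j"
    then show "norm x - \<delta> < opnorm (m n) (f n (y n x))"
      using opnorm_f_y_ge[of n j x] j by linarith
  qed
qed

end

lemma separable_dense_sequence:
  assumes "separable_cstar TYPE('a::cstar_algebra_1)"
  obtains e :: "nat \<Rightarrow> 'a::cstar_algebra_1" where "\<And>x \<delta>. \<delta> > 0 \<Longrightarrow> \<exists>j. norm (x - e j) < \<delta>"
proof -
  obtain D :: "'a set" where D: "countable D" "closure D = UNIV"
    using assms unfolding separable_cstar_def separable_space_def by auto
  then have ne: "D \<noteq> {}" by auto
  have "\<exists>j. norm (x - from_nat_into D j) < \<delta>" if \<delta>: "\<delta> > 0" for x \<delta>
  proof -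
    have "x \<in> closure D" using D by simp
    then obtain d where d: "d \<in> D" "dist d x < \<delta>" using \<delta> unfolding closure_approachable by blast
    obtain j where "from_nat_into D j = d"
      using from_nat_into_surj[OF D(1) d(1)] by blast
    then show ?thesis using d(2) by (auto simp: dist_norm norm_minus_commute)
  qed
  then show thesis by (rule that)
qed

theorem TAI_asymptotic_embedding:
  assumes sep: "separable_cstar TYPE('a::cstar_algebra_1)" and tai: "TAI TYPE('a::cstar_algebra_1)"
  obtains m and \<phi> :: "nat \<Rightarrow> 'a::cstar_algebra_1 \<Rightarrow> nat \<Rightarrow> nat \<Rightarrow> complex"
  where "\<And>n. m n > 0" "asymptotic_embedding m \<phi>"
proof -
  obtain e :: "nat \<Rightarrow> 'a" where dense: "\<And>x \<delta>. \<delta> > 0 \<Longrightarrow> \<exists>j. norm (x - e j) < \<delta>"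
    using separable_dense_sequence[OF sep] by blast
  define \<epsilon> where "\<epsilon> n = inverse (real (Suc n))" for n
  have pos: "\<epsilon> n > 0" for n by (simp add: \<epsilon>_def)
  have lim: "\<epsilon> \<longlonglongrightarrow> 0" unfolding \<epsilon>_def by (rule LIMSEQ_inverse_real_of_nat)
  define good where "good n p I y k f \<longleftrightarrow> p * p = p \<and> adj p = p \<and> cstar_subalgebra univ_alg I \<and>
    (\<forall>x\<in>e ` {..n}. norm (x * p - p * x) < \<epsilon> n) \<and> (\<forall>x\<in>e ` {..n}. \<exists>z\<in>I. norm (p * x * p - z) < \<epsilon> n) \<and>
    norm (e (fst (prod_decode n))) - \<epsilon> n \<le> norm (p * e (fst (prod_decode n)) * p) \<and>
    (\<forall>x. y x \<in> I) \<and> (\<forall>x. \<forall>z\<in>I. norm (p * x * p - y x) \<le> norm (p * x * p - z) + \<epsilon> n) \<and>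
    k \<ge> 1 \<and> star_hom (subalg I p) (cmat_alg k) f \<and> (\<forall>x\<in>I. opnorm k (f x) \<le> norm x) \<and>
    norm (y (e (fst (prod_decode n)))) - \<epsilon> n < opnorm k (f (y (e (fst (prod_decode n)))))"
    for n p I and y :: "'a \<Rightarrow> 'a" and k f
  have "\<exists>p I y k f. good n p I y k f" for n
    by (rule TAI_matrix_approximation[OF tai finite_imageI[OF finite_atMost] pos, of e n n "e (fst (prod_decode n))"])
      (unfold good_def, blast)
  then have "\<forall>n. \<exists>p I y k f. good n p I y k f" by blast
  then obtain p I y k f where "\<forall>n. good n (p n) (I n) (y n) (k n) (f n)"
    unfolding choice_iff by blast
  note good = this[unfolded good_def, rule_format]
  have "tracial_approximation e \<epsilon> p I y k f"
    by unfold_locales (use good dense lim pos in auto)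
  from tracial_approximation.asymptotic_embedding_f_y[OF this]
  have "asymptotic_embedding k (\<lambda>n x. f n (y n x))" .
  moreover have "k n > 0" for n using good[of n] by simp
  ultimately show thesis using that by blast
qed

section \<open>From asymptotic embeddings to the MF property\<close>

lemma mat_prod_alg_simps [simp]:
  "x \<otimes>\<^bsub>mat_prod_alg m\<^esub> y = (\<lambda>n. mmul (m n) (x n) (y n))"
  "\<one>\<^bsub>mat_prod_alg m\<^esub> = (\<lambda>n i j. if i = j \<and> i < m n then 1 else 0)"
  "\<zero>\<^bsub>mat_prod_alg m\<^esub> = (\<lambda>n i j. 0)"
  "x \<oplus>\<^bsub>mat_prod_alg m\<^esub> y = (\<lambda>n i j. x n i j + y n i j)"
  "c \<odot>\<^bsub>mat_prod_alg m\<^esub> x = (\<lambda>n i j. c * x n i j)"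
  "star (mat_prod_alg m) x = (\<lambda>n. madj (x n))"
  "nrm (mat_prod_alg m) x = (SUP n. opnorm (m n) (x n))"
  unfolding mat_prod_alg_def by (simp_all only: cmat_alg_simps partial_object.simps monoid.simps
      ring.simps module.simps star_alg.simps normed_star_alg.simps)

lemma mat_prod_alg_carrier:
  "x \<in> carrier (mat_prod_alg m) \<longleftrightarrow>
    (\<forall>n i j. \<not> (i < m n \<and> j < m n) \<longrightarrow> x n i j = 0) \<and> (\<exists>B. \<forall>n. opnorm (m n) (x n) \<le> B)"
proof -
  have "bounded (range (\<lambda>n. opnorm (m n) (x n))) \<longleftrightarrow> (\<exists>B. \<forall>n. opnorm (m n) (x n) \<le> B)"
    by (simp add: bounded_iff)
  then show ?thesis by (simp add: mat_prod_alg_def)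
qed

lemma mat_prod_algI:
  assumes "\<And>n i j. \<not> (i < m n \<and> j < m n) \<Longrightarrow> x n i j = 0" "\<And>n. opnorm (m n) (x n) \<le> B"
  shows "x \<in> carrier (mat_prod_alg m)"
  unfolding mat_prod_alg_carrier using assms by blast

lemma mat_prod_alg_bound:
  assumes "x \<in> carrier (mat_prod_alg m)"
  obtains B where "B \<ge> 0" "\<And>n. opnorm (m n) (x n) \<le> B"
  using assms order_trans[OF opnorm_nonneg] unfolding mat_prod_alg_carrier by blast

lemma mat_prod_alg_supp:
  "x \<in> carrier (mat_prod_alg m) \<Longrightarrow> \<not> (i < m n \<and> j < m n) \<Longrightarrow> x n i j = 0"
  unfolding mat_prod_alg_carrier by blast

lemma mat_prod_alg_closed:
  assumes x: "x \<in> carrier (mat_prod_alg m)"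
  shows "y \<in> carrier (mat_prod_alg m) \<Longrightarrow> (\<lambda>n i j. x n i j + y n i j) \<in> carrier (mat_prod_alg m)"
    and "y \<in> carrier (mat_prod_alg m) \<Longrightarrow> (\<lambda>n. mmul (m n) (x n) (y n)) \<in> carrier (mat_prod_alg m)"
    and "(\<lambda>n i j. c * x n i j) \<in> carrier (mat_prod_alg m)"
    and "(\<lambda>n. madj (x n)) \<in> carrier (mat_prod_alg m)"
    and "y \<in> carrier (mat_prod_alg m) \<Longrightarrow> (\<lambda>n i j. x n i j - y n i j) \<in> carrier (mat_prod_alg m)"
    and "(\<lambda>n i j. - x n i j) \<in> carrier (mat_prod_alg m)"
proof -
  note sx = mat_prod_alg_supp[OF x]
  obtain B where B: "B \<ge> 0" "\<And>n. opnorm (m n) (x n) \<le> B" using mat_prod_alg_bound[OF x] by blast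
  have scale: "(\<lambda>n i j. c * x n i j) \<in> carrier (mat_prod_alg m)" if "x \<in> carrier (mat_prod_alg m)" for c x
  proof (rule mat_prod_alg_bound[OF that], rule mat_prod_algI)
    fix B n assume "\<And>n. opnorm (m n) (x n) \<le> B"
    then show "opnorm (m n) (\<lambda>i j. c * x n i j) \<le> cmod c * B"
      by (intro order_trans[OF opnorm_scale_le] mult_left_mono) auto
  qed (use mat_prod_alg_supp[OF that] in simp)
  have add: "(\<lambda>n i j. x n i j + y n i j) \<in> carrier (mat_prod_alg m)" if y: "y \<in> carrier (mat_prod_alg m)" for y
  proof (rule mat_prod_alg_bound[OF y], rule mat_prod_algI)
    fix C n assume "\<And>n. opnorm (m n) (y n) \<le> C"
    then show "opnorm (m n) (\<lambda>i j. x n i j + y n i j) \<le> B + C"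
      by (intro order_trans[OF opnorm_add] add_mono B)
  qed (use mat_prod_alg_supp[OF y] sx in simp)
  show "(\<lambda>n i j. c * x n i j) \<in> carrier (mat_prod_alg m)" by (rule scale[OF x])
  show "(\<lambda>n i j. - x n i j) \<in> carrier (mat_prod_alg m)" using scale[OF x, of "-1"] by simp
  show "(\<lambda>n. madj (x n)) \<in> carrier (mat_prod_alg m)"
  proof (rule mat_prod_algI)
    show "opnorm (m n) (madj (x n)) \<le> B" for n by (simp add: B(2))
    fix n i j assume "\<not> (i < m n \<and> j < m n)"
    then show "madj (x n) i j = 0" using sx[of j n i] by (simp add: madj_def conj_commute)
  qed
  assume y: "y \<in> carrier (mat_prod_alg m)"
  show "(\<lambda>n i j. x n i j + y n i j) \<in> carrier (mat_prod_alg m)" by (rule add[OF y])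
  show "(\<lambda>n i j. x n i j - y n i j) \<in> carrier (mat_prod_alg m)"
    using add[OF scale[OF y, of "-1"]] by simp
  show "(\<lambda>n. mmul (m n) (x n) (y n)) \<in> carrier (mat_prod_alg m)"
  proof (rule mat_prod_alg_bound[OF y], rule mat_prod_algI)
    fix C n assume "\<And>n. opnorm (m n) (y n) \<le> C"
    then show "opnorm (m n) (mmul (m n) (x n) (y n)) \<le> B * C"
      by (intro order_trans[OF opnorm_mult] mult_mono B) auto
  next
    fix n i j assume "\<not> (i < m n \<and> j < m n)"
    then have "x n i l * y n l j = 0" for l
      using sx[of i n l] mat_prod_alg_supp[OF y, of l n j] by auto
    then show "mmul (m n) (x n) (y n) i j = 0" unfolding mmul_def by (simp only: sum.neutral_const)
  qed
qed

lemma mat_prod_alg_zero_one: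
  "(\<lambda>n i j. 0) \<in> carrier (mat_prod_alg m)"
  "(\<lambda>n i j. if i = j \<and> i < m n then 1 else 0) \<in> carrier (mat_prod_alg m)"
proof -
  show "(\<lambda>n i j. 0) \<in> carrier (mat_prod_alg m)"
    by (rule mat_prod_algI[where B = 0]) simp_all
  show "(\<lambda>n i j. if i = j \<and> i < m n then 1 else 0) \<in> carrier (mat_prod_alg m)"
  proof (rule mat_prod_algI)
    fix n
    show "opnorm (m n) (\<lambda>i j. if i = j \<and> i < m n then 1 else 0) \<le> 1"
    proof (rule opnorm_least)
      fix v assume v: "vnorm (m n) v \<le> 1"
      have "mvec (m n) (\<lambda>i j. if i = j \<and> i < m n then 1 else 0) v i = v i" if "i < m n" for i
      proof -
        have "(\<Sum>j<m n. (if i = j \<and> i < m n then 1 else 0) * v j) = (\<Sum>j<m n. if j = i then v j else 0)"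
          by (rule sum.cong) (use that in auto)
        then show ?thesis using that by (simp add: mvec_def)
      qed
      then show "vnorm (m n) (mvec (m n) (\<lambda>i j. if i = j \<and> i < m n then 1 else 0) v) \<le> 1"
        using v vnorm_cong[of "m n" "mvec (m n) (\<lambda>i j. if i = j \<and> i < m n then 1 else 0) v" v] by simp
    qed
  qed auto
qed

text \<open>
  The ring axioms are needed to compute with cosets of the ideal of null sequences.
\<close>

lemma mat_prod_alg_ring: "ring (mat_prod_alg m)"
proof (rule ringI)
  show "abelian_group (mat_prod_alg m)"
  proof (rule abelian_groupI)
    fix x assume "x \<in> carrier (mat_prod_alg m)"
    then show "\<exists>y\<in>carrier (mat_prod_alg m). y \<oplus>\<^bsub>mat_prod_alg m\<^esub> x = \<zero>\<^bsub>mat_prod_alg m\<^esub>"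
      by (intro bexI[OF _ mat_prod_alg_closed(6)]) (simp_all add: fun_eq_iff)
  qed (simp_all add: mat_prod_alg_closed mat_prod_alg_zero_one add_ac)
  show "Group.monoid (mat_prod_alg m)"
  proof (rule monoidI)
    fix x assume "x \<in> carrier (mat_prod_alg m)"
    note supp = mat_prod_alg_supp[OF this]
    show "\<one>\<^bsub>mat_prod_alg m\<^esub> \<otimes>\<^bsub>mat_prod_alg m\<^esub> x = x" "x \<otimes>\<^bsub>mat_prod_alg m\<^esub> \<one>\<^bsub>mat_prod_alg m\<^esub> = x"
      unfolding mat_prod_alg_simps by (intro ext[of _ x] mmul_one supp; assumption)+
  qed (simp_all add: mat_prod_alg_closed mat_prod_alg_zero_one mmul_assoc)
qed (simp_all add: mmul_add_left mmul_add_right)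

lemma mat_prod_alg_minus:
  assumes "x \<in> carrier (mat_prod_alg m)" "y \<in> carrier (mat_prod_alg m)"
  shows "x \<ominus>\<^bsub>mat_prod_alg m\<^esub> y = (\<lambda>n i j. x n i j - y n i j)"
    and "\<ominus>\<^bsub>mat_prod_alg m\<^esub> y = (\<lambda>n i j. - y n i j)"
proof -
  interpret ring "mat_prod_alg m" by (rule mat_prod_alg_ring)
  show "\<ominus>\<^bsub>mat_prod_alg m\<^esub> y = (\<lambda>n i j. - y n i j)"
    by (rule minus_equality) (use assms mat_prod_alg_closed(6) in simp_all)
  then show "x \<ominus>\<^bsub>mat_prod_alg m\<^esub> y = (\<lambda>n i j. x n i j - y n i j)"
    by (simp add: a_minus_def)
qed

lemma mat_c0_ideal_iff:
  "x \<in> mat_c0_ideal m \<longleftrightarrow> x \<in> carrier (mat_prod_alg m) \<and> (\<lambda>n. opnorm (m n) (x n)) \<longlonglongrightarrow> 0"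
  by (simp add: mat_c0_ideal_def)

lemma mat_c0_idealI:
  assumes "x \<in> carrier (mat_prod_alg m)" "a \<longlonglongrightarrow> 0" "\<And>n. opnorm (m n) (x n) \<le> a n"
  shows "x \<in> mat_c0_ideal m"
  unfolding mat_c0_ideal_iff
  using assms(1) tendsto_zero_squeeze[OF opnorm_nonneg assms(3,2)] by (rule conjI)

lemma mat_c0_ideal: "ideal (mat_c0_ideal m) (mat_prod_alg m)"
proof (rule idealI[OF mat_prod_alg_ring])
  interpret ring "mat_prod_alg m" by (rule mat_prod_alg_ring)
  show "subgroup (mat_c0_ideal m) (add_monoid (mat_prod_alg m))"
  proof (rule group.subgroupI[OF a_group])
    show "mat_c0_ideal m \<subseteq> carrier (add_monoid (mat_prod_alg m))"
      by (auto simp: mat_c0_ideal_iff)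
    have "(\<lambda>n i j. 0) \<in> mat_c0_ideal m"
      by (simp add: mat_c0_ideal_iff mat_prod_alg_zero_one)
    then show "mat_c0_ideal m \<noteq> {}" by blast
  next
    fix x assume "x \<in> mat_c0_ideal m"
    then show "inv\<^bsub>add_monoid (mat_prod_alg m)\<^esub> x \<in> mat_c0_ideal m"
      unfolding a_inv_def[symmetric] mat_c0_ideal_iff
      using mat_prod_alg_minus(2)[of x m x] mat_prod_alg_closed(6)[of x m] by simp
  next
    fix x y assume x: "x \<in> mat_c0_ideal m" and y: "y \<in> mat_c0_ideal m"
    have "(\<lambda>n i j. x n i j + y n i j) \<in> mat_c0_ideal m"
    proof (rule mat_c0_idealI)
      show "(\<lambda>n i j. x n i j + y n i j) \<in> carrier (mat_prod_alg m)"
        using x y by (simp add: mat_c0_ideal_iff mat_prod_alg_closed)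
      show "(\<lambda>n. opnorm (m n) (x n) + opnorm (m n) (y n)) \<longlonglongrightarrow> 0"
        using x y tendsto_add[of "\<lambda>n. opnorm (m n) (x n)" 0 sequentially "\<lambda>n. opnorm (m n) (y n)" 0]
        by (simp add: mat_c0_ideal_iff)
    qed (rule opnorm_add)
    then show "x \<otimes>\<^bsub>add_monoid (mat_prod_alg m)\<^esub> y \<in> mat_c0_ideal m" by simp
  qed
next
  fix a x assume a: "a \<in> mat_c0_ideal m" and x: "x \<in> carrier (mat_prod_alg m)"
  obtain B where B: "B \<ge> 0" "\<And>n. opnorm (m n) (x n) \<le> B" using mat_prod_alg_bound[OF x] by blast
  have lim: "(\<lambda>n. B * opnorm (m n) (a n)) \<longlonglongrightarrow> 0"
    using a tendsto_mult_left[of "\<lambda>n. opnorm (m n) (a n)" 0 sequentially B] by (simp add: mat_c0_ideal_iff)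
  have ca: "a \<in> carrier (mat_prod_alg m)" using a by (simp add: mat_c0_ideal_iff)
  have "(\<lambda>n. mmul (m n) (x n) (a n)) \<in> mat_c0_ideal m"
    by (rule mat_c0_idealI[OF mat_prod_alg_closed(2)[OF x ca] lim])
      (intro order_trans[OF opnorm_mult] mult_right_mono B opnorm_nonneg)
  then show "x \<otimes>\<^bsub>mat_prod_alg m\<^esub> a \<in> mat_c0_ideal m" by simp
  have "(\<lambda>n. mmul (m n) (a n) (x n)) \<in> mat_c0_ideal m"
    by (rule mat_c0_idealI[OF mat_prod_alg_closed(2)[OF ca x] lim], subst mult.commute)
      (intro order_trans[OF opnorm_mult] mult_left_mono B opnorm_nonneg)
  then show "a \<otimes>\<^bsub>mat_prod_alg m\<^esub> x \<in> mat_c0_ideal m" by simp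
qed

abbreviation c0_coset :: "(nat \<Rightarrow> nat) \<Rightarrow> (nat \<Rightarrow> nat \<Rightarrow> nat \<Rightarrow> complex) \<Rightarrow> (nat \<Rightarrow> nat \<Rightarrow> nat \<Rightarrow> complex) set"
  where "c0_coset m x \<equiv> mat_c0_ideal m +>\<^bsub>mat_prod_alg m\<^esub> x"

abbreviation quot_mat_alg :: "(nat \<Rightarrow> nat) \<Rightarrow> (nat \<Rightarrow> nat \<Rightarrow> nat \<Rightarrow> complex) set normed_star_alg"
  where "quot_mat_alg m \<equiv> quot_alg (mat_prod_alg m) (mat_c0_ideal m)"

text \<open>
  Equality in the quotient thus means that the distance of representatives tends to zero.
\<close>

lemma mem_c0_coset:
  assumes x: "x \<in> carrier (mat_prod_alg m)"
  shows "z \<in> c0_coset m x \<longleftrightarrow> z \<in> carrier (mat_prod_alg m) \<and> (\<lambda>n. mat_dist (m n) (z n) (x n)) \<longlonglongrightarrow> 0"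
proof
  assume "z \<in> c0_coset m x"
  then obtain h where h: "h \<in> mat_c0_ideal m" and z: "z = (\<lambda>n i j. h n i j + x n i j)"
    unfolding a_r_coset_def' by auto
  have "h \<in> carrier (mat_prod_alg m)" using h by (simp add: mat_c0_ideal_iff)
  from mat_prod_alg_closed(1)[OF this x] have "z \<in> carrier (mat_prod_alg m)" unfolding z .
  moreover have "(\<lambda>n. mat_dist (m n) (z n) (x n)) \<longlonglongrightarrow> 0"
    using h by (simp add: z mat_dist_def mat_c0_ideal_iff)
  ultimately show "z \<in> carrier (mat_prod_alg m) \<and> (\<lambda>n. mat_dist (m n) (z n) (x n)) \<longlonglongrightarrow> 0" ..
next
  assume z: "z \<in> carrier (mat_prod_alg m) \<and> (\<lambda>n. mat_dist (m n) (z n) (x n)) \<longlonglongrightarrow> 0"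
  define h where "h = (\<lambda>n i j. z n i j - x n i j)"
  have "h \<in> carrier (mat_prod_alg m)"
    unfolding h_def using mat_prod_alg_closed(5)[of z m x] z x by blast
  then have h: "h \<in> mat_c0_ideal m"
    using z by (simp add: mat_c0_ideal_iff h_def mat_dist_def)
  have eq: "z = h \<oplus>\<^bsub>mat_prod_alg m\<^esub> x"
    by (simp add: h_def)
  show "z \<in> c0_coset m x"
    unfolding a_r_coset_def' using h eq by blast
qed

lemma c0_coset_eq_iff:
  assumes x: "x \<in> carrier (mat_prod_alg m)" and y: "y \<in> carrier (mat_prod_alg m)"
  shows "c0_coset m x = c0_coset m y \<longleftrightarrow> (\<lambda>n. mat_dist (m n) (x n) (y n)) \<longlonglongrightarrow> 0"
proof
  assume "c0_coset m x = c0_coset m y"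
  moreover have "x \<in> c0_coset m x" using x by (simp add: mem_c0_coset)
  ultimately show "(\<lambda>n. mat_dist (m n) (x n) (y n)) \<longlonglongrightarrow> 0" using mem_c0_coset[OF y] by blast
next
  assume lim: "(\<lambda>n. mat_dist (m n) (x n) (y n)) \<longlonglongrightarrow> 0"
  have trans: "(\<lambda>n. mat_dist (m n) (z n) (w n)) \<longlonglongrightarrow> 0"
    if "(\<lambda>n. mat_dist (m n) (z n) (v n)) \<longlonglongrightarrow> 0" "(\<lambda>n. mat_dist (m n) (v n) (w n)) \<longlonglongrightarrow> 0" for z v w
    by (rule tendsto_sandwich[OF _ _ tendsto_const tendsto_add[OF that, simplified]])
      (simp_all add: mat_dist_triangle)
  have "(\<lambda>n. mat_dist (m n) (y n) (x n)) \<longlonglongrightarrow> 0" using lim by (simp only: mat_dist_commute)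
  then show "c0_coset m x = c0_coset m y"
    using lim trans unfolding set_eq_iff mem_c0_coset[OF x] mem_c0_coset[OF y] by blast
qed

lemma quot_mat_alg_carrier:
  "X \<in> carrier (quot_mat_alg m) \<longleftrightarrow> (\<exists>x\<in>carrier (mat_prod_alg m). X = c0_coset m x)"
  by (auto simp: quot_alg_def FactRing_def A_RCOSETS_def')

lemma quot_mat_alg_zero: "\<zero>\<^bsub>quot_mat_alg m\<^esub> = c0_coset m (\<lambda>n i j. 0)"
proof -
  have "\<zero>\<^bsub>quot_mat_alg m\<^esub> = mat_c0_ideal m" by (simp add: quot_alg_def FactRing_def)
  also have "\<dots> = c0_coset m (\<lambda>n i j. 0)"
    using mat_prod_alg_zero_one(1)[of m] by (auto simp: mem_c0_coset mat_c0_ideal_iff mat_dist_def)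
  finally show ?thesis .
qed

lemma quot_mat_alg_add:
  assumes "x \<in> carrier (mat_prod_alg m)" "y \<in> carrier (mat_prod_alg m)"
  shows "c0_coset m x \<oplus>\<^bsub>quot_mat_alg m\<^esub> c0_coset m y = c0_coset m (\<lambda>n i j. x n i j + y n i j)"
proof -
  interpret ideal "mat_c0_ideal m" "mat_prod_alg m" by (rule mat_c0_ideal)
  show ?thesis using a_rcos_sum[OF assms] by (simp add: quot_alg_def FactRing_def)
qed

lemma quot_mat_alg_mult:
  assumes "x \<in> carrier (mat_prod_alg m)" "y \<in> carrier (mat_prod_alg m)"
  shows "c0_coset m x \<otimes>\<^bsub>quot_mat_alg m\<^esub> c0_coset m y = c0_coset m (\<lambda>n. mmul (m n) (x n) (y n))"
proof -
  interpret ideal "mat_c0_ideal m" "mat_prod_alg m" by (rule mat_c0_ideal)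
  show ?thesis using rcoset_mult_add[OF assms] by (simp add: quot_alg_def FactRing_def)
qed

lemma quot_mat_alg_scale:
  assumes x: "x \<in> carrier (mat_prod_alg m)"
  shows "c \<odot>\<^bsub>quot_mat_alg m\<^esub> c0_coset m x = c0_coset m (\<lambda>n i j. c * x n i j)"
proof -
  have "c0_coset m (\<lambda>n i j. c * z n i j) = c0_coset m (\<lambda>n i j. c * x n i j)" if "z \<in> c0_coset m x" for z
  proof -
    have z: "z \<in> carrier (mat_prod_alg m)" "(\<lambda>n. mat_dist (m n) (z n) (x n)) \<longlonglongrightarrow> 0"
      using that mem_c0_coset[OF x] by blast+
    have le: "mat_dist (m n) (\<lambda>i j. c * z n i j) (\<lambda>i j. c * x n i j) \<le> cmod c * mat_dist (m n) (z n) (x n)" for n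
      using opnorm_scale_le[of "m n" c "\<lambda>i j. z n i j - x n i j"] by (simp add: mat_dist_def right_diff_distrib)
    have lim: "(\<lambda>n. cmod c * mat_dist (m n) (z n) (x n)) \<longlonglongrightarrow> 0"
      using tendsto_mult_left[OF z(2), of "cmod c"] by simp
    have "(\<lambda>n. mat_dist (m n) (\<lambda>i j. c * z n i j) (\<lambda>i j. c * x n i j)) \<longlonglongrightarrow> 0"
      by (rule tendsto_zero_squeeze[OF mat_dist_nonneg le lim])
    then show ?thesis
      unfolding c0_coset_eq_iff[OF mat_prod_alg_closed(3)[OF z(1)] mat_prod_alg_closed(3)[OF x]] .
  qed
  moreover have "x \<in> c0_coset m x" using x by (simp add: mem_c0_coset)
  ultimately have "(\<Union>z\<in>c0_coset m x. c0_coset m (\<lambda>n i j. c * z n i j)) = c0_coset m (\<lambda>n i j. c * x n i j)"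
    by blast
  then show ?thesis by (simp add: quot_alg_def)
qed

lemma quot_mat_alg_star:
  assumes x: "x \<in> carrier (mat_prod_alg m)"
  shows "star (quot_mat_alg m) (c0_coset m x) = c0_coset m (\<lambda>n. madj (x n))"
proof -
  have sub: "(\<lambda>n. madj (z n)) \<in> c0_coset m (\<lambda>n. madj (y n))"
    if "z \<in> c0_coset m y" "y \<in> carrier (mat_prod_alg m)" for y z
    using that mat_prod_alg_closed(4)[of z m] mat_prod_alg_closed(4)[of y m]
    by (simp add: mem_c0_coset mat_dist_madj)
  have "(\<lambda>z n. madj (z n)) ` c0_coset m x = c0_coset m (\<lambda>n. madj (x n))"
  proof
    show "(\<lambda>z n. madj (z n)) ` c0_coset m x \<subseteq> c0_coset m (\<lambda>n. madj (x n))"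
      using sub[OF _ x] by blast
    show "c0_coset m (\<lambda>n. madj (x n)) \<subseteq> (\<lambda>z n. madj (z n)) ` c0_coset m x"
    proof
      fix z assume "z \<in> c0_coset m (\<lambda>n. madj (x n))"
      from sub[OF this mat_prod_alg_closed(4)[OF x]] show "z \<in> (\<lambda>z n. madj (z n)) ` c0_coset m x"
        by (intro image_eqI[of _ _ "\<lambda>n. madj (z n)"]) simp_all
    qed
  qed
  moreover have "star (mat_prod_alg m) = (\<lambda>z n. madj (z n))" by (rule ext) simp
  ultimately show ?thesis by (simp add: quot_alg_def)
qed

lemma quot_mat_alg_minus:
  assumes x: "x \<in> carrier (mat_prod_alg m)" and y: "y \<in> carrier (mat_prod_alg m)"
  shows "c0_coset m x \<ominus>\<^bsub>quot_mat_alg m\<^esub> c0_coset m y = c0_coset m (\<lambda>n i j. x n i j - y n i j)"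
proof -
  interpret ideal "mat_c0_ideal m" "mat_prod_alg m" by (rule mat_c0_ideal)
  interpret h: ring_hom_ring "mat_prod_alg m" "mat_prod_alg m Quot mat_c0_ideal m" "\<lambda>x. c0_coset m x"
    by (rule rcos_ring_hom_ring)
  have "\<ominus>\<^bsub>quot_mat_alg m\<^esub> c0_coset m y = \<ominus>\<^bsub>mat_prod_alg m Quot mat_c0_ideal m\<^esub> c0_coset m y"
    by (simp add: a_inv_def m_inv_def quot_alg_def)
  also have "\<dots> = c0_coset m (\<lambda>n i j. - y n i j)"
    using h.hom_a_inv[OF y] mat_prod_alg_minus(2)[OF y y] by simp
  finally show ?thesis
    using quot_mat_alg_add[OF x mat_prod_alg_closed(6)[OF y]] by (simp add: a_minus_def)
qed

text \<open>
  This is one half of the fact that the quotient norm is the limes superior of the norms: a representative with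
  all norms below some \<open>s < \<delta>\<close> differs from \<open>z\<close> by a null sequence.
\<close>

lemma quot_mat_alg_nrm_less:
  assumes z: "z \<in> carrier (mat_prod_alg m)" and less: "nrm (quot_mat_alg m) (c0_coset m z) < \<delta>"
  shows "\<forall>\<^sub>F n in sequentially. opnorm (m n) (z n) < \<delta>"
proof -
  have "z \<in> c0_coset m z" using z by (simp add: mem_c0_coset)
  moreover have "(INF x\<in>c0_coset m z. SUP n. opnorm (m n) (x n)) < \<delta>"
    using less by (simp add: quot_alg_def)
  ultimately obtain x where x: "x \<in> c0_coset m z" and sup: "(SUP n. opnorm (m n) (x n)) < \<delta>"
    using cInf_lessD[of "(\<lambda>x. SUP n. opnorm (m n) (x n)) ` c0_coset m z" \<delta>] by blast
  have xc: "x \<in> carrier (mat_prod_alg m)" and lim: "(\<lambda>n. mat_dist (m n) (x n) (z n)) \<longlonglongrightarrow> 0"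
    using x mem_c0_coset[OF z] by blast+
  define s where "s = (SUP n. opnorm (m n) (x n))"
  obtain B where "\<And>n. opnorm (m n) (x n) \<le> B" using mat_prod_alg_bound[OF xc] by blast
  then have "bdd_above (range (\<lambda>n. opnorm (m n) (x n)))" by (rule bdd_aboveI2)
  then have le: "opnorm (m n) (x n) \<le> s" for n
    unfolding s_def by (rule cSUP_upper[OF UNIV_I])
  have "\<forall>\<^sub>F n in sequentially. mat_dist (m n) (x n) (z n) < \<delta> - s"
    by (rule order_tendstoD(2)[OF lim]) (use sup in \<open>simp add: s_def\<close>)
  then show ?thesis
  proof eventually_elim
    case (elim n)
    then show ?case
      using le[of n] opnorm_le_add_mat_dist[of "m n" "z n" "x n"] mat_dist_commute[of "m n" "z n" "x n"] by linarith
  qed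
qed

context
  fixes m :: "nat \<Rightarrow> nat" and \<phi> :: "nat \<Rightarrow> 'a::cstar_algebra_1 \<Rightarrow> nat \<Rightarrow> nat \<Rightarrow> complex"
  assumes emb: "asymptotic_embedding m \<phi>"
begin

lemma embedding_carrier: "(\<lambda>n. \<phi> n x) \<in> carrier (mat_prod_alg m)"
  using emb unfolding asymptotic_embedding_def mat_prod_alg_carrier by simp

lemma embedding_limits:
  "(\<lambda>n. mat_dist (m n) (\<phi> n (x + y)) (\<lambda>i j. \<phi> n x i j + \<phi> n y i j)) \<longlonglongrightarrow> 0"
  "(\<lambda>n. mat_dist (m n) (\<phi> n (x * y)) (mmul (m n) (\<phi> n x) (\<phi> n y))) \<longlonglongrightarrow> 0"
  "(\<lambda>n. mat_dist (m n) (\<phi> n (scaleC c x)) (\<lambda>i j. c * \<phi> n x i j)) \<longlonglongrightarrow> 0"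
  "(\<lambda>n. mat_dist (m n) (\<phi> n (adj x)) (madj (\<phi> n x))) \<longlonglongrightarrow> 0"
  "\<delta> > 0 \<Longrightarrow> \<forall>\<^sub>F n in sequentially. opnorm (m n) (\<phi> n x) < norm x + \<delta>"
  "\<delta> > 0 \<Longrightarrow> \<exists>\<^sub>F n in sequentially. norm x - \<delta> < opnorm (m n) (\<phi> n x)"
  using emb by (simp_all only: asymptotic_embedding_def)

text \<open>
  Additivity is applied to \<open>x = (x - y) + y\<close>.
\<close>

lemma embedding_diff:
  "(\<lambda>n. \<bar>opnorm (m n) (\<phi> n (x - y)) - mat_dist (m n) (\<phi> n x) (\<phi> n y)\<bar>) \<longlonglongrightarrow> 0"
proof (rule tendsto_sandwich[OF _ _ tendsto_const embedding_limits(1)[of "x - y" y]])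
  have "\<bar>opnorm (m n) (\<phi> n (x - y)) - mat_dist (m n) (\<phi> n x) (\<phi> n y)\<bar>
      \<le> mat_dist (m n) (\<phi> n (x - y + y)) (\<lambda>i j. \<phi> n (x - y) i j + \<phi> n y i j)" for n
  proof -
    let ?a = "\<phi> n (x - y)" and ?b = "\<phi> n x" and ?c = "\<phi> n y"
    have "mat_dist (m n) (\<lambda>i j. ?a i j + ?c i j) ?c = opnorm (m n) ?a"
      by (simp add: mat_dist_def)
    then show ?thesis
      using mat_dist_triangle[of "m n" "\<lambda>i j. ?a i j + ?c i j" ?c ?b]
        mat_dist_triangle[of "m n" ?b ?c "\<lambda>i j. ?a i j + ?c i j"]
        mat_dist_commute[of "m n" ?b "\<lambda>i j. ?a i j + ?c i j"] by (simp add: abs_le_iff)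
  qed
  then show "\<forall>\<^sub>F n in sequentially. \<bar>opnorm (m n) (\<phi> n (x - y)) - mat_dist (m n) (\<phi> n x) (\<phi> n y)\<bar>
      \<le> mat_dist (m n) (\<phi> n (x - y + y)) (\<lambda>i j. \<phi> n (x - y) i j + \<phi> n y i j)" by simp
qed simp

text \<open>
  The norm of \<open>\<phi> n (x - y)\<close> is infinitely often close to \<open>\<parallel>x - y\<parallel>\<close>, and it is eventually close to the distance of
  \<open>\<phi> n x\<close> and \<open>\<phi> n y\<close>. Together with the next lemma this expresses that the embedding into the quotient is
  isometric.
\<close>

lemma norm_diff_le_if_embedding_close:
  assumes close: "\<forall>\<^sub>F n in sequentially. mat_dist (m n) (\<phi> n x) (\<phi> n y) < r"
  shows "norm (x - y) \<le> r"
proof (rule field_le_epsilon)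
  fix \<delta> :: real assume \<delta>: "\<delta> > 0"
  have "\<forall>\<^sub>F n in sequentially. \<bar>opnorm (m n) (\<phi> n (x - y)) - mat_dist (m n) (\<phi> n x) (\<phi> n y)\<bar> < \<delta> / 2"
    by (rule order_tendstoD(2)[OF embedding_diff]) (use \<delta> in simp)
  with close have "\<forall>\<^sub>F n in sequentially. opnorm (m n) (\<phi> n (x - y)) < r + \<delta> / 2"
    by eventually_elim linarith
  moreover have "\<exists>\<^sub>F n in sequentially. norm (x - y) - \<delta> / 2 < opnorm (m n) (\<phi> n (x - y))"
    by (rule embedding_limits(6)) (use \<delta> in simp)
  ultimately have "\<exists>\<^sub>F n in sequentially. opnorm (m n) (\<phi> n (x - y)) < r + \<delta> / 2 \<and>
      norm (x - y) - \<delta> / 2 < opnorm (m n) (\<phi> n (x - y))"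
    by (intro frequently_eventually_conj)
  from frequently_ex[OF this] show "norm (x - y) \<le> r + \<delta>" by auto
qed

lemma embedding_close_if_norm_diff:
  assumes "norm (x - y) < r"
  shows "\<forall>\<^sub>F n in sequentially. mat_dist (m n) (\<phi> n x) (\<phi> n y) < r"
proof -
  define \<delta> where "\<delta> = (r - norm (x - y)) / 2"
  have \<delta>: "\<delta> > 0" using assms by (simp add: \<delta>_def)
  have "\<forall>\<^sub>F n in sequentially. \<bar>opnorm (m n) (\<phi> n (x - y)) - mat_dist (m n) (\<phi> n x) (\<phi> n y)\<bar> < \<delta>"
    by (rule order_tendstoD(2)[OF embedding_diff \<delta>])
  then show ?thesis
    using embedding_limits(5)[OF \<delta>, of "x - y"]
    by eventually_elim (simp add: \<delta>_def abs_less_iff, argo)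
qed

text \<open>
  Points of the algebra whose images approximate \<open>w\<close> form a Cauchy sequence, because distances in the algebra are
  bounded by asymptotic distances of images; the image of its limit is asymptotically equal to \<open>w\<close>.
\<close>

lemma embedding_image_closed:
  assumes w: "w \<in> carrier (mat_prod_alg m)"
    and appr: "\<And>\<delta>. \<delta> > 0 \<Longrightarrow> \<exists>x. \<forall>\<^sub>F n in sequentially. mat_dist (m n) (w n) (\<phi> n x) < \<delta>"
  obtains x where "(\<lambda>n. mat_dist (m n) (w n) (\<phi> n x)) \<longlonglongrightarrow> 0"
proof -
  have "\<forall>k. \<exists>x. \<forall>\<^sub>F n in sequentially. mat_dist (m n) (w n) (\<phi> n x) < inverse (real (Suc k))"
    by (intro allI appr) simp
  then obtain y where y: "\<forall>k. \<forall>\<^sub>F n in sequentially. mat_dist (m n) (w n) (\<phi> n (y k)) < inverse (real (Suc k))"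
    unfolding choice_iff by blast
  have dist_y: "norm (y k - y l) \<le> inverse (real (Suc k)) + inverse (real (Suc l))" for k l
  proof (rule norm_diff_le_if_embedding_close)
    have "\<forall>\<^sub>F n in sequentially. mat_dist (m n) (w n) (\<phi> n (y k)) < inverse (real (Suc k))"
      "\<forall>\<^sub>F n in sequentially. mat_dist (m n) (w n) (\<phi> n (y l)) < inverse (real (Suc l))" using y by blast+
    then show "\<forall>\<^sub>F n in sequentially. mat_dist (m n) (\<phi> n (y k)) (\<phi> n (y l)) < inverse (real (Suc k)) + inverse (real (Suc l))"
    proof eventually_elim
      case (elim n)
      then show ?case
        using mat_dist_triangle[of "m n" "\<phi> n (y k)" "\<phi> n (y l)" "w n"] mat_dist_commute[of "m n" "w n" "\<phi> n (y k)"]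
        by linarith
    qed
  qed
  have small: "\<exists>N. \<forall>k\<ge>N. inverse (real (Suc k)) < \<delta>" if "\<delta> > 0" for \<delta>
    using order_tendstoD(2)[OF LIMSEQ_inverse_real_of_nat that] unfolding eventually_sequentially .
  have "Cauchy y"
  proof (rule metric_CauchyI)
    fix \<delta> :: real assume "\<delta> > 0"
    then obtain N where N: "\<forall>k\<ge>N. inverse (real (Suc k)) < \<delta> / 2" using small[of "\<delta> / 2"] by auto
    have "dist (y k) (y l) < \<delta>" if "k \<ge> N" "l \<ge> N" for k l
      using dist_y[of k l] N[rule_format, OF that(1)] N[rule_format, OF that(2)]
      unfolding dist_norm by linarith
    then show "\<exists>N. \<forall>k\<ge>N. \<forall>l\<ge>N. dist (y k) (y l) < \<delta>" by blast
  qed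
  then obtain x where x: "y \<longlonglongrightarrow> x" using Cauchy_convergent convergent_def by blast
  have "(\<lambda>n. mat_dist (m n) (w n) (\<phi> n x)) \<longlonglongrightarrow> 0"
  proof (rule tendstoI)
    fix \<delta> :: real assume \<delta>: "\<delta> > 0"
    obtain N where N: "\<forall>k\<ge>N. inverse (real (Suc k)) < \<delta> / 2" using small[of "\<delta> / 2"] \<delta> by auto
    obtain M where M: "\<forall>k\<ge>M. dist (y k) x < \<delta> / 2" using metric_LIMSEQ_D[OF x, of "\<delta> / 2"] \<delta> by auto
    define k where "k = max N M"
    have "norm (y k - x) < \<delta> / 2" using M[rule_format, of k] by (simp add: k_def dist_norm)
    from embedding_close_if_norm_diff[OF this] y[rule_format, of k]
    show "\<forall>\<^sub>F n in sequentially. dist (mat_dist (m n) (w n) (\<phi> n x)) 0 < \<delta>"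
    proof eventually_elim
      case (elim n)
      have "inverse (real (Suc k)) < \<delta> / 2" using N by (simp add: k_def)
      with elim have "mat_dist (m n) (w n) (\<phi> n x) < \<delta>"
        using mat_dist_triangle[of "m n" "w n" "\<phi> n x" "\<phi> n (y k)"] by linarith
      then show ?case by simp
    qed
  qed
  then show thesis by (rule that)
qed

lemma coset_embedding_hom:
  "c0_coset m (\<lambda>n. \<phi> n (x + y)) = c0_coset m (\<lambda>n. \<phi> n x) \<oplus>\<^bsub>quot_mat_alg m\<^esub> c0_coset m (\<lambda>n. \<phi> n y)"
  "c0_coset m (\<lambda>n. \<phi> n (x * y)) = c0_coset m (\<lambda>n. \<phi> n x) \<otimes>\<^bsub>quot_mat_alg m\<^esub> c0_coset m (\<lambda>n. \<phi> n y)"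
  "c0_coset m (\<lambda>n. \<phi> n (scaleC c x)) = c \<odot>\<^bsub>quot_mat_alg m\<^esub> c0_coset m (\<lambda>n. \<phi> n x)"
  "c0_coset m (\<lambda>n. \<phi> n (adj x)) = star (quot_mat_alg m) (c0_coset m (\<lambda>n. \<phi> n x))"
proof -
  note c = embedding_carrier and eqI = c0_coset_eq_iff[THEN iffD2, OF embedding_carrier]
  show "c0_coset m (\<lambda>n. \<phi> n (x + y)) = c0_coset m (\<lambda>n. \<phi> n x) \<oplus>\<^bsub>quot_mat_alg m\<^esub> c0_coset m (\<lambda>n. \<phi> n y)"
    unfolding quot_mat_alg_add[OF c c] by (rule eqI[OF mat_prod_alg_closed(1)[OF c c] embedding_limits(1)])
  show "c0_coset m (\<lambda>n. \<phi> n (x * y)) = c0_coset m (\<lambda>n. \<phi> n x) \<otimes>\<^bsub>quot_mat_alg m\<^esub> c0_coset m (\<lambda>n. \<phi> n y)"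
    unfolding quot_mat_alg_mult[OF c c] by (rule eqI[OF mat_prod_alg_closed(2)[OF c c] embedding_limits(2)])
  show "c0_coset m (\<lambda>n. \<phi> n (scaleC c x)) = c \<odot>\<^bsub>quot_mat_alg m\<^esub> c0_coset m (\<lambda>n. \<phi> n x)"
    unfolding quot_mat_alg_scale[OF c] by (rule eqI[OF mat_prod_alg_closed(3)[OF c] embedding_limits(3)])
  show "c0_coset m (\<lambda>n. \<phi> n (adj x)) = star (quot_mat_alg m) (c0_coset m (\<lambda>n. \<phi> n x))"
    unfolding quot_mat_alg_star[OF c] by (rule eqI[OF mat_prod_alg_closed(4)[OF c] embedding_limits(4)])
qed

lemma coset_embedding_zero: "c0_coset m (\<lambda>n. \<phi> n 0) = \<zero>\<^bsub>quot_mat_alg m\<^esub>"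
proof -
  have "(\<lambda>n. mat_dist (m n) (\<phi> n 0) (\<lambda>i j. 0)) \<longlonglongrightarrow> 0"
    using embedding_limits(3)[where c = 0 and x = 0] unfolding scaleC_zero_left mult_zero_left .
  then show ?thesis
    unfolding quot_mat_alg_zero
    by (rule c0_coset_eq_iff[THEN iffD2, OF embedding_carrier mat_prod_alg_zero_one(1)])
qed

lemma coset_embedding_inj:
  assumes "c0_coset m (\<lambda>n. \<phi> n x) = c0_coset m (\<lambda>n. \<phi> n y)" shows "x = y"
proof -
  have lim: "(\<lambda>n. mat_dist (m n) (\<phi> n x) (\<phi> n y)) \<longlonglongrightarrow> 0"
    using assms by (rule c0_coset_eq_iff[THEN iffD1, OF embedding_carrier embedding_carrier])
  have "norm (x - y) \<le> 0 + \<delta>" if "\<delta> > 0" for \<delta>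
    using norm_diff_le_if_embedding_close[OF order_tendstoD(2)[OF lim that]] by simp
  then have "norm (x - y) \<le> 0" by (rule field_le_epsilon)
  then show ?thesis by simp
qed

theorem asymptotic_embedding_imp_MF:
  assumes pos: "\<And>n. m n > 0"
  shows "MF (univ_alg :: 'a normed_star_alg)"
proof -
  define \<Phi> where "\<Phi> x = c0_coset m (\<lambda>n. \<phi> n x)" for x
  note hom = coset_embedding_hom[folded \<Phi>_def]
  have "cstar_subalgebra (quot_mat_alg m) (range \<Phi>)"
    unfolding cstar_subalgebra_def
  proof (intro conjI ballI allI impI)
    show "range \<Phi> \<subseteq> carrier (quot_mat_alg m)"
      unfolding image_subset_iff quot_mat_alg_carrier \<Phi>_def using embedding_carrier by blast
    show "\<zero>\<^bsub>quot_mat_alg m\<^esub> \<in> range \<Phi>"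
      unfolding coset_embedding_zero[folded \<Phi>_def, symmetric] by (rule rangeI)
    fix X assume "X \<in> range \<Phi>"
    then obtain x where X: "X = \<Phi> x" by blast
    show "c \<odot>\<^bsub>quot_mat_alg m\<^esub> X \<in> range \<Phi>" for c unfolding X hom(3)[symmetric] by (rule rangeI)
    show "star (quot_mat_alg m) X \<in> range \<Phi>" unfolding X hom(4)[symmetric] by (rule rangeI)
    fix Y assume "Y \<in> range \<Phi>"
    then obtain y where Y: "Y = \<Phi> y" by blast
    show "X \<oplus>\<^bsub>quot_mat_alg m\<^esub> Y \<in> range \<Phi>" unfolding X Y hom(1)[symmetric] by (rule rangeI)
    show "X \<otimes>\<^bsub>quot_mat_alg m\<^esub> Y \<in> range \<Phi>" unfolding X Y hom(2)[symmetric] by (rule rangeI)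
  next
    fix X assume "X \<in> carrier (quot_mat_alg m)"
      and close: "\<forall>e>0. \<exists>Y\<in>range \<Phi>. nrm (quot_mat_alg m) (X \<ominus>\<^bsub>quot_mat_alg m\<^esub> Y) < e"
    then obtain w where w: "w \<in> carrier (mat_prod_alg m)" and X: "X = c0_coset m w"
      unfolding quot_mat_alg_carrier by blast
    have "\<exists>x. \<forall>\<^sub>F n in sequentially. mat_dist (m n) (w n) (\<phi> n x) < \<delta>" if \<delta>: "\<delta> > 0" for \<delta>
    proof -
      obtain x where "nrm (quot_mat_alg m) (X \<ominus>\<^bsub>quot_mat_alg m\<^esub> \<Phi> x) < \<delta>" using close \<delta> by blast
      then have "nrm (quot_mat_alg m) (c0_coset m (\<lambda>n i j. w n i j - \<phi> n x i j)) < \<delta>"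
        unfolding X \<Phi>_def quot_mat_alg_minus[OF w embedding_carrier] .
      from quot_mat_alg_nrm_less[OF mat_prod_alg_closed(5)[OF w embedding_carrier] this]
      show ?thesis unfolding mat_dist_def by (rule exI)
    qed
    from embedding_image_closed[OF w this] obtain x where "(\<lambda>n. mat_dist (m n) (w n) (\<phi> n x)) \<longlonglongrightarrow> 0" .
    then have "X = \<Phi> x" unfolding X \<Phi>_def c0_coset_eq_iff[OF w embedding_carrier] .
    then show "X \<in> range \<Phi>" by blast
  qed
  moreover have "star_iso (univ_alg :: 'a normed_star_alg) ((quot_mat_alg m)\<lparr>carrier := range \<Phi>\<rparr>) \<Phi>"
    unfolding star_iso_def
  proof (intro conjI ballI allI)
    have "inj \<Phi>" using coset_embedding_inj unfolding \<Phi>_def by (rule injI)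
    then show "bij_betw \<Phi> (carrier univ_alg) (carrier ((quot_mat_alg m)\<lparr>carrier := range \<Phi>\<rparr>))"
      by (simp add: bij_betw_def)
  qed (simp_all add: hom)
  ultimately show ?thesis
    unfolding MF_def star_isomorphic_def using pos by blast
qed

end

theorem theorem4p1:
  assumes "separable_cstar TYPE('a::cstar_algebra_1)"
    and "simple_cstar TYPE('a)"
    and "TAI TYPE('a)"
  shows "MF (univ_alg :: 'a normed_star_alg)"
proof -
  obtain m and \<phi> :: "nat \<Rightarrow> 'a \<Rightarrow> nat \<Rightarrow> nat \<Rightarrow> complex"
    where "\<And>n. m n > 0" "asymptotic_embedding m \<phi>"
    by (rule TAI_asymptotic_embedding[OF assms(1,3)]) (rule that)
  then show ?thesis by (intro asymptotic_embedding_imp_MF)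
qed

end
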